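(* Let $(S_n)_{n\ge 0}$ be the random walk with two memory channels with memory parameter $p\in(0,1)$, $p\neq 7/8$. Then $$\frac{S_n}{n}\xrightarrow{\text{a.s.}}\Lambda_p:=c_p\,R,$$ where $R$ is a $\mathrm{Rad}(1/2)$ random variable and $$c_p=\begin{cases}0, & p\in(0,\tfrac78),\\[2pt] \dfrac{\sqrt{32p^2-52p+21}}{(2p-1)^2}, & p\in(\tfrac78,1).\end{cases}$$
   Context: A random variable is $\mathrm{Rad}(q)$ if it equals $+1$ with probability $q$ and $-1$ with probability $1-q$. Random walk with two memory channels with parameter $p\in(0,1)$: $S_0=0$; $X_1,X_2$ are i.i.d. $\mathrm{Rad}(1/2)$; for each $n\ge 2$, let $U_{1,n+1},U_{2,n+1}$ be i.i.d. uniform on $\{1,\dots,n\}$ and $\alpha_{1,n+1},\alpha_{2,n+1}$ i.i.d. $\mathrm{Rad}(p)$, all mutually independent and independent of $X_1,\dots,X_n$ (and of all earlier draws); set $T_{n+1}=\alpha_{1,n+1}X_{U_{1,n+1}}+\alpha_{2,n+1}X_{U_{2,n+1}}$ and $X_{n+1}=\max(-1,\min(1,T_{n+1}))\in\{-1,0,1\}$. Then $S_n=X_1+\dots+X_n$. *)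

theory Defs
  imports "HOL-Probability.Probability"
begin

definition rad_pmf :: "real \<Rightarrow> int pmf" where
  "rad_pmf q = map_pmf (\<lambda>b. if b then 1 else -1) (bernoulli_pmf q)"

definition clamp1 :: "int \<Rightarrow> int" where
  "clamp1 t = max (-1) (min 1 t)"

text \<open>Indices of the primitive random draws of the walk: X_1, X_2, and for m \<ge> 3
  the draws U_{1,m}, U_{2,m}, alpha_{1,m}, alpha_{2,m}.\<close>
datatype draw_idx = IX nat | IU1 nat | IU2 nat | IA1 nat | IA2 nat

definition draw_set :: "draw_idx set" where
  "draw_set = {IX 1, IX 2} \<union> IU1 ` {3..} \<union> IU2 ` {3..} \<union> IA1 ` {3..} \<union> IA2 ` {3..}"

fun draws :: "(nat \<Rightarrow> 'a \<Rightarrow> int) \<Rightarrow> (nat \<Rightarrow> 'a \<Rightarrow> nat) \<Rightarrow> (nat \<Rightarrow> 'a \<Rightarrow> nat)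
   \<Rightarrow> (nat \<Rightarrow> 'a \<Rightarrow> int) \<Rightarrow> (nat \<Rightarrow> 'a \<Rightarrow> int) \<Rightarrow> draw_idx \<Rightarrow> 'a \<Rightarrow> int" where
  "draws X U1 U2 A1 A2 (IX n) = X n"
| "draws X U1 U2 A1 A2 (IU1 n) = (\<lambda>w. int (U1 n w))"
| "draws X U1 U2 A1 A2 (IU2 n) = (\<lambda>w. int (U2 n w))"
| "draws X U1 U2 A1 A2 (IA1 n) = A1 n"
| "draws X U1 U2 A1 A2 (IA2 n) = A2 n"

definition walk_S :: "(nat \<Rightarrow> 'a \<Rightarrow> int) \<Rightarrow> nat \<Rightarrow> 'a \<Rightarrow> int" where
  "walk_S X n w = (\<Sum>i=1..n. X i w)"

definition c_p :: "real \<Rightarrow> real" where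
  "c_p p = (if p < 7/8 then 0 else sqrt (32*p^2 - 52*p + 21) / (2*p - 1)^2)"

end

theory Submission
  imports Defs
begin

text \<open>Let \<open>m = 2 p - 1\<close>, let \<open>x\<close> be \<open>S\<^sub>n / n\<close> and \<open>y\<close> the proportion of nonzero steps. Up to a noise term whose
  weighted sum converges almost surely, \<open>(x, y)\<close> is an Euler scheme with step \<open>1/(n+1)\<close> for the ODE
  \<open>x' = x (2 m - 1 - m y)\<close>, \<open>y' = y - 3/2 y\<^sup>2 + m\<^sup>2 x\<^sup>2 / 2\<close>. The expectation of \<open>1/y\<close> stays bounded, so \<open>y\<close> does
  not tend to 0, and then \<open>liminf y \<ge> 2/3\<close>. For \<open>p < 7/8\<close> this makes the equation for \<open>x\<close> contracting.
  For \<open>p > 7/8\<close> a strict Lyapunov function of predator-prey type forces \<open>x\<close> to converge to \<open>\<plusminus> c\<^sub>p\<close> unless it tends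
  to 0; in the latter case \<open>y\<close> tends to 2/3, which is impossible because then \<open>S\<^sub>n\<close> grows faster than \<open>n\<close>: the noise
  brings \<open>S\<^sub>n\<^sup>2 / n\<close> above any level, and from a high level it never returns with probability at least 1/2.
  The sign of the limit is fair because the law of the walk is invariant under \<open>X \<mapsto> - X\<close>.\<close>

section \<open>Asymptotically vanishing perturbations of the Euler scheme\<close>

text \<open>The threshold comes from linearising at \<open>(0, 2/3)\<close>: there \<open>x\<close>
  grows at rate \<open>2 m - 1 - 2/3 m = 4/3 m - 1\<close>, which is positive exactly when
  \<open>m > 3/4\<close>, that is \<open>p > 7/8\<close>. Equilibria with
  \<open>x \<noteq> 0\<close> have \<open>y = (2 m - 1) / m\<close>, and \<open>y' = 0\<close> at
  this height gives the value \<open>c_p\<close>. Noise and drift have the same order in each step,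
  so no step-by-step comparison works; instead the tail of the noise series is added to
  \<open>(x, y)\<close>, and the corrected path moves by the drift alone, which turns the dynamics
  into statements about one deterministic sequence. Near \<open>(0, 2/3)\<close> this view is blind,
  because the line \<open>x = 0\<close> is invariant for the ODE and only the variance of the steps
  drives the walk off it; so the escape is proved from expectations of potentials, on a window for
  \<open>y\<close> where the variance is bounded below. Since there are finitely many histories of
  each length, all conditioning is done by finite sums over them, and the functions involved are
  bounded.\<close>

lemma lyapunov_capture:
  fixes v :: "nat \<Rightarrow> real"
  assumes start: "v N \<le> T" and c: "c > 0" and le: "\<theta> \<le> \<theta>'" "\<theta>' \<le> T"
    and dec: "\<And>n. n \<ge> N \<Longrightarrow> \<theta> \<le> v n \<Longrightarrow> v n \<le> T \<Longrightarrow> v (Suc n) \<le> v n - c / real (Suc n)"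
    and stay: "\<And>n. n \<ge> N \<Longrightarrow> v n \<le> \<theta> \<Longrightarrow> v (Suc n) \<le> \<theta>'"
    and below: "\<And>n. n \<ge> N \<Longrightarrow> B \<le> v n"
  shows "\<forall>\<^sub>F n in sequentially. v n \<le> \<theta>'"
proof -
  have cap: "v n \<le> T" if "n \<ge> N" for n
    using that
  proof (induction n rule: dec_induct)
    case (step n)
    have "c / real (Suc n) > 0" using c by simp
    then show ?case
      using dec[of n] stay[of n] step le by linarith
  qed (rule start)
  \<comment> \<open>Staying above \<open>\<theta>\<close> forever would cost \<open>c\<close> times
    the divergent harmonic sum, against the lower bound \<open>B\<close>.\<close>
  have "\<exists>n\<ge>N. v n < \<theta>"
  proof (rule ccontr)
    assume "\<not> ?thesis"
    then have ge: "\<theta> \<le> v n" if "n \<ge> N" for n using that by force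
    have bound: "v n \<le> v N - c * (harm n - harm N)" if "n \<ge> N" for n
      using that
    proof (induction n rule: dec_induct)
      case (step n)
      have "v (Suc n) \<le> v n - c / real (Suc n)"
        using dec[of n] step ge cap by simp
      moreover have "c * (harm (Suc n) - harm N) = c * (harm n - harm N) + c / real (Suc n)"
        by (simp add: harm_Suc divide_inverse algebra_simps)
      ultimately show ?case using step by linarith
    qed simp
    have "filterlim (harm :: nat \<Rightarrow> real) at_top sequentially"
      by (rule harm_at_top)
    then have "\<forall>\<^sub>F n in sequentially. (harm n :: real) \<ge> (v N - B) / c + harm N + 1"
      by (simp add: filterlim_at_top)
    then have "\<forall>\<^sub>F n in sequentially. (harm n :: real) \<ge> (v N - B) / c + harm N + 1 \<and> n \<ge> N"
      using eventually_ge_at_top by (rule eventually_conj)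
    then obtain n where n: "(harm n :: real) \<ge> (v N - B) / c + harm N + 1" "n \<ge> N"
      using eventually_happens'[OF sequentially_bot] by blast
    then have "c * (harm n - harm N) \<ge> c * ((v N - B) / c + 1)"
      using c by (intro mult_left_mono) auto
    moreover have "c * ((v N - B) / c + 1) = v N - B + c"
      using c by (simp add: field_simps)
    ultimately have "c * (harm n - harm N) \<ge> v N - B + c" by linarith
    then show False
      using bound[OF n(2)] below[OF n(2)] c by linarith
  qed
  then obtain n0 where n0: "n0 \<ge> N" "v n0 < \<theta>" by blast
  \<comment> \<open>From below \<open>\<theta>\<close> one step overshoots at most to
    \<open>\<theta>'\<close>, and between \<open>\<theta>\<close> and \<open>\<theta>'\<close> the
    decrease still applies because \<open>\<theta>' \<le> T\<close>.\<close>
  have "v n \<le> \<theta>'" if "n \<ge> n0" for n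
    using that
  proof (induction n rule: dec_induct)
    case base
    then show ?case using n0 le by simp
  next
    case (step n)
    have "c / real (Suc n) > 0" using c by simp
    then show ?case
      using dec[of n] stay[of n] step n0 le cap[of n] by linarith
  qed
  then show ?thesis by (auto simp: eventually_sequentially)
qed

text \<open>Above any level \<open>r / 2\<close> the relative decrease becomes an absolute one with
  constant \<open>r / 2 * c\<close>, and \<open>lyapunov_capture\<close> applies. It serves the
  expectations in the escape argument.\<close>

lemma contraction_tendsto_zero:
  fixes a :: "nat \<Rightarrow> real"
  assumes c: "c > 0" and nonneg: "\<And>n. n \<ge> N \<Longrightarrow> 0 \<le> a n"
    and dec: "\<And>n. n \<ge> N \<Longrightarrow> a (Suc n) \<le> a n * (1 - c / real (Suc n))"
  shows "a \<longlonglongrightarrow> 0"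
proof (rule LIMSEQ_I)
  fix r :: real assume r: "r > 0"
  have less: "a (Suc n) \<le> a n - r / 2 * c / real (Suc n)" if "n \<ge> N" "r / 2 \<le> a n" for n
  proof -
    have "r / 2 * (c / real (Suc n)) \<le> a n * (c / real (Suc n))"
      using that c by (intro mult_right_mono) auto
    then show ?thesis using dec[OF that(1)] by (simp add: algebra_simps)
  qed
  have stay: "a (Suc n) \<le> a n" if "n \<ge> N" for n
  proof -
    have "0 \<le> a n * (c / real (Suc n))" using nonneg[OF that] c by simp
    then show ?thesis using dec[OF that] by (simp add: algebra_simps)
  qed
  have "\<forall>\<^sub>F n in sequentially. a n \<le> r / 2"
  proof (rule lyapunov_capture[where T = "max (a N) (r/2)" and N = N and c = "r / 2 * c" and \<theta> = "r / 2" and B = 0])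
    show "a (Suc n) \<le> r / 2" if "N \<le> n" "a n \<le> r / 2" for n
      using stay[OF that(1)] that(2) by linarith
  qed (use r c less nonneg in auto)
  then obtain n0 where n0: "\<forall>n\<ge>n0. a n \<le> r / 2"
    by (auto simp: eventually_sequentially)
  have "norm (a n - 0) < r" if "n \<ge> max n0 N" for n
  proof -
    have "a n \<le> r / 2" "0 \<le> a n" using n0 nonneg that by auto
    then show ?thesis using r by simp
  qed
  then show "\<exists>no. \<forall>n\<ge>no. norm (a n - 0) < r" by blast
qed

section \<open>The limiting drift and its perturbed Euler schemes\<close>

text \<open>An average over \<open>n\<close> terms moves by \<open>(X - x) / (n + 1)\<close>, so
  each drift is a conditional mean minus the current value: here \<open>m x (2 - y) - x\<close>, and
  in \<open>drift_y\<close> the probability \<open>2 y - 3/2 y^2 + m^2 x^2 / 2\<close> of a nonzero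
  step minus \<open>y\<close>.\<close>

definition drift_x :: "real \<Rightarrow> real \<Rightarrow> real \<Rightarrow> real" where
  "drift_x m x y = x * (2 * m - 1 - m * y)"

definition drift_y :: "real \<Rightarrow> real \<Rightarrow> real \<Rightarrow> real" where
  "drift_y m x y = y - 3/2 * y^2 + m^2 * x^2 / 2"

lemma abs_drift_x_le:
  assumes "\<bar>m\<bar> \<le> 1" "\<bar>x\<bar> \<le> y" "y \<le> 1"
  shows "\<bar>drift_x m x y\<bar> \<le> 4"
proof -
  have "\<bar>m * y\<bar> \<le> 1 * 1" unfolding abs_mult using assms by (intro mult_mono) auto
  then have "\<bar>2 * m - 1 - m * y\<bar> \<le> 4" using assms by linarith
  then have "\<bar>x\<bar> * \<bar>2 * m - 1 - m * y\<bar> \<le> 1 * 4" using assms by (intro mult_mono) auto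
  then show ?thesis by (simp add: drift_x_def abs_mult)
qed

lemma square_le_one: "\<bar>x\<bar> \<le> 1 \<Longrightarrow> x^2 \<le> (1::real)"
  by (simp add: abs_square_le_1)

lemma abs_drift_y_le:
  assumes "\<bar>m\<bar> \<le> 1" "\<bar>x\<bar> \<le> y" "y \<le> 1"
  shows "\<bar>drift_y m x y\<bar> \<le> 4"
proof -
  have "m^2 \<le> 1" "x^2 \<le> 1" "y^2 \<le> 1"
    using assms by (auto intro!: square_le_one)
  moreover from this have "m^2 * x^2 \<le> 1 * 1" by (intro mult_mono) auto
  moreover have "0 \<le> m^2 * x^2" "0 \<le> y^2" by auto
  ultimately show ?thesis unfolding drift_y_def using assms by linarith
qed

text \<open>A single path, free of probability: \<open>(x, y)\<close> is the walk and
  \<open>(xt, yt)\<close> its companion without noise. The drift is evaluated at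
  \<open>(x, y)\<close> and not at the companion, so every use pays an error controlled by
  \<open>xt - x\<close> and \<open>yt - y\<close>. The recursion starts at 2 because the first two
  steps follow their own law.\<close>

locale euler_scheme =
  fixes m :: real and x y xt yt :: "nat \<Rightarrow> real"
  assumes m: "\<bar>m\<bar> \<le> 1"
    and xy: "\<And>n. \<bar>x n\<bar> \<le> y n" and y1: "\<And>n. y n \<le> 1"
    and xt_Suc: "\<And>n. n \<ge> 2 \<Longrightarrow> xt (Suc n) = xt n + drift_x m (x n) (y n) / real (Suc n)"
    and yt_Suc: "\<And>n. n \<ge> 2 \<Longrightarrow> yt (Suc n) = yt n + drift_y m (x n) (y n) / real (Suc n)"
    and xt_lim: "(\<lambda>n. xt n - x n) \<longlonglongrightarrow> 0"
    and yt_lim: "(\<lambda>n. yt n - y n) \<longlonglongrightarrow> 0"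
begin

lemma y0: "0 \<le> y n" using xy[of n] by linarith

lemma x1: "\<bar>x n\<bar> \<le> 1" using xy[of n] y1[of n] by linarith

text \<open>The third bound controls a single step of the companion, as both drifts are at most 4 in
  modulus.\<close>

lemma close:
  assumes "\<eta> > 0"
  shows "\<exists>N\<ge>2. \<forall>n\<ge>N. \<bar>xt n - x n\<bar> < \<eta> \<and> \<bar>yt n - y n\<bar> < \<eta> \<and> 4 / real (Suc n) < \<eta>"
proof -
  have "(\<lambda>n. 4 / real (Suc n)) \<longlonglongrightarrow> 0" by (rule LIMSEQ_Suc[OF lim_const_over_n])
  then have "\<forall>\<^sub>F n in sequentially. 4 / real (Suc n) < \<eta>"
    using assms by (rule order_tendstoD)
  moreover have "\<forall>\<^sub>F n in sequentially. \<bar>xt n - x n\<bar> < \<eta>" "\<forall>\<^sub>F n in sequentially. \<bar>yt n - y n\<bar> < \<eta>"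
    using tendstoD[OF xt_lim assms] tendstoD[OF yt_lim assms] by (auto simp: dist_real_def)
  ultimately have "\<forall>\<^sub>F n in sequentially. n \<ge> 2 \<and> \<bar>xt n - x n\<bar> < \<eta> \<and> \<bar>yt n - y n\<bar> < \<eta> \<and> 4 / real (Suc n) < \<eta>"
    using eventually_ge_at_top[of "2::nat"] by eventually_elim auto
  then obtain N where "\<forall>n\<ge>N. n \<ge> 2 \<and> \<bar>xt n - x n\<bar> < \<eta> \<and> \<bar>yt n - y n\<bar> < \<eta> \<and> 4 / real (Suc n) < \<eta>"
    by (auto simp: eventually_sequentially)
  then show ?thesis by (intro exI[of _ "max 2 N"]) auto
qed

lemma xt_step: "n \<ge> 2 \<Longrightarrow> \<bar>xt (Suc n) - xt n\<bar> \<le> 4 / real (Suc n)"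
  using abs_drift_x_le[OF m xy y1, of n] by (simp add: xt_Suc divide_right_mono)

lemma yt_step: "n \<ge> 2 \<Longrightarrow> \<bar>yt (Suc n) - yt n\<bar> \<le> 4 / real (Suc n)"
  using abs_drift_y_le[OF m xy y1, of n] by (simp add: yt_Suc divide_right_mono)

text \<open>While \<open>y\<close> lies between a small positive level and a level just below
  \<open>2/3\<close>, the term \<open>y (1 - 3/2 y)\<close> is bounded away from 0 and the
  \<open>x\<close> term only helps. The hypothesis on \<open>y\<close> provides a late start at a
  positive level; it has to be assumed because \<open>(0, 0)\<close> is an equilibrium as
  well.\<close>

lemma eventually_y_ge_small:
  assumes ny: "\<not> y \<longlonglongrightarrow> 0" and e: "0 < \<epsilon>" "\<epsilon> \<le> 1/3"
  shows "\<forall>\<^sub>F n in sequentially. 2/3 - \<epsilon> \<le> y n"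
proof -
  obtain r where r: "r > 0" "\<And>N. \<exists>n\<ge>N. \<bar>y n\<bar> \<ge> r"
    using ny unfolding LIMSEQ_iff by (auto simp: not_less)
  \<comment> \<open>With \<open>y N \<ge> r \<ge> 4 \<delta>\<close> the companion starts above
    \<open>2 \<delta>\<close>, and while \<open>yt\<close> stays there \<open>y\<close> stays above
    \<open>\<delta>\<close>; the bound 1/8 keeps \<open>2 \<delta>\<close> below the target
    level.\<close>
  define \<delta> where "\<delta> = min (r/4) (1/8)"
  have d: "\<delta> > 0" "4 * \<delta> \<le> r" "\<delta> \<le> 1/8" using r by (auto simp: \<delta>_def)
  define \<eta> where "\<eta> = min \<delta> (\<epsilon>/4)"
  have eta: "\<eta> > 0" "\<eta> \<le> \<delta>" "\<eta> \<le> \<epsilon>/4" using d e by (auto simp: \<eta>_def)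
  obtain N0 where N0: "N0 \<ge> 2" "\<forall>n\<ge>N0. \<bar>xt n - x n\<bar> < \<eta> \<and> \<bar>yt n - y n\<bar> < \<eta> \<and> 4 / real (Suc n) < \<eta>"
    using close[OF eta(1)] by blast
  obtain N where N: "N \<ge> N0" "\<bar>y N\<bar> \<ge> r" using r(2) by blast
  have ev: "\<forall>\<^sub>F n in sequentially. - yt n \<le> - (2/3 - 3 * \<epsilon> / 4)"
  proof (rule lyapunov_capture[where T = "- 2 * \<delta>" and N = N and c = "\<delta> * (3 * \<epsilon> / 8)" and \<theta> = "- (2/3 - \<epsilon>/2)" and B = "-2"])
    show "- yt N \<le> - 2 * \<delta>"
      using N N0(2) d eta y0[of N] by (auto simp: abs_real_def split: if_splits)
    show "- yt (Suc n) \<le> - (2 / 3 - 3 * \<epsilon> / 4)" if "N \<le> n" "- yt n \<le> - (2 / 3 - \<epsilon> / 2)" for n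
    proof -
      have "4 / real (Suc n) < \<eta>" "n \<ge> 2" using N0 N(1) that by auto
      then show ?thesis using yt_step[of n] that eta by linarith
    qed
    show "- 2 \<le> - yt n" if "N \<le> n" for n
    proof -
      have "\<bar>yt n - y n\<bar> < \<eta>" using N0 N(1) that by auto
      then show ?thesis using y1[of n] eta d by linarith
    qed
    show "- yt (Suc n) \<le> - yt n - \<delta> * (3 * \<epsilon> / 8) / real (Suc n)"
      if n: "N \<le> n" "- (2 / 3 - \<epsilon> / 2) \<le> - yt n" "- yt n \<le> - 2 * \<delta>" for n
    proof -
      have "\<bar>yt n - y n\<bar> < \<eta>" and n2: "n \<ge> 2" using N0 N n by auto
      then have y: "\<delta> \<le> y n" "y n \<le> 2/3 - \<epsilon>/4" using n eta by linarith+
      have "\<delta> * (3 * \<epsilon> / 8) \<le> y n * (1 - 3/2 * y n)"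
        using y d e by (intro mult_mono) auto
      also have "\<dots> \<le> y n * (1 - 3/2 * y n) + (m * x n)^2 / 2" by simp
      also have "\<dots> = drift_y m (x n) (y n)"
        by (simp add: drift_y_def algebra_simps power2_eq_square)
      finally have "\<delta> * (3 * \<epsilon> / 8) / real (Suc n) \<le> drift_y m (x n) (y n) / real (Suc n)"
        by (rule divide_right_mono) simp
      then show ?thesis by (simp add: yt_Suc[OF n2])
    qed
  qed (use d e in auto)
  show ?thesis
    using ev eventually_ge_at_top[of N0]
  proof eventually_elim
    case (elim n)
    then have "\<bar>yt n - y n\<bar> < \<eta>" using N0 by auto
    then show ?case using elim eta by linarith
  qed
qed

lemma eventually_y_ge:
  assumes ny: "\<not> y \<longlonglongrightarrow> 0" and e: "0 < \<epsilon>"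
  shows "\<forall>\<^sub>F n in sequentially. 2/3 - \<epsilon> \<le> y n"
proof -
  have "\<forall>\<^sub>F n in sequentially. 2/3 - min \<epsilon> (1/3) \<le> y n"
    using e by (intro eventually_y_ge_small[OF ny]) auto
  then show ?thesis by (rule eventually_mono) linarith
qed

text \<open>At \<open>y = 2/3\<close> the growth rate of \<open>x\<close> is
  \<open>4/3 m - 1 < 0\<close>, and for \<open>m \<ge> 0\<close> a larger \<open>y\<close> only
  lowers it, so an eventual lower bound on \<open>y\<close> suffices.\<close>

lemma x_tendsto_zero:
  assumes ny: "\<not> y \<longlonglongrightarrow> 0" and m34: "m < 3/4"
  shows "x \<longlonglongrightarrow> 0"
proof -
  \<comment> \<open>Here \<open>2 c\<close> is the contraction rate \<open>1 - 4/3 m\<close> at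
    \<open>y = 2/3\<close>; letting \<open>y\<close> be smaller by \<open>c\<close> costs at most
    \<open>3/4 c\<close>. The minimum with 1 serves \<open>m < 0\<close>, where
    \<open>m (2 - y) - 1 \<le> -1\<close> is the bound used.\<close>
  define c where "c = (3 - 4 * m) / 6"
  define c' where "c' = min c 1"
  have c: "c > 0" using m34 by (simp add: c_def)
  have c': "c' > 0" "c' \<le> c" "c' \<le> 1" using c by (auto simp: c'_def)
  have "\<forall>\<^sub>F n in sequentially. 2/3 - c \<le> y n"
    using eventually_y_ge[OF ny c] .
  then obtain N1 where N1: "\<And>n. n \<ge> N1 \<Longrightarrow> 2/3 - c \<le> y n"
    by (auto simp: eventually_sequentially)
  have coef: "2 * m - 1 - m * y n \<le> - c'" if "n \<ge> N1" for n
  proof (cases "m \<ge> 0")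
    case True
    have "m * (2/3 - c) \<le> m * y n" using N1[OF that] True by (intro mult_left_mono) auto
    moreover have "m * c \<le> 3/4 * c" using m34 c by (intro mult_right_mono) auto
    moreover have "m * (2/3 - c) = 2/3 * m - m * c" by (simp add: algebra_simps)
    ultimately have "2 * m - 1 - m * y n \<le> 4/3 * m - 1 + 3/4 * c" by linarith
    also have "\<dots> \<le> - c" by (simp add: c_def field_simps) (use m34 in linarith)
    finally show ?thesis using c' by linarith
  next
    case False
    have "m * (2 - y n) \<le> 0" using False y1[of n] by (simp add: mult_le_0_iff)
    then show ?thesis using c' by (simp add: algebra_simps)
  qed
  have "(\<lambda>n. xt n) \<longlonglongrightarrow> 0"
  proof (rule LIMSEQ_I)
    fix r0 :: real assume r0: "r0 > 0"
    define r where "r = min (r0/3) (1/2)"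
    have r: "r > 0" "r \<le> r0/3" "r \<le> 1/2" using r0 by (auto simp: r_def)
    define \<eta> where "\<eta> = r/2"
    obtain N0 where N0: "N0 \<ge> 2" "\<forall>n\<ge>N0. \<bar>xt n - x n\<bar> < \<eta> \<and> \<bar>yt n - y n\<bar> < \<eta> \<and> 4 / real (Suc n) < \<eta>"
      using close[of \<eta>] r by (auto simp: \<eta>_def)
    have "\<forall>\<^sub>F n in sequentially. \<bar>xt n\<bar> \<le> 2 * r"
    proof (rule lyapunov_capture[where T = 2 and N = "max N0 N1" and c = "r/2 * c'" and \<theta> = r and B = 0])
      show "\<bar>xt (max N0 N1)\<bar> \<le> 2"
        using N0(2)[rule_format, of "max N0 N1"] x1[of "max N0 N1"] r unfolding \<eta>_def by linarith
      show "\<bar>xt (Suc n)\<bar> \<le> 2 * r" if "max N0 N1 \<le> n" "\<bar>xt n\<bar> \<le> r" for n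
        using xt_step[of n] N0(1) N0(2)[rule_format, of n] that r unfolding \<eta>_def by (auto)
      show "\<bar>xt (Suc n)\<bar> \<le> \<bar>xt n\<bar> - r/2 * c' / real (Suc n)"
        if n: "max N0 N1 \<le> n" "r \<le> \<bar>xt n\<bar>" "\<bar>xt n\<bar> \<le> 2" for n
      proof -
        let ?k = "2 * m - 1 - m * y n"
        have a: "\<bar>xt n - x n\<bar> < r/2" "4 / real (Suc n) < r/2" and n2: "n \<ge> 2"
          using N0 n by (auto simp: \<eta>_def)
        have k: "?k \<le> - c'" using coef n by simp
        \<comment> \<open>A step shorter than \<open>r / 2\<close> cannot change the sign of
          \<open>xt\<close> while its modulus is at least \<open>r\<close>, so the modulus moves by
          the signed drift.\<close>
        have st: "\<bar>xt (Suc n) - xt n\<bar> < r/2" using xt_step[OF n2] a by linarith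
        show ?thesis
        proof (cases "xt n \<ge> 0")
          case True
          then have "x n \<ge> r/2" using a n by linarith
          then have "x n * (- ?k) \<ge> r/2 * c'" using k c' r by (intro mult_mono) auto
          then have "drift_x m (x n) (y n) / real (Suc n) \<le> - (r/2 * c') / real (Suc n)"
            by (intro divide_right_mono) (auto simp: drift_x_def algebra_simps)
          moreover have "xt (Suc n) > 0" using True st n a r by linarith
          ultimately show ?thesis using True xt_Suc[OF n2] by linarith
        next
          case False
          then have "- x n \<ge> r/2" using a n by linarith
          then have "(- x n) * (- ?k) \<ge> r/2 * c'" using k c' r by (intro mult_mono) auto
          then have "drift_x m (x n) (y n) / real (Suc n) \<ge> (r/2 * c') / real (Suc n)"
            by (intro divide_right_mono) (auto simp: drift_x_def algebra_simps)
          moreover have "xt (Suc n) < 0" using False st n a r by linarith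
          ultimately show ?thesis using False xt_Suc[OF n2] by linarith
        qed
      qed
    qed (use r c' in auto)
    then obtain n0 where "\<forall>n\<ge>n0. \<bar>xt n\<bar> \<le> 2 * r" by (auto simp: eventually_sequentially)
    then have "\<forall>n\<ge>n0. norm (xt n - 0) < r0" using r r0 by force
    then show "\<exists>no. \<forall>n\<ge>no. norm (xt n - 0) < r0" by blast
  qed
  then show ?thesis using tendsto_diff[OF _ xt_lim] by force
qed

text \<open>Above \<open>2/3\<close> the quadratic damping wins once the forcing
  \<open>m^2 x^2 / 2\<close> is negligible. The bound serves to refute \<open>x\<close> tending to 0
  in the supercritical case, by placing the path in a window where escape can be shown.\<close>

lemma eventually_y_le:
  assumes x0: "x \<longlonglongrightarrow> 0" and e: "0 < \<epsilon>" "\<epsilon> \<le> 1"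
  shows "\<forall>\<^sub>F n in sequentially. y n \<le> 2/3 + \<epsilon>"
proof -
  define \<eta> where "\<eta> = \<epsilon>/4"
  obtain N0 where N0: "N0 \<ge> 2" "\<forall>n\<ge>N0. \<bar>xt n - x n\<bar> < \<eta> \<and> \<bar>yt n - y n\<bar> < \<eta> \<and> 4 / real (Suc n) < \<eta>"
    using close[of \<eta>] e by (auto simp: \<eta>_def)
  have "\<forall>\<^sub>F n in sequentially. \<bar>x n\<bar> < \<epsilon>/4"
    using tendstoD[OF x0, of "\<epsilon>/4"] e by auto
  then obtain N1 where N1: "\<And>n. n \<ge> N1 \<Longrightarrow> \<bar>x n\<bar> < \<epsilon>/4"
    by (auto simp: eventually_sequentially)
  have ev: "\<forall>\<^sub>F n in sequentially. yt n \<le> 2/3 + 3 * \<epsilon> / 4"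
  proof (rule lyapunov_capture[where T = 2 and N = "max N0 N1" and c = "\<epsilon>/8" and \<theta> = "2/3 + \<epsilon>/2" and B = "-1"])
    show "yt (max N0 N1) \<le> 2"
      using N0(2)[rule_format, of "max N0 N1"] y1[of "max N0 N1"] e unfolding \<eta>_def by linarith
    show "yt (Suc n) \<le> 2/3 + 3 * \<epsilon> / 4" if "max N0 N1 \<le> n" "yt n \<le> 2/3 + \<epsilon>/2" for n
      using yt_step[of n] N0(1) N0(2)[rule_format, of n] that unfolding \<eta>_def by auto
    show "- 1 \<le> yt n" if "max N0 N1 \<le> n" for n
    proof -
      have "\<bar>yt n - y n\<bar> < \<epsilon>/4" using N0 that by (auto simp: \<eta>_def)
      then show ?thesis using y0[of n] e by linarith
    qed
    show "yt (Suc n) \<le> yt n - \<epsilon>/8 / real (Suc n)"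
      if n: "max N0 N1 \<le> n" "2/3 + \<epsilon>/2 \<le> yt n" "yt n \<le> 2" for n
    proof -
      have a: "\<bar>yt n - y n\<bar> < \<epsilon>/4" and n2: "n \<ge> 2"
        using N0 n by (auto simp: \<eta>_def)
      have y: "y n \<ge> 2/3 + \<epsilon>/4" using a n by linarith
      have "2/3 * (3 * \<epsilon> / 8) \<le> y n * (3/2 * y n - 1)"
        using y e by (intro mult_mono) auto
      moreover have "\<bar>x n\<bar> * \<bar>x n\<bar> \<le> 1 * (\<epsilon>/4)"
        using N1[of n] n x1[of n] by (intro mult_mono) auto
      then have "(x n)^2 \<le> \<epsilon>/4" by (simp add: power2_eq_square)
      moreover have "m^2 * (x n)^2 \<le> 1 * (x n)^2"
        using m by (intro mult_right_mono square_le_one) auto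
      ultimately have "drift_y m (x n) (y n) \<le> - (\<epsilon>/8)"
        by (simp add: drift_y_def algebra_simps power2_eq_square)
      then have "drift_y m (x n) (y n) / real (Suc n) \<le> - (\<epsilon>/8) / real (Suc n)"
        by (rule divide_right_mono) simp
      then show ?thesis by (simp add: yt_Suc[OF n2])
    qed
  qed (use e in auto)
  show ?thesis
    using ev eventually_ge_at_top[of N0]
  proof eventually_elim
    case (elim n)
    then have "\<bar>yt n - y n\<bar> < \<epsilon>/4" using N0 by (auto simp: \<eta>_def)
    then show ?case using elim by linarith
  qed
qed

end

section \<open>The supercritical Lyapunov function\<close>

lemma abs_le_square: "\<bar>a\<bar> \<le> b \<Longrightarrow> a^2 \<le> (b::real)^2"
  using power_mono[of "\<bar>a\<bar>" b 2] by simp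

text \<open>With \<open>P = x\<^sup>2 - r\<^sup>2\<close> and \<open>q = y - s\<close>, the function \<open>(m/2) (x\<^sup>2 - r\<^sup>2 - 2 r\<^sup>2 ln (x/r)) + q\<^sup>2\<close> is the
  classical predator-prey Lyapunov function of the limiting ODE, whose derivative only controls \<open>q\<^sup>2\<close>;
  the small cross term \<open>- \<delta> P q\<close> makes it strict.\<close>

locale lyapunov =
  fixes m :: real
  assumes m_gt: "3/4 < m" and m_lt: "m < 1"
begin

text \<open>The point \<open>(r, s)\<close> is the equilibrium with \<open>x > 0\<close>:
  \<open>s\<close> annihilates the growth rate of \<open>x\<close>, and \<open>r\<close> then solves
  \<open>drift_y m r s = 0\<close>. For \<open>y \<ge> 0\<close>, \<open>c0\<close> is a lower bound
  for the damping rate of \<open>y - s\<close>; \<open>\<delta>\<close> is a fraction of it, small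
  enough for \<open>dissipation\<close> to absorb the terms produced by the cross term.\<close>

definition s :: real where "s = (2 * m - 1) / m"
definition r :: real where "r = sqrt ((2 * m - 1) * (4 * m - 3)) / m^2"
definition c0 :: real where "c0 = 3/2 * s - 1"
definition \<delta> :: real where "\<delta> = c0 / 80"

definition log_gap :: "real \<Rightarrow> real" where
  "log_gap x = x^2 - r^2 - 2 * r^2 * ln (x / r)"

definition V :: "real \<Rightarrow> real \<Rightarrow> real" where
  "V x y = m / 2 * log_gap x + (y - s)^2 - \<delta> * (x^2 - r^2) * (y - s)"

text \<open>\<open>Vx\<close> and \<open>Vy\<close> are the partial derivatives of
  \<open>V\<close>.\<close>

definition Vx :: "real \<Rightarrow> real \<Rightarrow> real" where
  "Vx x y = m * (x - r^2 / x) - 2 * \<delta> * x * (y - s)"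

definition Vy :: "real \<Rightarrow> real \<Rightarrow> real" where
  "Vy x y = 2 * (y - s) - \<delta> * (x^2 - r^2)"

lemma s_bounds: "2/3 < s" "s < 1"
  using m_gt m_lt by (auto simp: s_def field_simps)

lemma c0_bounds: "0 < c0" "c0 < 1/2"
  using s_bounds by (auto simp: c0_def)

lemma \<delta>_bounds: "0 < \<delta>" "\<delta> < 1/160"
  using c0_bounds by (auto simp: \<delta>_def)

lemma r_pos: "0 < r"
  using m_gt by (simp add: r_def)

text \<open>This is the equilibrium equation \<open>drift_y m r s = 0\<close> in disguise.\<close>

lemma r_square: "m^2 * r^2 = 3 * s^2 - 2 * s"
proof -
  have "r^2 = ((2 * m - 1) * (4 * m - 3)) / (m^2)^2"
    using m_gt by (simp add: r_def power_divide real_sqrt_pow2)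
  then have "m^2 * r^2 = ((2 * m - 1) * (4 * m - 3)) / m^2"
    using m_gt by (simp add: power2_eq_square)
  also have "\<dots> = 3 * s^2 - 2 * s"
    using m_gt by (simp add: s_def field_simps power2_eq_square)
  finally show ?thesis .
qed

lemma r_less: "r < 2"
proof (rule ccontr)
  assume "\<not> ?thesis"
  then have "4 \<le> r^2" using power_mono[of 2 r 2] by simp
  have "(3/4)^2 < m^2" using m_gt by (intro power_strict_mono) auto
  then have "(3/4)^2 * 4 \<le> m^2 * r^2" using \<open>4 \<le> r^2\<close> by (intro mult_mono) auto
  then have "9/4 \<le> s * (3 * s - 2)" unfolding r_square by (simp add: power2_eq_square algebra_simps)
  moreover have "s * (3 * s - 2) \<le> 1 * 1" using s_bounds by (intro mult_mono) auto
  ultimately show False by simp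
qed

lemma drift_x_eq: "drift_x m x y = - m * x * (y - s)"
  using m_gt by (simp add: drift_x_def s_def field_simps)

lemma drift_y_eq: "drift_y m x y = m^2 * (x^2 - r^2) / 2 + (y - s) * (1 - 3/2 * (y + s))"
proof -
  have "m^2 * (x^2 - r^2) + (y - s) * (2 - 3 * (y + s)) = 2 * y - 3 * y^2 + m^2 * x^2"
    using r_square by algebra
  moreover have "1 - 3/2 * u = (2 - 3 * u) / 2" for u :: real by argo
  then have "(y - s) * (1 - 3/2 * (y + s)) = (y - s) * (2 - 3 * (y + s)) / 2"
    by (metis times_divide_eq_right)
  ultimately show ?thesis unfolding drift_y_def by linarith
qed

text \<open>The terms \<open>m^2 q P\<close> from the two derivatives cancel, as in the
  predator-prey system, leaving \<open>2 q^2 t\<close> with \<open>t \<le> - c0\<close>. The cross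
  term of \<open>V\<close> contributes \<open>- \<delta> m^2 P^2 / 2\<close>, the missing control of
  \<open>P\<close>; all remaining terms carry a factor \<open>\<delta>\<close> and are
  absorbed.\<close>

lemma dissipation:
  assumes x: "0 < x" "x \<le> 2" and y: "0 \<le> y" "y \<le> 2"
  shows "Vx x y * drift_x m x y + Vy x y * drift_y m x y
    \<le> - (\<delta> / 8) * ((x^2 - r^2)^2 + (y - s)^2)"
proof -
  define P where "P = x^2 - r^2"
  define q where "q = y - s"
  define t where "t = 1 - 3/2 * (y + s)"
  have t: "t \<le> - c0" "\<bar>t\<bar> \<le> 4" using y s_bounds by (auto simp: t_def c0_def)
  define w where "w = x - r^2 / x"
  have "x * w = P" unfolding w_def using x by (simp add: P_def field_simps power2_eq_square)
  have "Vx x y = m * w - 2 * \<delta> * x * q" "drift_x m x y = - m * x * q"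
    by (simp_all only: Vx_def drift_x_eq q_def w_def)
  then have "Vx x y * drift_x m x y = (m * w - 2 * \<delta> * x * q) * (- m * x * q)" by (simp only:)
  also have "\<dots> = - (m^2) * q * (x * w) + 2 * \<delta> * m * x^2 * q^2"
    by (simp add: left_diff_distrib power2_eq_square)
  finally have 1: "Vx x y * drift_x m x y = - (m^2) * q * P + 2 * \<delta> * m * x^2 * q^2"
    unfolding \<open>x * w = P\<close> .
  have 2: "Vy x y * drift_y m x y
      = (m^2) * q * P + 2 * (q^2 * t) - (\<delta> * (m^2 * P^2)) / 2 - \<delta> * (P * q * t)"
  proof -
    define c where "c = m^2 / 2"
    have "Vy x y = 2 * q - \<delta> * P" by (simp only: Vy_def P_def q_def)
    moreover have "drift_y m x y = c * P + q * t" unfolding drift_y_eq P_def q_def t_def c_def by simp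
    moreover have "(2 * q - \<delta> * P) * (c * P + q * t)
        = (2 * c) * q * P + 2 * (q^2 * t) - \<delta> * (c * P^2) - \<delta> * (P * q * t)"
      by algebra
    ultimately show ?thesis by (simp add: c_def)
  qed
  have a: "2 * \<delta> * m * x^2 * q^2 \<le> 8 * (\<delta> * q^2)"
  proof -
    have "x^2 \<le> 2^2" using x by (intro power_mono) auto
    then have "m * x^2 \<le> 1 * 4" using m_lt m_gt by (intro mult_mono) auto
    then have "(2 * (\<delta> * q^2)) * (m * x^2) \<le> (2 * (\<delta> * q^2)) * 4"
      using \<delta>_bounds by (intro mult_left_mono) auto
    moreover have "(2 * (\<delta> * q^2)) * (m * x^2) = 2 * \<delta> * m * x^2 * q^2" by algebra
    ultimately show ?thesis by linarith
  qed
  have b: "q^2 * t \<le> q^2 * (- c0)"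
    using t(1) by (intro mult_left_mono) auto
  \<comment> \<open>The weights are chosen so that only half of the gain
    \<open>\<delta> P^2 / 4\<close> is spent; the price is a large multiple of
    \<open>\<delta> q^2\<close>.\<close>
  have c: "\<delta> * (- (P * q * t)) \<le> \<delta> * (P^2 / 8 + 32 * q^2)"
  proof -
    have "- (P * q * t) \<le> \<bar>P * q * t\<bar>" by (rule abs_ge_minus_self)
    also have "\<dots> = \<bar>P * q\<bar> * \<bar>t\<bar>" by (rule abs_mult)
    also have "\<dots> \<le> \<bar>P * q\<bar> * 4" using t by (intro mult_left_mono) auto
    also have "\<dots> \<le> P^2 / 8 + 32 * q^2"
    proof -
      have "2 * (\<bar>P\<bar> / 4) * (4 * \<bar>q\<bar>) \<le> (\<bar>P\<bar> / 4)^2 + (4 * \<bar>q\<bar>)^2" by (rule sum_squares_bound)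
      then have "2 * \<bar>P * q\<bar> \<le> P^2 / 16 + 16 * q^2"
        by (simp add: abs_mult power_divide power_mult_distrib)
      then show ?thesis by linarith
    qed
    finally show ?thesis using \<delta>_bounds by (intro mult_left_mono) auto
  qed
  have d: "\<delta> * (1/2 * P^2) \<le> \<delta> * (m^2 * P^2)"
  proof -
    have "(3/4)^2 \<le> m^2" using m_gt by (intro power_mono) auto
    then have "1/2 \<le> m^2" by (simp add: power2_eq_square)
    then show ?thesis using \<delta>_bounds by (intro mult_left_mono mult_right_mono) auto
  qed
  \<comment> \<open>Budget for \<open>\<delta> q^2\<close>: 8 from \<open>a\<close>, 32 from
    \<open>c\<close> and 1 to keep, all paid by the damping \<open>2 c0 q^2\<close>.\<close>
  have e: "41 * (\<delta> * q^2) \<le> 2 * (c0 * q^2)"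
    using c0_bounds by (simp add: \<delta>_def)
  have "\<delta> * (1/2 * P^2) = 1/2 * (\<delta> * P^2)" "\<delta> * (P^2 / 8 + 32 * q^2) = (\<delta> * P^2) / 8 + 32 * (\<delta> * q^2)"
    "\<delta> * (- (P * q * t)) = - (\<delta> * (P * q * t))" "q^2 * (- c0) = - (c0 * q^2)"
    "0 \<le> \<delta> * q^2" "- (m^2) * q * P = - ((m^2) * q * P)"
    using \<delta>_bounds by (simp_all add: distrib_left)
  moreover have "- M + Z1 + (M + 2 * Z2 - D / 2 - Z3) \<le> - (A / 8 + B / 8)"
    if "Z1 \<le> 8 * B" "Z2 \<le> - C" "- Z3 \<le> A / 8 + 32 * B" "1/2 * A \<le> D" "41 * B \<le> 2 * C" "0 \<le> B"
    for M Z1 Z2 Z3 A B C D :: real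
    using that by argo
  ultimately have "Vx x y * drift_x m x y + Vy x y * drift_y m x y \<le> - (\<delta> * P^2 / 8 + \<delta> * q^2 / 8)"
    unfolding 1 2 using a b c d e by metis
  also have "\<dots> = - (\<delta> / 8) * ((x^2 - r^2)^2 + (y - s)^2)" unfolding P_def q_def by argo
  finally show ?thesis .
qed

text \<open>Both bounds on \<open>log_gap\<close> are \<open>ln z \<le> z - 1\<close>, here with
  \<open>z = x / r\<close> and in \<open>log_gap_upper\<close> with
  \<open>z = r^2 / x^2\<close>.\<close>

lemma log_gap_lower: "0 < x \<Longrightarrow> (x - r)^2 \<le> log_gap x"
proof -
  assume x: "0 < x"
  have "ln (x / r) \<le> x / r - 1" using x r_pos by (intro ln_le_minus_one) auto
  then have "2 * r^2 * ln (x / r) \<le> 2 * r^2 * (x / r - 1)" by (intro mult_left_mono) auto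
  also have "\<dots> = 2 * r * x - 2 * r^2" using r_pos by (simp add: field_simps power2_eq_square)
  finally show ?thesis by (simp add: log_gap_def power2_eq_square algebra_simps)
qed

lemma log_gap_upper: "0 < x \<Longrightarrow> log_gap x \<le> (x^2 - r^2)^2 / x^2"
proof -
  assume x: "0 < x"
  have "ln (r^2 / x^2) \<le> r^2 / x^2 - 1" using x r_pos by (intro ln_le_minus_one) auto
  moreover have "ln (r^2 / x^2) = - 2 * ln (x / r)"
    using x r_pos by (simp add: ln_div ln_realpow)
  ultimately have "r^2 * (- 2 * ln (x / r)) \<le> r^2 * (r^2 / x^2 - 1)" by (intro mult_left_mono) auto
  moreover have "x^2 - r^2 + r^2 * (r^2 / x^2 - 1) = (x^2 - r^2)^2 / x^2"
    using x by (simp add: field_simps power2_eq_square)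
  ultimately show ?thesis by (simp add: log_gap_def algebra_simps)
qed

lemma abs_P_le: "0 < x \<Longrightarrow> x \<le> 2 \<Longrightarrow> \<bar>x^2 - r^2\<bar> \<le> 4 * \<bar>x - r\<bar>"
proof -
  assume x: "0 < x" "x \<le> 2"
  have "\<bar>x^2 - r^2\<bar> = \<bar>x - r\<bar> * (x + r)"
    using x r_pos by (simp add: square_diff_square_factored power2_eq_square abs_mult)
  also have "\<dots> \<le> \<bar>x - r\<bar> * 4" using x r_less by (intro mult_left_mono) auto
  finally show ?thesis by simp
qed

text \<open>As \<open>\<delta> < 1/160\<close>, the cross term is a small part of the squared
  distance to \<open>(r, s)\<close>, so it cannot destroy the positivity of
  \<open>V\<close>.\<close>

lemma cross_le:
  assumes "0 < x" "x \<le> 2"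
  shows "\<bar>\<delta> * (x^2 - r^2) * (y - s)\<bar> \<le> 1/8 * ((x - r)^2 + (y - s)^2)"
proof -
  have "\<bar>\<delta> * (x^2 - r^2) * (y - s)\<bar> = \<delta> * (\<bar>x^2 - r^2\<bar> * \<bar>y - s\<bar>)"
    using \<delta>_bounds by (simp add: abs_mult)
  also have "\<dots> \<le> 1/160 * (4 * \<bar>x - r\<bar> * \<bar>y - s\<bar>)"
    using \<delta>_bounds abs_P_le[OF assms] by (intro mult_mono) auto
  also have "\<dots> \<le> 1/8 * ((x - r)^2 + (y - s)^2)"
  proof -
    have "2 * (\<bar>x - r\<bar> * \<bar>y - s\<bar>) \<le> (x - r)^2 + (y - s)^2"
      using sum_squares_bound[of "\<bar>x - r\<bar>" "\<bar>y - s\<bar>"] by simp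
    moreover have "0 \<le> (x - r)^2 + (y - s)^2" by simp
    moreover have "1/160 * (4 * u) \<le> 1/8 * w" if "2 * u \<le> w" "0 \<le> w" for u w :: real
      using that by linarith
    ultimately show ?thesis unfolding mult.assoc by blast
  qed
  finally show ?thesis .
qed

lemma V_lower:
  assumes "0 < x" "x \<le> 2"
  shows "1/8 * ((x - r)^2 + (y - s)^2) \<le> V x y"
proof -
  have "3/8 * (x - r)^2 \<le> m / 2 * log_gap x"
    using m_gt log_gap_lower[OF assms(1)] by (intro mult_mono) auto
  moreover have "0 \<le> (x - r)^2" "0 \<le> (y - s)^2" by auto
  ultimately show ?thesis
    using order_trans[OF abs_ge_self cross_le[OF assms, of y]]
    unfolding V_def distrib_left by linarith
qed

text \<open>The bracket is the quantity dissipated, so on \<open>x \<ge> e\<close> a lower bound on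
  \<open>V\<close> forces a decrease at a definite rate. The factor \<open>1 / e^2\<close> comes
  from the logarithm near \<open>x = 0\<close>.\<close>

lemma V_upper:
  assumes e: "0 < e" "e \<le> 1" and x: "e \<le> x" "x \<le> 2"
  shows "V x y \<le> 2 / e^2 * ((x^2 - r^2)^2 + (y - s)^2)"
proof -
  let ?P = "x^2 - r^2" let ?q = "y - s"
  have "log_gap x \<le> ?P^2 / x^2" using log_gap_upper x e by simp
  also have "\<dots> \<le> ?P^2 / e^2" using x e by (intro divide_left_mono power_mono) auto
  finally have "m / 2 * log_gap x \<le> 1/2 * (?P^2 / e^2)"
    using m_lt m_gt log_gap_lower[of x] x e
    by (intro mult_mono) (auto intro: order_trans[OF zero_le_power2])
  moreover have "- (\<delta> * ?P * ?q) \<le> 1/2 * (?P^2 + ?q^2)"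
  proof -
    have "- (\<delta> * ?P * ?q) \<le> \<delta> * (\<bar>?P\<bar> * \<bar>?q\<bar>)"
      using \<delta>_bounds by (metis abs_ge_minus_self abs_mult abs_of_pos mult.assoc)
    also have "\<dots> \<le> 1 * (\<bar>?P\<bar> * \<bar>?q\<bar>)" using \<delta>_bounds by (intro mult_right_mono) auto
    also have "\<dots> \<le> 1/2 * (?P^2 + ?q^2)"
      using zero_le_power2[of "\<bar>?P\<bar> - \<bar>?q\<bar>"] by (simp add: power2_eq_square algebra_simps)
    finally show ?thesis .
  qed
  ultimately have "V x y \<le> 1/2 * (?P^2 / e^2) + 1/2 * ?P^2 + 3/2 * ?q^2"
    by (simp add: V_def)
  also have "\<dots> \<le> 1/2 * (?P^2 / e^2) + 1/2 * (?P^2 / e^2) + 3/2 * (?q^2 / e^2)"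
  proof -
    have "e^2 \<le> 1" using e by (simp add: power_le_one)
    then have "a \<le> a / e^2" if "0 \<le> a" for a :: real
      using that e by (simp add: pos_le_divide_eq mult_left_le)
    then have "?P^2 \<le> ?P^2 / e^2" "?q^2 \<le> ?q^2 / e^2" by auto
    then show ?thesis by linarith
  qed
  also have "\<dots> \<le> 2 / e^2 * (?P^2 + ?q^2)"
    using e by (simp add: field_simps)
  finally show ?thesis .
qed

text \<open>Only an upper bound is wanted, so the logarithm is expanded by the elementary estimate
  of \<open>ln (1 + t) - t\<close> with \<open>t = h / x\<close>; the condition on \<open>h\<close>
  ensures that \<open>t\<close> is at most 1/2 in modulus. All other terms of \<open>V\<close> are
  polynomial and expand exactly.\<close>

lemma V_taylor:
  assumes e: "0 < e" "e \<le> 1" and x: "e \<le> x" "x \<le> 2" and y: "0 \<le> y" "y \<le> 2"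
    and h: "\<bar>h\<bar> \<le> e / 2" and k: "\<bar>k\<bar> \<le> 1"
  shows "V (x + h) (y + k) \<le> V x y + Vx x y * h + Vy x y * k + 40 / e^2 * (h^2 + k^2)"
proof -
  have xp: "0 < x" using e x by simp
  define t where "t = h / x"
  have "\<bar>h\<bar> \<le> x / 2" using h x by simp
  then have t: "\<bar>t\<bar> \<le> 1/2" using xp by (simp add: t_def field_simps)
  have "\<bar>ln (1 + t) - t\<bar> \<le> 2 * t^2" using t by (rule abs_ln_one_plus_x_minus_x_bound)
  then have ln_t: "- ln (1 + t) \<le> - t + 2 * t^2" by linarith
  have "(x + h) / r = (x / r) * (1 + t)" using xp r_pos by (simp add: t_def field_simps)
  then have ln_eq: "ln ((x + h) / r) = ln (x / r) + ln (1 + t)"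
    using xp r_pos t ln_mult_pos[of "x / r" "1 + t"] by simp
  have r2: "r^2 \<le> 4" using r_less r_pos power_mono[of r 2 2] by simp
  have "2 * r^2 * (- ln (1 + t)) \<le> 2 * r^2 * (- t + 2 * t^2)"
    using ln_t by (intro mult_left_mono) auto
  then have ent: "log_gap (x + h) \<le> log_gap x + 2 * x * h + h^2 - 2 * r^2 * t + 4 * r^2 * t^2"
    unfolding log_gap_def ln_eq by (simp add: power2_eq_square algebra_simps)
  have "t^2 \<le> h^2 / e^2" unfolding t_def power_divide using e x
    by (intro divide_left_mono power_mono) auto
  then have "r^2 * t^2 \<le> 4 * (h^2 / e^2)" using r2 by (intro mult_mono) auto
  then have "log_gap (x + h) \<le> log_gap x + 2 * (x - r^2 / x) * h + h^2 + 16 * (h^2 / e^2)"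
  proof -
    have "2 * (x - r^2 / x) * h = 2 * x * h - 2 * r^2 * t"
      using xp by (simp add: t_def field_simps)
    moreover have "4 * r^2 * t^2 = 4 * (r^2 * t^2)" by simp
    ultimately show ?thesis using ent \<open>r^2 * t^2 \<le> 4 * (h^2 / e^2)\<close> by linarith
  qed
  then have "m / 2 * log_gap (x + h) \<le> m / 2 * (log_gap x + 2 * (x - r^2 / x) * h + h^2 + 16 * (h^2 / e^2))"
    using m_gt by (intro mult_left_mono) auto
  also have "\<dots> = m / 2 * log_gap x + m * (x - r^2 / x) * h + m / 2 * (h^2 + 16 * (h^2 / e^2))"
    by (simp add: algebra_simps)
  also have "m / 2 * (h^2 + 16 * (h^2 / e^2)) \<le> 1 * (h^2 + 16 * (h^2 / e^2))"
    using m_lt m_gt by (intro mult_right_mono) auto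
  finally have A: "m / 2 * log_gap (x + h) \<le> m / 2 * log_gap x + m * (x - r^2 / x) * h + h^2 + 16 * (h^2 / e^2)"
    by simp
  have q: "\<bar>y - s\<bar> \<le> 2" using y s_bounds by auto
  have B: "- (2 * x * h * k + h^2 * (y - s + k)) \<le> 5 * (h^2 + k^2)"
  proof -
    have "- (2 * x * h * k) \<le> 2 * (h^2 + k^2)"
    proof -
      have "- (2 * x * h * k) \<le> 2 * \<bar>x\<bar> * (\<bar>h\<bar> * \<bar>k\<bar>)"
        by (metis abs_ge_minus_self abs_mult abs_numeral mult.assoc)
      also have "\<dots> \<le> 4 * (\<bar>h\<bar> * \<bar>k\<bar>)" using x xp by (intro mult_right_mono) auto
      also have "\<dots> \<le> 2 * (h^2 + k^2)"
        using zero_le_power2[of "\<bar>h\<bar> - \<bar>k\<bar>"] by (simp add: power2_eq_square algebra_simps)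
      finally show ?thesis .
    qed
    moreover have "h^2 * (- (y - s + k)) \<le> h^2 * 3" using q k by (intro mult_left_mono) auto
    moreover have "- (2 * x * h * k + h^2 * (y - s + k)) = - (2 * x * h * k) + h^2 * (- (y - s + k))"
      by (simp add: algebra_simps)
    ultimately show ?thesis using zero_le_power2[of k] unfolding distrib_left by linarith
  qed
  have C: "- \<delta> * (2 * x * h * k + h^2 * (y - s + k)) \<le> 5 * (h^2 + k^2)"
  proof -
    have "\<delta> * (- (2 * x * h * k + h^2 * (y - s + k))) \<le> \<delta> * (5 * (h^2 + k^2))"
      using B \<delta>_bounds by (intro mult_left_mono) auto
    also have "\<dots> \<le> 1 * (5 * (h^2 + k^2))" using \<delta>_bounds by (intro mult_right_mono) auto
    finally show ?thesis by (simp only: mult_minus_left mult_minus_right mult_1)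
  qed
  have e2: "h^2 \<le> h^2 / e^2" "k^2 \<le> k^2 / e^2"
    using e by (auto simp: pos_le_divide_eq mult_left_le power_le_one)
  have "V (x + h) (y + k) = m / 2 * log_gap (x + h) + (y - s)^2 + 2 * (y - s) * k + k^2
      - \<delta> * (x^2 - r^2) * (y - s) - 2 * \<delta> * x * (y - s) * h - \<delta> * (x^2 - r^2) * k
      - \<delta> * (2 * x * h * k + h^2 * (y - s + k))"
    by (simp add: V_def power2_eq_square algebra_simps)
  also have "\<dots> \<le> V x y + Vx x y * h + Vy x y * k + h^2 + 16 * (h^2 / e^2) + k^2 + 5 * (h^2 + k^2)"
    using A C by (simp add: V_def Vx_def Vy_def algebra_simps)
  also have "\<dots> \<le> V x y + Vx x y * h + Vy x y * k + 40 / e^2 * (h^2 + k^2)"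
  proof -
    have eq: "40 / e^2 * (h^2 + k^2) = 40 * (h^2 / e^2) + 40 * (k^2 / e^2)"
      by (simp add: add_divide_distrib algebra_simps)
    have gen: "W + a + 16 * A + b + 5 * (a + b) \<le> W + (40 * A + 40 * B)"
      if "0 \<le> A" "0 \<le> B" "a \<le> A" "b \<le> B" for W a b A B :: real
      using that by argo
    show ?thesis unfolding eq
      using gen[of "h^2 / e^2" "k^2 / e^2" "h^2" "k^2" "V x y + Vx x y * h + Vy x y * k"] e2
      by (simp only: zero_le_divide_iff zero_le_power2 simp_thms)
  qed
  finally show ?thesis .
qed

text \<open>The logarithm keeps sublevel sets of the Lyapunov function away from the invariant line \<open>x = 0\<close>.\<close>

lemma V_sublevel:
  obtains e where "0 < e" "e \<le> 1" "\<And>x y. 0 < x \<Longrightarrow> x \<le> 2 \<Longrightarrow> 0 \<le> y \<Longrightarrow> y \<le> 2 \<Longrightarrow> V x y \<le> T \<Longrightarrow> e \<le> x"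
proof -
  define a where "a = (2 / m * (T + 3) + r^2) / (2 * r^2)"
  define e where "e = min 1 (r * exp (- a))"
  have "e \<le> x" if x: "0 < x" "x \<le> 2" "0 \<le> y" "y \<le> 2" "V x y \<le> T" for x y
  proof -
    have "\<bar>x - r\<bar> \<le> 2" "\<bar>y - s\<bar> \<le> 2" using x r_pos r_less s_bounds by auto
    then have "(x - r)^2 \<le> 2^2" "(y - s)^2 \<le> 2^2" by (auto dest: abs_le_square)
    then have "\<delta> * (x^2 - r^2) * (y - s) \<le> 1"
      using cross_le[OF x(1,2), of y] by (simp add: abs_le_iff)
    then have "m / 2 * log_gap x \<le> T + 1"
      using x(5) zero_le_power2[of "y - s"] unfolding V_def by linarith
    then have "log_gap x \<le> 2 / m * (T + 1)"
      using m_gt by (simp add: field_simps)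
    also have "\<dots> \<le> 2 / m * (T + 3)" using m_gt by (intro mult_left_mono) auto
    finally have "- (2 * r^2 * ln (x / r)) \<le> 2 / m * (T + 3) + r^2"
      using zero_le_power2[of x] unfolding log_gap_def by linarith
    then have "- ln (x / r) \<le> a"
      using r_pos by (simp add: a_def pos_le_divide_eq algebra_simps)
    then have "exp (- a) \<le> exp (ln (x / r))" by simp
    also have "\<dots> = x / r" using x r_pos by simp
    finally have "r * exp (- a) \<le> x" using r_pos by (simp add: field_simps)
    then show ?thesis by (simp add: e_def)
  qed
  then show ?thesis using that[of e] r_pos by (auto simp: e_def)
qed

end

section \<open>Convergence of supercritical schemes to a nonzero equilibrium\<close>

locale supercritical_scheme = euler_scheme m x y xt yt + lyapunov m
  for m :: real and x y xt yt :: "nat \<Rightarrow> real"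
begin

text \<open>The companion moves by the drift at \<open>(x, y)\<close>, while
  \<open>dissipation\<close> speaks of the drift at \<open>(xt, yt)\<close>; this Lipschitz estimate
  and \<open>drift_y_diff\<close> bridge the gap.\<close>

lemma drift_x_diff:
  assumes "\<bar>a - a'\<bar> \<le> \<eta>" "\<bar>b - b'\<bar> \<le> \<eta>" "\<bar>a'\<bar> \<le> 2" "\<bar>b\<bar> \<le> 1"
  shows "\<bar>drift_x m a b - drift_x m a' b'\<bar> \<le> 10 * \<eta>"
proof -
  have "drift_x m a b - drift_x m a' b' = (a - a') * (2 * m - 1 - m * b) + a' * (m * (b' - b))"
    by (simp add: drift_x_def algebra_simps)
  also have "\<bar>\<dots>\<bar> \<le> \<bar>a - a'\<bar> * \<bar>2 * m - 1 - m * b\<bar> + \<bar>a'\<bar> * (\<bar>m\<bar> * \<bar>b' - b\<bar>)"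
    by (simp flip: abs_mult add: abs_triangle_ineq)
  also have "\<dots> \<le> \<eta> * 4 + 2 * (1 * \<eta>)"
  proof (intro add_mono mult_mono)
    have "\<bar>m * b\<bar> \<le> 1 * 1" unfolding abs_mult using assms m by (intro mult_mono) auto
    then show "\<bar>2 * m - 1 - m * b\<bar> \<le> 4" using m by linarith
  qed (use assms m in auto)
  finally show ?thesis using assms by linarith
qed

lemma square_diff:
  assumes "\<bar>a - a'\<bar> \<le> \<eta>" "\<bar>a\<bar> \<le> 2" "\<bar>a'\<bar> \<le> (2::real)"
  shows "\<bar>a^2 - a'^2\<bar> \<le> 4 * \<eta>"
proof -
  have "\<bar>a^2 - a'^2\<bar> = \<bar>a - a'\<bar> * \<bar>a + a'\<bar>"
    by (simp add: square_diff_square_factored power2_eq_square abs_mult)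
  also have "\<dots> \<le> \<eta> * 4" using assms by (intro mult_mono) auto
  finally show ?thesis by simp
qed

lemma drift_y_diff:
  assumes "\<bar>a - a'\<bar> \<le> \<eta>" "\<bar>b - b'\<bar> \<le> \<eta>" "\<bar>a\<bar> \<le> 1" "\<bar>a'\<bar> \<le> 2" "\<bar>b\<bar> \<le> 1" "\<bar>b'\<bar> \<le> 2"
  shows "\<bar>drift_y m a b - drift_y m a' b'\<bar> \<le> 10 * \<eta>"
proof -
  define A where "A = a^2 - a'^2"
  define B where "B = b^2 - b'^2"
  have eq: "drift_y m a b - drift_y m a' b' = (b - b') - 3/2 * B + (m^2 * A) / 2"
    by (simp add: drift_y_def A_def B_def right_diff_distrib diff_divide_distrib)
  have A: "\<bar>A\<bar> \<le> 4 * \<eta>" and B: "\<bar>B\<bar> \<le> 4 * \<eta>"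
    using assms by (auto intro!: square_diff simp: A_def B_def)
  have "m^2 * \<bar>A\<bar> \<le> 1 * \<bar>A\<bar>"
    using m by (intro mult_right_mono square_le_one) auto
  then have "\<bar>m^2 * A\<bar> \<le> 4 * \<eta>" using A by (simp add: abs_mult)
  then show ?thesis using assms(2) B unfolding eq by linarith
qed

lemma abs_Vx_le:
  assumes "0 < e" "e \<le> 1" "e \<le> a" "a \<le> 2" "0 \<le> b" "b \<le> 2"
  shows "\<bar>Vx a b\<bar> \<le> 8 / e"
proof -
  have "r^2 \<le> 2^2" using r_less r_pos by (intro power_mono) auto
  then have r2: "r^2 \<le> 4" by simp
  have "r^2 / a \<le> 4 / e" using assms r2 by (intro frac_le) auto
  moreover have "0 \<le> r^2 / a" using assms by simp
  ultimately have "\<bar>a - r^2 / a\<bar> \<le> 2 + 4 / e" using assms by linarith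
  then have "m * \<bar>a - r^2 / a\<bar> \<le> 1 * (2 + 4 / e)" using m_lt m_gt by (intro mult_mono) auto
  then have 1: "\<bar>m * (a - r^2 / a)\<bar> \<le> 2 + 4 / e" using m_gt by (simp add: abs_mult)
  have "(2 * \<delta>) * (\<bar>a\<bar> * \<bar>b - s\<bar>) \<le> (1/4) * (2 * 2)"
    using assms \<delta>_bounds s_bounds by (intro mult_mono) auto
  then have 2: "\<bar>2 * \<delta> * a * (b - s)\<bar> \<le> 1" using \<delta>_bounds by (simp add: abs_mult)
  have "3 \<le> 3 / e" using assms by (simp add: pos_le_divide_eq)
  then have "3 + 4 / e \<le> 7 / e" by (simp add: add_divide_distrib[symmetric] algebra_simps)
  moreover have "7 / e \<le> 8 / e" using assms by (simp add: divide_right_mono)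
  ultimately have "\<bar>m * (a - r^2 / a)\<bar> + \<bar>2 * \<delta> * a * (b - s)\<bar> \<le> 8 / e" using 1 2 by linarith
  then show ?thesis unfolding Vx_def by (rule order_trans[OF abs_triangle_ineq4])
qed

lemma abs_Vy_le:
  assumes "0 < e" "e \<le> 1" "e \<le> a" "a \<le> 2" "0 \<le> b" "b \<le> 2"
  shows "\<bar>Vy a b\<bar> \<le> 8 / e"
proof -
  have "\<bar>a^2 - r^2\<bar> \<le> 4 * \<bar>a - r\<bar>" using assms by (intro abs_P_le) auto
  also have "\<dots> \<le> 8" using assms r_less r_pos by auto
  finally have "\<delta> * \<bar>a^2 - r^2\<bar> \<le> (1/8) * 8" using \<delta>_bounds by (intro mult_mono) auto
  then have "\<bar>\<delta> * (a^2 - r^2)\<bar> \<le> 1" using \<delta>_bounds by (simp add: abs_mult)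
  moreover have "\<bar>2 * (b - s)\<bar> \<le> 4" using assms s_bounds by auto
  ultimately have "\<bar>Vy a b\<bar> \<le> 5" unfolding Vy_def by linarith
  also have "5 \<le> 8 / e" using assms by (simp add: pos_le_divide_eq)
  finally show ?thesis .
qed

text \<open>The error \<open>480 \<eta> / e^2\<close> collects two gradient terms
  \<open>8 / e * 10 \<eta>\<close> from moving the drift to the companion, and
  \<open>40 / e^2 * 8 \<eta>\<close> from the Taylor remainder, where
  \<open>\<gamma> (f^2 + g^2) \<le> 32 \<gamma> \<le> 8 \<eta>\<close>.\<close>

lemma V_step:
  assumes e: "0 < e" "e \<le> 1" and n: "n \<ge> 2" and xt: "e \<le> xt n" "xt n \<le> 2" and yt: "0 \<le> yt n" "yt n \<le> 2"
    and eta: "\<bar>xt n - x n\<bar> \<le> \<eta>" "\<bar>yt n - y n\<bar> \<le> \<eta>" "4 / real (Suc n) \<le> \<eta>" "\<eta> \<le> e / 2"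
  shows "V (xt (Suc n)) (yt (Suc n)) \<le> V (xt n) (yt n)
     + (480 * \<eta> / e^2 - \<delta> / 8 * (((xt n)^2 - r^2)^2 + (yt n - s)^2)) / real (Suc n)"
proof -
  let ?X = "xt n" let ?Y = "yt n"
  define \<gamma> where "\<gamma> = 1 / real (Suc n)"
  define f where "f = drift_x m (x n) (y n)"
  define g where "g = drift_y m (x n) (y n)"
  have fg: "\<bar>f\<bar> \<le> 4" "\<bar>g\<bar> \<le> 4"
    using abs_drift_x_le[OF m xy y1] abs_drift_y_le[OF m xy y1] by (auto simp: f_def g_def)
  have ga: "0 < \<gamma>" "4 * \<gamma> \<le> \<eta>" using eta by (auto simp: \<gamma>_def)
  have S: "xt (Suc n) = ?X + \<gamma> * f" "yt (Suc n) = ?Y + \<gamma> * g"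
    using n by (auto simp: xt_Suc yt_Suc f_def g_def \<gamma>_def)
  have hk: "\<bar>\<gamma> * f\<bar> \<le> 4 * \<gamma>" "\<bar>\<gamma> * g\<bar> \<le> 4 * \<gamma>"
    using fg ga by (auto simp: abs_mult)
  have "V (?X + \<gamma> * f) (?Y + \<gamma> * g) \<le> V ?X ?Y + Vx ?X ?Y * (\<gamma> * f) + Vy ?X ?Y * (\<gamma> * g)
       + 40 / e^2 * ((\<gamma> * f)^2 + (\<gamma> * g)^2)"
    using hk ga eta e xt yt by (intro V_taylor) auto
  also have "\<dots> = V ?X ?Y + \<gamma> * (Vx ?X ?Y * f + Vy ?X ?Y * g + 40 / e^2 * (\<gamma> * (f^2 + g^2)))"
  proof -
    have "(\<gamma> * f)^2 + (\<gamma> * g)^2 = \<gamma> * (\<gamma> * (f^2 + g^2))"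
      by (simp add: power2_eq_square algebra_simps)
    then show ?thesis by (simp add: algebra_simps)
  qed
  finally have taylor: "V (?X + \<gamma> * f) (?Y + \<gamma> * g)
    \<le> V ?X ?Y + \<gamma> * (Vx ?X ?Y * f + Vy ?X ?Y * g + 40 / e^2 * (\<gamma> * (f^2 + g^2)))" .
  have "Vx ?X ?Y * f + Vy ?X ?Y * g + 40 / e^2 * (\<gamma> * (f^2 + g^2))
      \<le> 480 * \<eta> / e^2 - \<delta> / 8 * ((?X^2 - r^2)^2 + (?Y - s)^2)"
  proof -
    have df: "\<bar>f - drift_x m ?X ?Y\<bar> \<le> 10 * \<eta>"
      unfolding f_def using eta xt e x1[of n] y1[of n] y0[of n] by (intro drift_x_diff) auto
    have dg: "\<bar>g - drift_y m ?X ?Y\<bar> \<le> 10 * \<eta>"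
      unfolding g_def using eta xt yt e x1[of n] y1[of n] y0[of n] by (intro drift_y_diff) auto
    have vx: "Vx ?X ?Y * (f - drift_x m ?X ?Y) \<le> 8 / e * (10 * \<eta>)"
    proof -
      have "Vx ?X ?Y * (f - drift_x m ?X ?Y) \<le> \<bar>Vx ?X ?Y\<bar> * \<bar>f - drift_x m ?X ?Y\<bar>"
        by (metis abs_ge_self abs_mult)
      also have "\<dots> \<le> 8 / e * (10 * \<eta>)" using abs_Vx_le[of e ?X ?Y] e xt yt df by (intro mult_mono) auto
      finally show ?thesis .
    qed
    have vy: "Vy ?X ?Y * (g - drift_y m ?X ?Y) \<le> 8 / e * (10 * \<eta>)"
    proof -
      have "Vy ?X ?Y * (g - drift_y m ?X ?Y) \<le> \<bar>Vy ?X ?Y\<bar> * \<bar>g - drift_y m ?X ?Y\<bar>"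
        by (metis abs_ge_self abs_mult)
      also have "\<dots> \<le> 8 / e * (10 * \<eta>)" using abs_Vy_le[of e ?X ?Y] e xt yt dg by (intro mult_mono) auto
      finally show ?thesis .
    qed
    have f2: "f^2 \<le> 4^2" "g^2 \<le> 4^2" using abs_le_square[OF fg(1)] abs_le_square[OF fg(2)] by auto
    have "\<gamma> * (f^2 + g^2) \<le> \<gamma> * 32" using ga f2 by (intro mult_left_mono) auto
    also have "\<dots> \<le> 8 * \<eta>" using ga by simp
    finally have q: "40 / e^2 * (\<gamma> * (f^2 + g^2)) \<le> 40 / e^2 * (8 * \<eta>)"
      by (intro mult_left_mono) auto
    have dis: "Vx ?X ?Y * drift_x m ?X ?Y + Vy ?X ?Y * drift_y m ?X ?Y
      \<le> - (\<delta> / 8) * ((?X^2 - r^2)^2 + (?Y - s)^2)"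
      using xt yt e by (intro dissipation) auto
    have eta0: "0 \<le> \<eta>" using ga by linarith
    have "\<eta> / e \<le> \<eta> / e^2"
      using e eta0 by (intro divide_left_mono) (auto simp: power2_eq_square mult_left_le)
    then have "160 * (\<eta> / e) + 320 * (\<eta> / e^2) \<le> 480 * (\<eta> / e^2)" by linarith
    then show ?thesis using vx vy q dis by (simp add: algebra_simps)
  qed
  from mult_left_mono[OF this, of \<gamma>] ga
  have "\<gamma> * (Vx ?X ?Y * f + Vy ?X ?Y * g + 40 / e^2 * (\<gamma> * (f^2 + g^2)))
     \<le> \<gamma> * (480 * \<eta> / e^2 - \<delta> / 8 * ((?X^2 - r^2)^2 + (?Y - s)^2))" by simp
  then have "V (?X + \<gamma> * f) (?Y + \<gamma> * g) \<le> V ?X ?Y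
      + \<gamma> * (480 * \<eta> / e^2 - \<delta> / 8 * ((?X^2 - r^2)^2 + (?Y - s)^2))"
    by (rule order_trans[OF taylor add_left_mono])
  then show ?thesis unfolding S by (simp add: \<gamma>_def)
qed

text \<open>Frequent visits to \<open>x \<ge> e0\<close> supply start times after which the
  perturbation is as small as desired; from there \<open>V\<close> stays below \<open>T\<close>,
  hence \<open>xt\<close> away from 0, and falls below any positive level.\<close>

lemma tendsto_r:
  assumes e0: "0 < e0" and freq: "\<And>N. \<exists>n\<ge>N. e0 \<le> x n"
  shows "x \<longlonglongrightarrow> r"
proof -
  have e01: "e0 \<le> 1" using freq[of 0] x1 by (meson abs_le_D1 order_trans)
  have ny: "\<not> y \<longlonglongrightarrow> 0"
  proof
    assume "y \<longlonglongrightarrow> 0"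
    then have "\<forall>\<^sub>F n in sequentially. y n < e0" using e0 by (rule order_tendstoD)
    then obtain N where "\<forall>n\<ge>N. y n < e0" by (auto simp: eventually_sequentially)
    then show False using freq[of N] xy by (smt (verit))
  qed
  have "\<forall>\<^sub>F n in sequentially. 2/3 - 1/6 \<le> y n" by (rule eventually_y_ge[OF ny]) simp
  then obtain N1 where N1: "\<And>n. n \<ge> N1 \<Longrightarrow> 1/2 \<le> y n" by (auto simp: eventually_sequentially)
  \<comment> \<open>A bound for \<open>V\<close> at every start with \<open>xt \<ge> e0 / 2\<close>,
    independent of the time: \<open>e\<close> and then \<open>\<eta>\<close> must be fixed before
    the late start \<open>N\<close> is chosen.\<close>
  define T where "T = 2 / (e0/2)^2 * (8^2 + 2^2)"
  have T: "0 < T" using e0 by (simp add: T_def)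
  obtain e where e: "0 < e" "e \<le> 1"
    and sub: "\<And>x y. 0 < x \<Longrightarrow> x \<le> 2 \<Longrightarrow> 0 \<le> y \<Longrightarrow> y \<le> 2 \<Longrightarrow> V x y \<le> T \<Longrightarrow> e \<le> x"
    using V_sublevel[of T] by blast
  have "xt \<longlonglongrightarrow> r"
  proof (rule LIMSEQ_I)
    fix \<epsilon> :: real assume eps: "\<epsilon> > 0"
    \<comment> \<open>\<open>V \<le> 2 \<theta>\<close> yields
      \<open>(xt - r)^2 \<le> 16 \<theta> < \<epsilon>^2\<close>. In \<open>c\<close> below, half of
      the dissipation \<open>\<delta> / 8 * (\<theta> * e^2 / 2)\<close> is kept; the other half
      pays for \<open>\<eta>\<close>.\<close>
    define \<theta> where "\<theta> = min (\<epsilon>^2 / 32) (T / 2)"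
    have th: "0 < \<theta>" "2 * \<theta> \<le> T" "32 * \<theta> \<le> \<epsilon>^2" using eps T by (auto simp: \<theta>_def)
    define c where "c = \<delta> / 16 * (\<theta> * e^2 / 2)"
    have c: "0 < c" using th e \<delta>_bounds by (simp add: c_def)
    define \<eta> where "\<eta> = min (min (e / 2) (e0 / 2)) (min (c * e^2 / 480) (\<theta> * e^2 / 480))"
    have eta: "0 < \<eta>" "\<eta> \<le> e / 2" "\<eta> \<le> e0 / 2" using e e0 c th by (auto simp: \<eta>_def)
    have "480 * \<eta> \<le> c * e^2" "480 * \<eta> \<le> \<theta> * e^2" by (auto simp: \<eta>_def)
    then have eta2: "480 * \<eta> / e^2 \<le> c" "480 * \<eta> / e^2 \<le> \<theta>"
      using e by (auto simp: pos_divide_le_eq)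
    obtain N0 where N0: "N0 \<ge> 2" "\<forall>n\<ge>N0. \<bar>xt n - x n\<bar> < \<eta> \<and> \<bar>yt n - y n\<bar> < \<eta> \<and> 4 / real (Suc n) < \<eta>"
      using close[OF eta(1)] by blast
    obtain N where N: "N \<ge> max N0 N1" "e0 \<le> x N" using freq by blast
    have range: "xt n \<le> 2 \<and> 0 \<le> yt n \<and> yt n \<le> 2 \<and> n \<ge> 2 \<and> \<bar>xt n - x n\<bar> < \<eta> \<and> \<bar>yt n - y n\<bar> < \<eta> \<and> 4 / real (Suc n) < \<eta>"
      if "n \<ge> N" for n
    proof -
      have "\<bar>xt n - x n\<bar> < \<eta>" "\<bar>yt n - y n\<bar> < \<eta>" "4 / real (Suc n) < \<eta>" "n \<ge> 2"
        using N0 N that by auto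
      moreover have "1/2 \<le> y n" using N1 N that by simp
      ultimately show ?thesis using x1[of n] y1[of n] eta e by auto
    qed
    \<comment> \<open>For \<open>xt \<le> 0\<close> the logarithm is meaningless; the value
      \<open>T + 1\<close> lies outside the region where the capture argument asks for a
      decrease.\<close>
    define v where "v n = (if 0 < xt n then V (xt n) (yt n) else T + 1)" for n
    have step: "v (Suc n) \<le> v n + (480 * \<eta> / e^2 - \<delta> / 8 * (((xt n)^2 - r^2)^2 + (yt n - s)^2)) / real (Suc n)"
      and pos: "e \<le> xt n" if n: "n \<ge> N" and vT: "v n \<le> T" for n
    proof -
      have p: "0 < xt n" "V (xt n) (yt n) \<le> T" using vT by (auto simp: v_def split: if_splits)
      show ex: "e \<le> xt n" using sub[OF p(1) _ _ _ p(2)] range[OF n] by auto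
      have "\<bar>xt (Suc n) - xt n\<bar> \<le> 4 / real (Suc n)" using range[OF n] xt_step by auto
      then have "0 < xt (Suc n)" using range[OF n] ex eta e by auto
      then have "v (Suc n) = V (xt (Suc n)) (yt (Suc n))" "v n = V (xt n) (yt n)"
        using p by (auto simp: v_def)
      then show "v (Suc n) \<le> v n + (480 * \<eta> / e^2 - \<delta> / 8 * (((xt n)^2 - r^2)^2 + (yt n - s)^2)) / real (Suc n)"
        using V_step[OF e _ ex, of \<eta>] range[OF n] eta by auto
    qed
    have "\<forall>\<^sub>F n in sequentially. v n \<le> 2 * \<theta>"
    proof (rule lyapunov_capture[where T = T and N = N and c = c and \<theta> = \<theta> and B = 0])
      have "e0 / 2 \<le> xt N" using range[of N] N eta by auto
      then have "V (xt N) (yt N) \<le> 2 / (e0/2)^2 * (((xt N)^2 - r^2)^2 + (yt N - s)^2)"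
        using e0 e01 range[of N] by (intro V_upper) auto
      also have "\<dots> \<le> T" unfolding T_def
      proof (intro mult_left_mono add_mono)
        have "\<bar>(xt N)^2 - r^2\<bar> \<le> 4 * \<bar>xt N - r\<bar>"
          using \<open>e0 / 2 \<le> xt N\<close> e0 range[of N] by (intro abs_P_le) auto
        also have "\<dots> \<le> 8" using \<open>e0 / 2 \<le> xt N\<close> e0 range[of N] r_pos r_less by auto
        finally show "((xt N)^2 - r^2)^2 \<le> 8^2" by (rule abs_le_square)
        have "\<bar>yt N - s\<bar> \<le> 2" using range[of N] s_bounds by auto
        then show "(yt N - s)^2 \<le> 2^2" by (rule abs_le_square)
      qed simp
      finally show "v N \<le> T" using \<open>e0 / 2 \<le> xt N\<close> e0 by (simp add: v_def)
      show "0 \<le> v n" if "N \<le> n" for n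
      proof (cases "0 < xt n")
        case True
        have "0 \<le> 1/8 * ((xt n - r)^2 + (yt n - s)^2)" by simp
        also have "\<dots> \<le> V (xt n) (yt n)" using True range[OF that] by (intro V_lower) auto
        finally show ?thesis using True by (simp add: v_def)
      qed (use T in \<open>simp add: v_def\<close>)
      show "v (Suc n) \<le> 2 * \<theta>" if n: "N \<le> n" and vn: "v n \<le> \<theta>" for n
      proof -
        have "v n \<le> T" using vn th by linarith
        moreover have "(480 * \<eta> / e^2 - \<delta> / 8 * (((xt n)^2 - r^2)^2 + (yt n - s)^2)) / real (Suc n) \<le> \<theta>"
        proof -
          have "0 \<le> \<delta> / 8 * (((xt n)^2 - r^2)^2 + (yt n - s)^2)" using \<delta>_bounds by simp
          then have "480 * \<eta> / e^2 - \<delta> / 8 * (((xt n)^2 - r^2)^2 + (yt n - s)^2) \<le> \<theta>"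
            using eta2 by linarith
          then have "(480 * \<eta> / e^2 - \<delta> / 8 * (((xt n)^2 - r^2)^2 + (yt n - s)^2)) / real (Suc n) \<le> \<theta> / real (Suc n)"
            by (intro divide_right_mono) auto
          also have "\<dots> \<le> \<theta>" using th by (simp add: pos_divide_le_eq)
          finally show ?thesis .
        qed
        ultimately show ?thesis using step[OF n] vn by linarith
      qed
      show "v (Suc n) \<le> v n - c / real (Suc n)" if n: "N \<le> n" and vn: "\<theta> \<le> v n" "v n \<le> T" for n
      proof -
        have ex: "e \<le> xt n" using pos n vn by blast
        let ?G = "((xt n)^2 - r^2)^2 + (yt n - s)^2"
        have "\<theta> \<le> V (xt n) (yt n)" using vn ex e by (simp add: v_def)
        also have "\<dots> \<le> 2 / e^2 * ?G"
          using e ex range[OF n] by (intro V_upper) auto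
        finally have "\<theta> * e^2 / 2 \<le> ?G" using e by (simp add: field_simps)
        then have "\<delta> / 8 * (\<theta> * e^2 / 2) \<le> \<delta> / 8 * ?G" using \<delta>_bounds by (intro mult_left_mono) auto
        then have "480 * \<eta> / e^2 - \<delta> / 8 * ?G \<le> - c" using eta2 unfolding c_def by linarith
        then have "(480 * \<eta> / e^2 - \<delta> / 8 * ?G) / real (Suc n) \<le> - c / real (Suc n)"
          by (intro divide_right_mono) auto
        then show ?thesis using step[OF n vn(2)] by simp
      qed
    qed (use th c in auto)
    then obtain n0 where n0: "\<And>n. n \<ge> n0 \<Longrightarrow> v n \<le> 2 * \<theta>" by (auto simp: eventually_sequentially)
    have "norm (xt n - r) < \<epsilon>" if n: "n \<ge> max n0 N" for n
    proof -
      have v: "v n \<le> 2 * \<theta>" using n0 n by simp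
      then have p: "0 < xt n" "V (xt n) (yt n) \<le> 2 * \<theta>"
        using th by (auto simp: v_def split: if_splits)
      have "1/8 * ((xt n - r)^2 + (yt n - s)^2) \<le> 2 * \<theta>"
        using V_lower[OF p(1), of "yt n"] p range[of n] n by auto
      moreover have "A < E" if "1/8 * (A + B) \<le> 2 * \<theta>" "0 \<le> B" "32 * \<theta> \<le> E" for A B E :: real
        using that th(1) by argo
      ultimately have "(xt n - r)^2 < \<epsilon>^2" using th(3) zero_le_power2[of "yt n - s"] by blast
      then show ?thesis using eps by (metis abs_of_pos abs_le_square not_less power2_abs real_norm_def power2_less_imp_less abs_ge_zero less_imp_le)
    qed
    then show "\<exists>no. \<forall>n\<ge>no. norm (xt n - r) < \<epsilon>" by blast
  qed
  then show ?thesis using tendsto_diff[OF _ xt_lim, of xt r] by simp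
qed

text \<open>If \<open>x\<close> does not keep returning above \<open>e0\<close>, then
  \<open>- x\<close> does, and the negated path is again a scheme since \<open>drift_x\<close> is
  odd and \<open>drift_y\<close> even in \<open>x\<close>.\<close>

lemma tendsto_r_or_minus_r:
  assumes "\<not> x \<longlonglongrightarrow> 0"
  shows "x \<longlonglongrightarrow> r \<or> x \<longlonglongrightarrow> - r"
proof -
  obtain e0 where e0: "e0 > 0" "\<And>N. \<exists>n\<ge>N. e0 \<le> \<bar>x n\<bar>"
    using assms unfolding LIMSEQ_iff by (auto simp: not_less)
  show ?thesis
  proof (cases "\<forall>N. \<exists>n\<ge>N. e0 \<le> x n")
    case True
    then show ?thesis using tendsto_r[OF e0(1)] by blast
  next
    case False
    then obtain N1 where N1: "\<And>n. n \<ge> N1 \<Longrightarrow> x n < e0" by (meson not_le)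
    have freq: "\<exists>n\<ge>N. e0 \<le> - x n" for N
    proof -
      obtain n where "n \<ge> max N N1" "e0 \<le> \<bar>x n\<bar>" using e0(2) by blast
      then show ?thesis using N1[of n] by (intro exI[of _ n]) auto
    qed
    interpret neg: supercritical_scheme m "\<lambda>n. - x n" y "\<lambda>n. - xt n" yt
    proof unfold_locales
      show "(\<lambda>n. - xt n - - x n) \<longlonglongrightarrow> 0" using tendsto_minus[OF xt_lim] by simp
    qed (auto simp: m xy y1 xt_Suc yt_Suc yt_lim drift_x_def drift_y_def)
    show ?thesis using neg.tendsto_r[OF e0(1) freq] tendsto_minus_cancel_left by force
  qed
qed

end

section \<open>Series of uncorrelated bounded random variables\<close>

lemma (in prob_space) AE_summable_of_expectation_bound:
  fixes f :: "nat \<Rightarrow> 'a \<Rightarrow> real"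
  assumes int: "\<And>j. integrable M (f j)" and nonneg: "\<And>j w. 0 \<le> f j w"
    and bound: "\<And>j. expectation (f j) \<le> c j" and c: "summable c"
  shows "AE w in M. summable (\<lambda>j. f j w)"
proof -
  have nc: "0 \<le> c j" for j
    using bound[of j] nonneg Bochner_Integration.integral_nonneg[of M "f j"] by (meson order_trans)
  have "(\<integral>\<^sup>+ w. (\<Sum>j. ennreal (f j w)) \<partial>M) = (\<Sum>j. \<integral>\<^sup>+ w. ennreal (f j w) \<partial>M)"
    using int by (intro nn_integral_suminf) auto
  also have "\<dots> = (\<Sum>j. ennreal (expectation (f j)))"
    using int nonneg by (intro suminf_cong nn_integral_eq_integral) auto
  also have "\<dots> \<le> (\<Sum>j. ennreal (c j))"
    using bound by (intro suminf_le ennreal_leI) auto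
  also have "\<dots> = ennreal (\<Sum>j. c j)" using c nc by (intro suminf_ennreal2) auto
  also have "\<dots> < \<infinity>" by simp
  finally have "AE w in M. (\<Sum>j. ennreal (f j w)) \<noteq> \<infinity>"
    using int by (intro nn_integral_PInf_AE) auto
  then show ?thesis
    by eventually_elim (auto intro!: summable_suminf_not_top nonneg)
qed

lemma ex_cube_bracket:
  fixes n :: nat
  assumes "(Suc J0)^3 \<le> n"
  obtains J where "J \<ge> J0" "(Suc J)^3 \<le> n" "n < (Suc (Suc J))^3"
proof -
  have fin: "J \<le> n" if "(Suc J)^3 \<le> n" for J
  proof -
    have "J \<le> Suc J ^ 1" by simp
    also have "\<dots> \<le> Suc J ^ 3" by (intro power_increasing) auto
    finally show ?thesis using that by simp
  qed
  define J where "J = (GREATEST J. (Suc J)^3 \<le> n)"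
  have 1: "(Suc J)^3 \<le> n" unfolding J_def
    by (rule GreatestI_nat[where P = "\<lambda>J. (Suc J)^3 \<le> n" and b = n]) (use assms fin in auto)
  have 2: "J0 \<le> J" unfolding J_def
    by (rule Greatest_le_nat[where P = "\<lambda>J. (Suc J)^3 \<le> n" and b = n]) (use assms fin in auto)
  have "\<not> (Suc (Suc J))^3 \<le> n"
  proof
    assume "(Suc (Suc J))^3 \<le> n"
    then have "Suc J \<le> J" unfolding J_def
      by (intro Greatest_le_nat[where P = "\<lambda>J. (Suc J)^3 \<le> n" and b = n]) (use fin in auto)
    then show False by simp
  qed
  then show ?thesis using that 1 2 by auto
qed

lemma card_cube_block: "real (card {(Suc j)^3<..(Suc (Suc j))^3}) \<le> 7 * (real (Suc j))^2"
proof -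
  have "(Suc j)^3 \<le> (Suc (Suc j))^3" by (intro power_mono) auto
  then have "real (card {(Suc j)^3<..(Suc (Suc j))^3}) = real ((Suc (Suc j))^3) - real ((Suc j)^3)"
    by (simp add: of_nat_diff)
  also have "\<dots> = (real (Suc j) + 1)^3 - (real (Suc j))^3" by (simp add: algebra_simps)
  also have "\<dots> = 3 * (real (Suc j))^2 + 3 * real (Suc j) + 1"
    by (simp only: power3_eq_cube power2_eq_square) algebra
  also have "\<dots> \<le> 7 * (real (Suc j))^2"
  proof -
    have "3 * x^2 + 3 * x + 1 \<le> 7 * x^2" if "1 \<le> x" for x :: real
    proof -
      have "x * 1 \<le> x * x" using that by (intro mult_left_mono) auto
      then show ?thesis using that unfolding power2_eq_square by linarith
    qed
    then show ?thesis by (simp del: of_nat_Suc)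
  qed
  finally show ?thesis .
qed

text \<open>Between consecutive cubes the partial sums move by \<open>O(1/j)\<close>, and along the cubes the increments
  have summable first moments; hence no maximal inequality is needed.\<close>

lemma (in prob_space) AE_convergent_uncorrelated_series:
  fixes \<xi> :: "nat \<Rightarrow> 'a \<Rightarrow> real"
  assumes meas[measurable]: "\<And>k. \<xi> k \<in> borel_measurable M"
    and bound: "\<And>k w. w \<in> space M \<Longrightarrow> \<bar>\<xi> k w\<bar> \<le> C"
    and orth: "\<And>j k. j < k \<Longrightarrow> expectation (\<lambda>w. \<xi> j w * \<xi> k w) = 0"
  shows "AE w in M. convergent (\<lambda>n. \<Sum>k=1..n. \<xi> k w / real k)"
proof -
  obtain w0 where "w0 \<in> space M" using not_empty by blast
  then have C: "0 \<le> C" using bound[of w0 0] by linarith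
  define B where "B j = {(Suc j)^3<..(Suc (Suc j))^3}" for j :: nat
  define b where "b j w = (\<Sum>k\<in>B j. \<xi> k w / real k)" for j w
  have fin: "finite (B j)" for j by (simp add: B_def)
  have [measurable]: "b j \<in> borel_measurable M" for j unfolding b_def by measurable
  have intp: "integrable M (\<lambda>w. \<xi> j w * \<xi> k w)" for j k
  proof (rule integrable_const_bound[where B = "C * C"])
    show "AE w in M. norm (\<xi> j w * \<xi> k w) \<le> C * C"
      using bound C by (intro AE_I2) (auto simp: abs_mult intro!: mult_mono)
  qed measurable
  have B_ge: "real (Suc j) ^ 3 \<le> real k" "0 < k" if "k \<in> B j" for j k
  proof -
    have "(Suc j)^3 < k" using that by (simp add: B_def)
    then show "0 < k" by simp
    have "real ((Suc j)^3) \<le> real k" using \<open>(Suc j)^3 < k\<close> by linarith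
    then show "real (Suc j) ^ 3 \<le> real k" by (simp only: of_nat_power)
  qed
  have b2: "expectation (\<lambda>w. (b j w)^2) \<le> 7 * C^2 / (real (Suc j))^4" for j
  proof -
    have sq: "(b j w)^2 = (\<Sum>k\<in>B j. \<Sum>l\<in>B j. 1 / (real k * real l) * (\<xi> k w * \<xi> l w))" for w
      by (simp add: b_def power2_eq_square sum_product field_simps)
    have "expectation (\<lambda>w. (b j w)^2)
        = (\<Sum>k\<in>B j. \<Sum>l\<in>B j. 1 / (real k * real l) * expectation (\<lambda>w. \<xi> k w * \<xi> l w))"
      unfolding sq using intp by (subst Bochner_Integration.integral_sum)
        (auto intro!: Bochner_Integration.integrable_sum sum.cong integrable_mult_right simp del: times_divide_eq_left)
    also have "\<dots> = (\<Sum>k\<in>B j. 1 / (real k * real k) * expectation (\<lambda>w. \<xi> k w * \<xi> k w))"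
    proof (rule sum.cong[OF refl])
      fix k assume k: "k \<in> B j"
      have z: "expectation (\<lambda>w. \<xi> k w * \<xi> l w) = 0" if "l \<noteq> k" for l
        using orth[of k l] orth[of l k] that by (cases k l rule: linorder_cases) (auto simp: mult.commute)
      have "(\<Sum>l\<in>B j. 1 / (real k * real l) * expectation (\<lambda>w. \<xi> k w * \<xi> l w))
        = (\<Sum>l\<in>B j. if l = k then 1 / (real k * real k) * expectation (\<lambda>w. \<xi> k w * \<xi> k w) else 0)"
        by (intro sum.cong) (auto simp: z)
      then show "(\<Sum>l\<in>B j. 1 / (real k * real l) * expectation (\<lambda>w. \<xi> k w * \<xi> l w))
        = 1 / (real k * real k) * expectation (\<lambda>w. \<xi> k w * \<xi> k w)"
        using k fin by simp
    qed
    also have "\<dots> \<le> (\<Sum>k\<in>B j. 1 / (real (Suc j))^6 * C^2)"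
    proof (intro sum_mono mult_mono)
      fix k assume k: "k \<in> B j"
      have "real (Suc j)^3 * real (Suc j)^3 \<le> real k * real k"
        using B_ge[OF k] by (intro mult_mono) auto
      then have "real (Suc j)^6 \<le> real k * real k" by (simp flip: power_add)
      then show "1 / (real k * real k) \<le> 1 / (real (Suc j))^6"
        by (intro divide_left_mono) (use B_ge[OF k] in auto)
      have "expectation (\<lambda>w. \<xi> k w * \<xi> k w) \<le> expectation (\<lambda>w. C^2)"
      proof (rule integral_mono[OF intp])
        fix w assume "w \<in> space M"
        then have "\<bar>\<xi> k w\<bar>^2 \<le> C^2" using bound by (intro power_mono) auto
        then show "\<xi> k w * \<xi> k w \<le> C^2" by (simp add: power2_eq_square)
      qed simp
      then show "expectation (\<lambda>w. \<xi> k w * \<xi> k w) \<le> C^2" by (simp add: prob_space)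
    qed (auto intro!: integral_nonneg)
    also have "\<dots> = real (card (B j)) * (C^2 / (real (Suc j))^6)" by simp
    also have "\<dots> \<le> 7 * (real (Suc j))^2 * (C^2 / (real (Suc j))^6)"
      using card_cube_block[of j] unfolding B_def by (intro mult_right_mono) auto
    also have "\<dots> = 7 * C^2 / (real (Suc j))^4"
    proof -
      have eq: "(real (Suc j))^6 = (real (Suc j))^2 * (real (Suc j))^4" by (simp flip: power_add)
      have gen: "7 * u * (v / (u * z)) = 7 * v / z" if "u \<noteq> 0" for u v z :: real
        using that by simp
      show ?thesis unfolding eq by (rule gen) simp
    qed
    finally show ?thesis .
  qed
  have int2: "integrable M (\<lambda>w. (b j w)^2)" for j
  proof -
    have sq: "(\<lambda>w. (b j w)^2) = (\<lambda>w. \<Sum>k\<in>B j. \<Sum>l\<in>B j. 1 / (real k * real l) * (\<xi> k w * \<xi> l w))"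
      by (simp add: b_def power2_eq_square sum_product field_simps)
    show ?thesis unfolding sq using intp by (intro Bochner_Integration.integrable_sum integrable_mult_right)
  qed
  \<comment> \<open>By AM-GM the modulus of \<open>b j\<close> is at most half of
    \<open>1 / j^2 + j^2 (b j)^2\<close>, with \<open>j\<close> shifted by one; second moments of
    order \<open>1 / j^4\<close> thus give a dominating series with expectations of order
    \<open>1 / j^2\<close>.\<close>
  have "AE w in M. summable (\<lambda>j. (1 / (real (Suc j))^2 + (real (Suc j))^2 * (b j w)^2) / 2)"
  proof (rule AE_summable_of_expectation_bound)
    show "integrable M (\<lambda>w. (1 / (real (Suc j))^2 + (real (Suc j))^2 * (b j w)^2) / 2)" for j
      using int2 by auto
    show "0 \<le> (1 / (real (Suc j))^2 + (real (Suc j))^2 * (b j w)^2) / 2" for j w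
      by (intro divide_nonneg_nonneg add_nonneg_nonneg mult_nonneg_nonneg) auto
    show "summable (\<lambda>j. (1 + 7 * C^2) / 2 * inverse ((real (Suc j))^2))"
    proof (intro summable_mult)
      have "summable (\<lambda>n. inverse ((real n)^2))"
        using inverse_power_summable[of 2, where 'a = real] by simp
      then show "summable (\<lambda>j. inverse ((real (Suc j))^2))" by (subst summable_Suc_iff)
    qed
    show "expectation (\<lambda>w. (1 / (real (Suc j))^2 + (real (Suc j))^2 * (b j w)^2) / 2)
        \<le> (1 + 7 * C^2) / 2 * inverse ((real (Suc j))^2)" for j
    proof -
      let ?n = "real (Suc j)"
      have "expectation (\<lambda>w. (1 / ?n^2 + ?n^2 * (b j w)^2) / 2) = (1 / ?n^2 + ?n^2 * expectation (\<lambda>w. (b j w)^2)) / 2"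
        using int2 by (simp add: prob_space del: of_nat_Suc)
      also have "\<dots> \<le> (1 / ?n^2 + ?n^2 * (7 * C^2 / ?n^4)) / 2"
        using b2[of j] by (intro divide_right_mono add_left_mono mult_left_mono) auto
      also have "?n^2 * (7 * C^2 / ?n^4) = 7 * C^2 / ?n^2"
      proof -
        have eq: "?n^4 = ?n^2 * ?n^2" by (simp flip: power_add)
        have gen: "u * (v / (u * u)) = v / u" if "u \<noteq> 0" for u v :: real
          using that by simp
        show ?thesis unfolding eq by (rule gen) simp
      qed
      also have "(1 / ?n^2 + 7 * C^2 / ?n^2) / 2 = (1 + 7 * C^2) / 2 * inverse (?n^2)"
      proof -
        have gen: "(1 / u + c / u) / 2 = (1 + c) / 2 * inverse u" for u c :: real
          by (cases "u = 0") (simp_all add: field_simps)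
        show ?thesis by (rule gen)
      qed
      finally show ?thesis .
    qed
  qed
  then show ?thesis
    using AE_space
  proof eventually_elim
    case (elim w)
    define s where "s n = (\<Sum>k=1..n. \<xi> k w / real k)" for n
    have "summable (\<lambda>j. b j w)"
    proof (rule summable_comparison_test'[OF elim(1)])
      fix j :: nat
      let ?n = "real (Suc j)"
      have "2 * (1 / ?n) * (?n * \<bar>b j w\<bar>) \<le> (1 / ?n)^2 + (?n * \<bar>b j w\<bar>)^2" by (rule sum_squares_bound)
      then have "2 * \<bar>b j w\<bar> \<le> 1 / ?n^2 + ?n^2 * (b j w)^2"
        by (simp add: power_mult_distrib power_divide del: of_nat_Suc)
      then show "norm (b j w) \<le> (1 / ?n^2 + ?n^2 * (b j w)^2) / 2" by simp
    qed
    have telescope: "s ((Suc J)^3) = s 1 + (\<Sum>j<J. b j w)" for J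
    proof (induction J)
      case (Suc J)
      have "(Suc J)^3 \<le> (Suc (Suc J))^3" by (intro power_mono) auto
      then have "{1..(Suc (Suc J))^3} = {1..(Suc J)^3} \<union> B J"
        unfolding B_def by (subst ivl_disj_un_two(8)[symmetric, of 1]) auto
      moreover have "{1..(Suc J)^3} \<inter> B J = {}" by (auto simp: B_def)
      ultimately have "s ((Suc (Suc J))^3) = s ((Suc J)^3) + b J w"
        unfolding s_def b_def by (simp add: sum.union_disjoint fin)
      then show ?case using Suc by simp
    qed simp
    define L where "L = s 1 + (\<Sum>j. b j w)"
    have "(\<lambda>J. s ((Suc J)^3)) \<longlonglongrightarrow> L"
      unfolding telescope L_def by (intro tendsto_intros summable_LIMSEQ \<open>summable (\<lambda>j. b j w)\<close>)
    have within: "\<bar>s n - s ((Suc J)^3)\<bar> \<le> 7 * C / real (Suc J)"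
      if n: "(Suc J)^3 \<le> n" "n < (Suc (Suc J))^3" for n J
    proof -
      have "{1..n} = {1..(Suc J)^3} \<union> {(Suc J)^3<..n}" "{1..(Suc J)^3} \<inter> {(Suc J)^3<..n} = {}"
        using n by auto
      then have "s n - s ((Suc J)^3) = (\<Sum>k\<in>{(Suc J)^3<..n}. \<xi> k w / real k)"
        unfolding s_def by (simp add: sum.union_disjoint)
      also have "\<bar>\<dots>\<bar> \<le> (\<Sum>k\<in>{(Suc J)^3<..n}. \<bar>\<xi> k w / real k\<bar>)" by (rule sum_abs)
      also have "\<dots> \<le> (\<Sum>k\<in>B J. \<bar>\<xi> k w / real k\<bar>)"
        using n by (intro sum_mono2) (auto simp: B_def)
      also have "\<dots> \<le> (\<Sum>k\<in>B J. C / (real (Suc J))^3)"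
      proof (rule sum_mono)
        fix k assume "k \<in> B J"
        then show "\<bar>\<xi> k w / real k\<bar> \<le> C / (real (Suc J))^3"
          using B_ge[of k J] bound[OF elim(2), of k] C unfolding abs_divide
          by (intro frac_le) auto
      qed
      also have "\<dots> = real (card (B J)) * (C / (real (Suc J))^3)" by simp
      also have "\<dots> \<le> 7 * (real (Suc J))^2 * (C / (real (Suc J))^3)"
        using card_cube_block[of J] C unfolding B_def by (intro mult_right_mono) auto
      also have "\<dots> = 7 * C / real (Suc J)"
        by (simp add: power2_eq_square power3_eq_cube del: of_nat_Suc)
      finally show ?thesis .
    qed
    have "s \<longlonglongrightarrow> L"
    proof (rule LIMSEQ_I)
      fix \<epsilon> :: real assume e: "\<epsilon> > 0"
      have "\<forall>\<^sub>F J in sequentially. dist (s ((Suc J)^3)) L < \<epsilon> / 2"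
        using e by (intro tendstoD[OF \<open>(\<lambda>J. s ((Suc J)^3)) \<longlonglongrightarrow> L\<close>]) auto
      moreover have "\<forall>\<^sub>F J in sequentially. 7 * C / real (Suc J) < \<epsilon> / 2"
        by (rule order_tendstoD[OF LIMSEQ_Suc[OF lim_const_over_n]]) (use e in auto)
      ultimately have "\<forall>\<^sub>F J in sequentially. dist (s ((Suc J)^3)) L < \<epsilon> / 2 \<and> 7 * C / real (Suc J) < \<epsilon> / 2"
        by (rule eventually_conj)
      then obtain J0 where J0: "\<And>J. J \<ge> J0 \<Longrightarrow> dist (s ((Suc J)^3)) L < \<epsilon> / 2 \<and> 7 * C / real (Suc J) < \<epsilon> / 2"
        unfolding eventually_sequentially by blast
      have "norm (s n - L) < \<epsilon>" if n: "n \<ge> (Suc J0)^3" for n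
      proof -
        obtain J where J: "J \<ge> J0" "(Suc J)^3 \<le> n" "n < (Suc (Suc J))^3"
          using ex_cube_bracket[OF n] .
        then show ?thesis using J0[OF J(1)] within[OF J(2,3)] unfolding dist_real_def real_norm_def by linarith
      qed
      then show "\<exists>no. \<forall>n\<ge>no. norm (s n - L) < \<epsilon>" by blast
    qed
    then show ?case unfolding convergent_def s_def by blast
  qed
qed

section \<open>The walk as a process with a transition kernel\<close>

text \<open>One channel reports \<open>+1\<close> with probability \<open>(y + m x)/2\<close>, where \<open>m = 2 p - 1\<close>, \<open>x\<close> is the
  mean of the past steps and \<open>y\<close> the proportion of nonzero ones, and \<open>0\<close> with probability \<open>1 - y\<close>;
  the next step is \<open>+1\<close> iff both channels report \<open>+1\<close>, or one does and the other reports \<open>0\<close>.\<close>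

definition prob_up :: "real \<Rightarrow> real \<Rightarrow> real \<Rightarrow> real" where
  "prob_up m x y = ((y + m * x) / 2)^2 + 2 * ((y + m * x) / 2) * (1 - y)"

text \<open>Here \<open>u\<close> and \<open>v\<close> are the probabilities that one channel
  reports +1 and -1, so that \<open>u + v = y\<close> and \<open>u - v = m x\<close>. The identity
  is the conditional mean of the next step; \<open>prob_up_sum\<close> is its probability of being
  nonzero.\<close>

lemma prob_up_diff: "prob_up m x y - prob_up m (- x) y = m * x * (2 - y)"
proof -
  define u where "u = (y + m * x) / 2"
  define v where "v = (y + m * (- x)) / 2"
  have uv: "u + v = y" "u - v = m * x" unfolding u_def v_def by argo+
  have "(u^2 + 2 * u * (1 - (u + v))) - (v^2 + 2 * v * (1 - (u + v))) = (u - v) * (2 - (u + v))"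
    by (simp add: power2_eq_square algebra_simps)
  then have "(u^2 + 2 * u * (1 - y)) - (v^2 + 2 * v * (1 - y)) = m * x * (2 - y)" unfolding uv .
  then show ?thesis unfolding prob_up_def u_def v_def .
qed

lemma prob_up_sum: "prob_up m x y + prob_up m (- x) y = 2 * y - 3/2 * y^2 + m^2 * x^2 / 2"
proof -
  define u where "u = (y + m * x) / 2"
  define v where "v = (y + m * (- x)) / 2"
  have uv: "u + v = y" "u - v = m * x" unfolding u_def v_def by argo+
  have "2 * ((u^2 + 2 * u * (1 - (u + v))) + (v^2 + 2 * v * (1 - (u + v)))) = 4 * (u + v) - 3 * (u + v)^2 + (u - v)^2"
    by (simp add: power2_eq_square algebra_simps)
  then have "(u^2 + 2 * u * (1 - y)) + (v^2 + 2 * v * (1 - y)) = 2 * y - 3/2 * y^2 + m^2 * x^2 / 2"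
    unfolding uv power_mult_distrib by argo
  then show ?thesis unfolding prob_up_def u_def v_def .
qed

definition history :: "(nat \<Rightarrow> 'a \<Rightarrow> int) \<Rightarrow> nat \<Rightarrow> 'a \<Rightarrow> int list" where
  "history X n w = map (\<lambda>i. X i w) [1..<Suc n]"

lemma history_Suc: "history X (Suc n) w = history X n w @ [X (Suc n) w]"
  by (simp add: history_def)

lemma length_history [simp]: "length (history X n w) = n"
  by (simp add: history_def)

lemma sum_list_history: "sum_list (history X n w) = walk_S X n w"
  unfolding history_def walk_S_def
  by (subst sum_list_distinct_conv_sum_set) (auto intro!: sum.cong)

lemma sum_list_abs_history: "sum_list (map abs (history X n w)) = (\<Sum>i=1..n. \<bar>X i w\<bar>)"
  unfolding history_def map_map
  by (subst sum_list_distinct_conv_sum_set) (auto intro!: sum.cong)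

text \<open>The kernel is a joint probability with each history, which covers null histories too;
  its value at -1 is that at +1 with \<open>x\<close> negated. Range and first steps are constrained
  at every point of the space, not almost surely, so that histories range over a finite set and
  \<open>1 / Y\<close> is bounded everywhere.\<close>

locale two_channel_process = prob_space M for M :: "'a measure" +
  fixes X :: "nat \<Rightarrow> 'a \<Rightarrow> int" and p :: real
  assumes p: "0 < p" "p < 1"
    and X_meas [measurable]: "\<And>n. X n \<in> measurable M (count_space UNIV)"
    and X_range: "\<And>n w. X n w \<in> {-1, 0, 1}"
    and X_init: "\<And>w. X 1 w \<noteq> 0" "\<And>w. X 2 w \<noteq> 0"
    and kernel: "\<And>n h a. n \<ge> 2 \<Longrightarrow> length h = n \<Longrightarrow> set h \<subseteq> {-1, 0, 1} \<Longrightarrow> a \<in> {-1, 1} \<Longrightarrow>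
      \<P>(w in M. history X n w = h \<and> X (Suc n) w = a)
      = \<P>(w in M. history X n w = h) *
        prob_up (2 * p - 1) (real_of_int a * real_of_int (sum_list h) / real n)
          (real_of_int (sum_list (map abs h)) / real n)"
    and init_symmetric: "\<And>h. \<P>(w in M. history X 2 w = h) = \<P>(w in M. history X 2 w = map uminus h)"
begin

definition m :: real where "m = 2 * p - 1"
abbreviation H :: "nat \<Rightarrow> 'a \<Rightarrow> int list" where "H \<equiv> history X"
definition S :: "nat \<Rightarrow> 'a \<Rightarrow> real" where "S n w = real_of_int (walk_S X n w)"
definition Y :: "nat \<Rightarrow> 'a \<Rightarrow> real" where "Y n w = real_of_int (\<Sum>i=1..n. \<bar>X i w\<bar>)"
definition x :: "nat \<Rightarrow> 'a \<Rightarrow> real" where "x n w = S n w / real n"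
definition y :: "nat \<Rightarrow> 'a \<Rightarrow> real" where "y n w = Y n w / real n"
definition up :: "nat \<Rightarrow> 'a \<Rightarrow> real" where "up n w = prob_up m (x n w) (y n w)"
definition down :: "nat \<Rightarrow> 'a \<Rightarrow> real" where "down n w = prob_up m (- x n w) (y n w)"

lemma m: "\<bar>m\<bar> < 1" using p by (auto simp: m_def)

lemma X_cases: "X n w = -1 \<or> X n w = 0 \<or> X n w = 1" using X_range[of n w] by auto

lemma S_Suc: "S (Suc n) w = S n w + real_of_int (X (Suc n) w)"
  by (simp add: S_def walk_S_def)

lemma Y_Suc: "Y (Suc n) w = Y n w + \<bar>real_of_int (X (Suc n) w)\<bar>"
  by (simp add: Y_def)

lemma abs_S_le: "\<bar>S n w\<bar> \<le> Y n w"
proof (induction n)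
  case (Suc n)
  then show ?case unfolding S_Suc Y_Suc by linarith
qed (simp add: S_def Y_def walk_S_def)

lemma Y_le: "Y n w \<le> real n"
proof (induction n)
  case (Suc n)
  have "\<bar>real_of_int (X (Suc n) w)\<bar> \<le> 1" using X_cases[of "Suc n" w] by auto
  then show ?case using Suc unfolding Y_Suc by simp
qed (simp add: Y_def)

lemma Y_nonneg: "0 \<le> Y n w" using abs_S_le[of n w] by linarith

lemma Y_ge_2: "n \<ge> 2 \<Longrightarrow> 2 \<le> Y n w"
proof (induction n rule: dec_induct)
  case base
  have "\<bar>X 1 w\<bar> = 1" "\<bar>X 2 w\<bar> = 1" using X_cases[of 1 w] X_cases[of 2 w] X_init by auto
  moreover have "{1..2::nat} = {1,2}" by auto
  ultimately show ?case by (simp add: Y_def)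
qed (simp add: Y_Suc)

lemma xy: "\<bar>x n w\<bar> \<le> y n w"
  using abs_S_le[of n w] by (simp add: x_def y_def divide_right_mono)

lemma y_le: "y n w \<le> 1"
  using Y_le[of n w] by (cases n) (simp_all add: y_def)

lemma y_nonneg: "0 \<le> y n w" using xy[of n w] by linarith

section \<open>Finite histories and adapted functions\<close>

definition histories :: "nat \<Rightarrow> int list set" where
  "histories n = {h. set h \<subseteq> {-1, 0, 1} \<and> length h = n}"

lemma finite_histories: "finite (histories n)"
  unfolding histories_def by (rule finite_lists_length_eq) simp

lemma H_in: "H n w \<in> histories n"
  using X_range by (fastforce simp: histories_def history_def)

lemma H_set [measurable]: "{w \<in> space M. H n w = h} \<in> sets M"
proof (cases "length h = n")
  case True
  have "{w \<in> space M. H n w = h} = {w \<in> space M. \<forall>i<n. X (Suc i) w = h ! i}"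
    using True by (auto simp: history_def list_eq_iff_nth_eq simp del: upt_Suc)
  also have "\<dots> \<in> sets M" by measurable
  finally show ?thesis .
next
  case False
  then have empty: "{w \<in> space M. H n w = h} = {}" by auto
  show ?thesis unfolding empty by simp
qed

text \<open>Measurability with respect to the finite algebra generated by the first \<open>n\<close>
  steps, expressed as factoring through \<open>H n\<close>; such real functions take finitely many
  values, hence are integrable.\<close>

definition adapted :: "nat \<Rightarrow> ('a \<Rightarrow> 'b) \<Rightarrow> bool" where
  "adapted n f \<longleftrightarrow> (\<forall>w w'. H n w = H n w' \<longrightarrow> f w = f w')"

lemma adapted_repr:
  assumes "adapted n f"
  obtains F where "\<And>w. f w = F (H n w)"
proof -
  have "f w = f (SOME w'. H n w' = H n w)" for w
  proof -
    have "H n (SOME w'. H n w' = H n w) = H n w" by (rule someI) simp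
    then show ?thesis using assms unfolding adapted_def by metis
  qed
  then show ?thesis by (rule that[of "\<lambda>h. f (SOME w'. H n w' = h)"])
qed

lemma H_meas [measurable]: "H n \<in> measurable M (count_space UNIV)"
proof -
  have "H n -` A \<inter> space M \<in> sets M" for A
  proof -
    have "H n -` A \<inter> space M = (\<Union>h\<in>histories n \<inter> A. {w \<in> space M. H n w = h})"
      using H_in by auto
    also have "\<dots> \<in> sets M" using finite_histories by (intro sets.finite_UN) auto
    finally show ?thesis .
  qed
  then show ?thesis by (auto simp: measurable_def)
qed


lemma adaptedI: "(\<And>w w'. H n w = H n w' \<Longrightarrow> f w = f w') \<Longrightarrow> adapted n f"
  unfolding adapted_def by blast

lemma adaptedD: "adapted n f \<Longrightarrow> H n w = H n w' \<Longrightarrow> f w = f w'"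
  unfolding adapted_def by blast

lemma history_Suc_eqD:
  assumes "H (Suc n) w = H (Suc n) w'"
  shows "H n w = H n w'" "X (Suc n) w = X (Suc n) w'"
  using assms by (auto simp: history_Suc)

lemma adapted_next: "adapted n f \<Longrightarrow> adapted (Suc n) (\<lambda>w. f w (X (Suc n) w))"
  by (rule adaptedI) (metis adaptedD history_Suc_eqD)

lemma adapted_Suc: "adapted n f \<Longrightarrow> adapted (Suc n) f"
  by (rule adaptedI) (metis adaptedD history_Suc_eqD(1))

lemma adapted_mono: "n \<le> k \<Longrightarrow> adapted n f \<Longrightarrow> adapted k f"
  by (induction k rule: dec_induct) (auto intro: adapted_Suc)

lemma adapted_S: "adapted n (S n)"
  unfolding adapted_def S_def sum_list_history[symmetric] by metis

lemma Y_eq: "Y n w = real_of_int (sum_list (map abs (H n w)))"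
  by (simp add: Y_def sum_list_abs_history)

lemma adapted_Y: "adapted n (Y n)"
  unfolding adapted_def Y_eq by metis

lemma adapted_comp2: "adapted n f \<Longrightarrow> adapted n g \<Longrightarrow> adapted n (\<lambda>w. c (f w) (g w))"
  unfolding adapted_def by metis

lemma adapted_SY: "adapted n (\<lambda>w. c (S n w) (Y n w))"
  using adapted_S adapted_Y by (rule adapted_comp2)

lemma adapted_meas:
  fixes f :: "'a \<Rightarrow> real"
  assumes "adapted n f"
  shows "f \<in> borel_measurable M"
proof -
  obtain F where F: "\<And>w. f w = F (H n w)" using adapted_repr[OF assms] by blast
  have "f = F \<circ> H n" using F by auto
  also have "\<dots> \<in> borel_measurable M" by (rule measurable_comp[OF H_meas]) simp
  finally show ?thesis .
qed

lemma S_meas [measurable]: "S n \<in> borel_measurable M"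
  by (rule adapted_meas[OF adapted_S])

lemma Y_meas [measurable]: "Y n \<in> borel_measurable M"
  by (rule adapted_meas[OF adapted_Y])

lemma adapted_integrable:
  fixes f :: "'a \<Rightarrow> real"
  assumes "adapted n f"
  shows "integrable M f"
proof -
  obtain F where F: "\<And>w. f w = F (H n w)" using adapted_repr[OF assms] by blast
  have "norm (f w) \<le> (\<Sum>h\<in>histories n. \<bar>F h\<bar>)" for w
    unfolding F using member_le_sum[of "H n w" "histories n" "\<lambda>h. \<bar>F h\<bar>"] H_in finite_histories by auto
  then show ?thesis
    by (intro integrable_const_bound[OF _ adapted_meas[OF assms]] AE_I2)
qed

text \<open>Both sides are sums over the finitely many histories, and \<open>kernel\<close> matches
  them term by term.\<close>

lemma expectation_next_eq:
  fixes g :: "'a \<Rightarrow> real"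
  assumes n: "n \<ge> 2" and g: "adapted n g" and a: "a \<in> {-1, 1}"
  shows "expectation (\<lambda>w. g w * indicator {w. X (Suc n) w = a} w)
    = expectation (\<lambda>w. g w * prob_up m (real_of_int a * x n w) (y n w))"
proof -
  obtain G where G: "\<And>w. g w = G (H n w)" using adapted_repr[OF g] by blast
  define Q where "Q h = prob_up m (real_of_int a * real_of_int (sum_list h) / real n)
          (real_of_int (sum_list (map abs h)) / real n)" for h
  have Q: "Q (H n w) = prob_up m (real_of_int a * x n w) (y n w)" for w
    by (simp add: Q_def x_def y_def S_def Y_eq sum_list_history)
  have [measurable]: "{w \<in> space M. H n w = h \<and> X (Suc n) w = a} \<in> sets M" for h
    by measurable
  have sum_H: "(\<Sum>h\<in>histories n. c h * indicator {w \<in> space M. H n w = h \<and> P w} w)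
      = c (H n w) * indicator {w. P w} w" if "w \<in> space M" for c :: "int list \<Rightarrow> real" and P w
  proof -
    have "(\<Sum>h\<in>histories n. c h * indicator {w \<in> space M. H n w = h \<and> P w} w)
      = (\<Sum>h\<in>histories n. if h = H n w then c (H n w) * indicator {w. P w} w else 0)"
      using that by (intro sum.cong) (auto simp: indicator_def)
    then show ?thesis using H_in finite_histories by simp
  qed
  have "expectation (\<lambda>w. g w * indicator {w. X (Suc n) w = a} w)
    = expectation (\<lambda>w. \<Sum>h\<in>histories n. G h * indicator {w \<in> space M. H n w = h \<and> X (Suc n) w = a} w)"
    by (intro Bochner_Integration.integral_cong) (simp_all add: sum_H G)
  also have "\<dots> = (\<Sum>h\<in>histories n. G h * \<P>(w in M. H n w = h \<and> X (Suc n) w = a))"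
    by (subst Bochner_Integration.integral_sum) (auto simp: emeasure_eq_measure)
  also have "\<dots> = (\<Sum>h\<in>histories n. (G h * Q h) * \<P>(w in M. H n w = h \<and> True))"
  proof (rule sum.cong[OF refl])
    fix h assume "h \<in> histories n"
    then show "G h * \<P>(w in M. H n w = h \<and> X (Suc n) w = a) = (G h * Q h) * \<P>(w in M. H n w = h \<and> True)"
      using kernel[of n h a] n a by (simp add: histories_def Q_def m_def)
  qed
  also have "\<dots> = expectation (\<lambda>w. \<Sum>h\<in>histories n. (G h * Q h) * indicator {w \<in> space M. H n w = h \<and> True} w)"
    by (subst Bochner_Integration.integral_sum) (auto simp: emeasure_eq_measure)
  also have "\<dots> = expectation (\<lambda>w. g w * prob_up m (real_of_int a * x n w) (y n w))"
  proof (intro Bochner_Integration.integral_cong refl)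
    fix w assume "w \<in> space M"
    then show "(\<Sum>h\<in>histories n. (G h * Q h) * indicator {w \<in> space M. H n w = h \<and> True} w)
      = g w * prob_up m (real_of_int a * x n w) (y n w)"
      using sum_H[of w "\<lambda>h. G h * Q h" "\<lambda>_. True"] by (simp add: G Q)
  qed
  finally show ?thesis .
qed

lemma adapted_up: "adapted n (up n)" "adapted n (down n)"
  unfolding up_def down_def x_def y_def by (rule adapted_SY)+

text \<open>This plays the part of the tower property: given the past, the next step is averaged
  with weights \<open>up\<close>, \<open>down\<close> and the remainder.\<close>

lemma expectation_next:
  fixes f :: "'a \<Rightarrow> int \<Rightarrow> real"
  assumes n: "n \<ge> 2" and f: "adapted n f"
  shows "integrable M (\<lambda>w. f w (X (Suc n) w))"
    and "expectation (\<lambda>w. f w (X (Suc n) w))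
      = expectation (\<lambda>w. up n w * f w 1 + down n w * f w (-1) + (1 - up n w - down n w) * f w 0)"
proof -
  show "integrable M (\<lambda>w. f w (X (Suc n) w))"
    by (rule adapted_integrable[OF adapted_next[OF f]])
  have fa: "adapted n (\<lambda>w. c (f w))" for c :: "(int \<Rightarrow> real) \<Rightarrow> real"
    using f unfolding adapted_def by metis
  \<comment> \<open>Writing the values at 1 and -1 relative to the value at 0 leaves only the events
    that \<open>kernel\<close> describes.\<close>
  define g1 where "g1 w = f w 1 - f w 0" for w
  define g2 where "g2 w = f w (-1) - f w 0" for w
  have g: "adapted n g1" "adapted n g2" "adapted n (\<lambda>w. f w 0)"
    unfolding g1_def g2_def using fa[of "\<lambda>h. h 1 - h 0"] fa[of "\<lambda>h. h (-1) - h 0"] fa[of "\<lambda>h. h 0"] by auto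
  have ind: "integrable M (\<lambda>w. g w * indicator {w. X (Suc n) w = a} w)" if "adapted n g" for g :: "'a \<Rightarrow> real" and a
  proof -
    have "adapted (Suc n) (\<lambda>w. g w * indicator {w. X (Suc n) w = a} w)"
    proof (rule adaptedI)
      fix w w' assume eq: "H (Suc n) w = H (Suc n) w'"
      show "g w * indicator {w. X (Suc n) w = a} w = g w' * indicator {w. X (Suc n) w = a} w'"
        using adaptedD[OF that history_Suc_eqD(1)[OF eq]] history_Suc_eqD(2)[OF eq] by (simp add: indicator_def)
    qed
    then show ?thesis by (rule adapted_integrable)
  qed
  have iu: "integrable M (\<lambda>w. g1 w * up n w)" "integrable M (\<lambda>w. g2 w * down n w)" "integrable M (\<lambda>w. f w 0)"
    using adapted_comp2[OF g(1) adapted_up(1), of "(*)"] adapted_comp2[OF g(2) adapted_up(2), of "(*)"] g(3)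
    by (auto intro: adapted_integrable)
  have "expectation (\<lambda>w. f w (X (Suc n) w)) = expectation (\<lambda>w. f w 0 + g1 w * indicator {w. X (Suc n) w = 1} w
      + g2 w * indicator {w. X (Suc n) w = -1} w)"
  proof (intro Bochner_Integration.integral_cong refl)
    fix w
    show "f w (X (Suc n) w) = f w 0 + g1 w * indicator {w. X (Suc n) w = 1} w
      + g2 w * indicator {w. X (Suc n) w = -1} w"
      using X_cases[of "Suc n" w] by (auto simp: g1_def g2_def)
  qed
  also have "\<dots> = expectation (\<lambda>w. f w 0) + expectation (\<lambda>w. g1 w * indicator {w. X (Suc n) w = 1} w)
      + expectation (\<lambda>w. g2 w * indicator {w. X (Suc n) w = -1} w)"
    using ind g iu(3) by simp
  also have "\<dots> = expectation (\<lambda>w. f w 0) + expectation (\<lambda>w. g1 w * up n w) + expectation (\<lambda>w. g2 w * down n w)"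
    using expectation_next_eq[OF n g(1), of 1] expectation_next_eq[OF n g(2), of "-1"]
    by (simp add: up_def down_def)
  also have "\<dots> = expectation (\<lambda>w. f w 0 + g1 w * up n w + g2 w * down n w)"
    using iu by simp
  also have "\<dots> = expectation (\<lambda>w. up n w * f w 1 + down n w * f w (-1) + (1 - up n w - down n w) * f w 0)"
    by (intro Bochner_Integration.integral_cong) (auto simp: g1_def g2_def algebra_simps)
  finally show "expectation (\<lambda>w. f w (X (Suc n) w))
      = expectation (\<lambda>w. up n w * f w 1 + down n w * f w (-1) + (1 - up n w - down n w) * f w 0)" .
qed

lemma up_minus_down: "up n w - down n w = m * x n w * (2 - y n w)"
  unfolding up_def down_def by (rule prob_up_diff)

lemma up_plus_down: "up n w + down n w = 2 * y n w - 3/2 * (y n w)^2 + m^2 * (x n w)^2 / 2"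
  unfolding up_def down_def by (rule prob_up_sum)

lemma prob_up_nonneg: "\<bar>a\<bar> \<le> b \<Longrightarrow> b \<le> 1 \<Longrightarrow> 0 \<le> prob_up m a b"
proof -
  assume ab: "\<bar>a\<bar> \<le> b" "b \<le> 1"
  have "\<bar>m * a\<bar> \<le> 1 * b" unfolding abs_mult using m ab by (intro mult_mono) auto
  then show ?thesis unfolding prob_up_def using ab by (intro add_nonneg_nonneg mult_nonneg_nonneg) auto
qed

lemma up_down_nonneg: "0 \<le> up n w" "0 \<le> down n w"
  unfolding up_def down_def using xy[of n w] y_le[of n w] by (auto intro: prob_up_nonneg)

text \<open>As \<open>x\<close> is at most \<open>y\<close> and \<open>m\<close> at most 1 in
  modulus, the sum is at most \<open>2 y - y^2 = 1 - (1 - y)^2\<close>.\<close>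

lemma up_down_le_1: "up n w + down n w \<le> 1"
proof -
  have "m^2 * (x n w)^2 \<le> 1 * (y n w)^2"
    using m xy[of n w] abs_le_square[of "x n w" "y n w"] square_le_one[of m] by (intro mult_mono) auto
  moreover have "2 * y n w - (y n w)^2 \<le> 1"
    using zero_le_power2[of "1 - y n w"] by (simp add: power2_eq_square algebra_simps)
  ultimately show ?thesis unfolding up_plus_down by argo
qed

subsection \<open>Stochastic approximation\<close>

definition mean_next :: "(int \<Rightarrow> real) \<Rightarrow> nat \<Rightarrow> 'a \<Rightarrow> real" where
  "mean_next c n w = up n w * c 1 + down n w * c (-1) + (1 - up n w - down n w) * c 0"

text \<open>Martingale differences of \<open>c (X k)\<close>, set to 0 before time 3, where the
  kernel says nothing.\<close>

definition noise :: "(int \<Rightarrow> real) \<Rightarrow> nat \<Rightarrow> 'a \<Rightarrow> real" where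
  "noise c k w = (if k \<ge> 3 then c (X k w) - mean_next c (k - 1) w else 0)"

lemma adapted_mean_next: "adapted n (mean_next c n)"
proof (rule adaptedI)
  fix w w' assume "H n w = H n w'"
  then show "mean_next c n w = mean_next c n w'"
    using adaptedD[OF adapted_up(1)] adaptedD[OF adapted_up(2)] unfolding mean_next_def by metis
qed

lemma adapted_noise: "adapted k (noise c k)"
proof (rule adaptedI)
  fix w w' assume eq: "H k w = H k w'"
  show "noise c k w = noise c k w'"
  proof (cases "k \<ge> 3")
    case True
    then obtain n where k: "k = Suc n" by (cases k) auto
    show ?thesis
      using adaptedD[OF adapted_mean_next history_Suc_eqD(1)[OF eq[unfolded k]]]
        history_Suc_eqD(2)[OF eq[unfolded k]] by (simp add: noise_def k)
  qed (simp add: noise_def)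
qed

lemma abs_mean_next_le:
  assumes "\<And>a. a \<in> {-1, 0, 1} \<Longrightarrow> \<bar>c a\<bar> \<le> 1"
  shows "\<bar>mean_next c n w\<bar> \<le> 1"
proof -
  let ?u = "up n w" and ?d = "down n w"
  have "\<bar>mean_next c n w\<bar> \<le> \<bar>?u * c 1\<bar> + \<bar>?d * c (-1)\<bar> + \<bar>(1 - ?u - ?d) * c 0\<bar>"
    unfolding mean_next_def by linarith
  also have "\<dots> = ?u * \<bar>c 1\<bar> + ?d * \<bar>c (-1)\<bar> + (1 - ?u - ?d) * \<bar>c 0\<bar>"
    using up_down_nonneg[of n w] up_down_le_1[of n w] by (simp add: abs_mult)
  also have "\<dots> \<le> ?u * 1 + ?d * 1 + (1 - ?u - ?d) * 1"
    using up_down_nonneg[of n w] up_down_le_1[of n w] assms by (intro add_mono mult_left_mono) auto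
  finally show ?thesis by simp
qed

text \<open>The earlier noise is known one step before the later one, whose conditional mean is 0,
  so their product has expectation 0.\<close>

lemma AE_noise_convergent:
  assumes c: "\<And>a. a \<in> {-1, 0, 1} \<Longrightarrow> \<bar>c a\<bar> \<le> 1"
  shows "AE w in M. convergent (\<lambda>n. \<Sum>k=1..n. noise c k w / real k)"
proof (rule AE_convergent_uncorrelated_series[where C = 2])
  show "noise c k \<in> borel_measurable M" for k by (rule adapted_meas[OF adapted_noise])
  show "\<bar>noise c k w\<bar> \<le> 2" for k w
  proof -
    have "\<bar>mean_next c (k - 1) w\<bar> \<le> 1" by (rule abs_mean_next_le[OF c])
    moreover have "\<bar>c (X k w)\<bar> \<le> 1" by (rule c[OF X_range])
    ultimately show ?thesis unfolding noise_def by auto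
  qed
  show "expectation (\<lambda>w. noise c j w * noise c k w) = 0" if jk: "j < k" for j k
  proof (cases "k \<ge> 3")
    case True
    then obtain n where k: "k = Suc n" "n \<ge> 2" by (cases k) auto
    define f where "f w a = noise c j w * (c a - mean_next c n w)" for w a
    have "adapted n (noise c j)" using adapted_mono[OF _ adapted_noise, of j n] jk k by simp
    then have f: "adapted n f"
      unfolding f_def
      by (intro adaptedI ext) (metis adaptedD adapted_mean_next)
    have "expectation (\<lambda>w. noise c j w * noise c k w) = expectation (\<lambda>w. f w (X (Suc n) w))"
      using k by (simp add: f_def noise_def)
    also have "\<dots> = expectation (\<lambda>w. up n w * f w 1 + down n w * f w (-1) + (1 - up n w - down n w) * f w 0)"
      by (rule expectation_next(2)[OF k(2) f])
    also have "\<dots> = expectation (\<lambda>w. 0)"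
      by (intro Bochner_Integration.integral_cong) (simp_all add: f_def mean_next_def algebra_simps)
    finally show ?thesis by simp
  qed (simp add: noise_def)
qed

lemma AE_euler_scheme:
  "AE w in M. \<exists>xt yt. euler_scheme m (\<lambda>n. x n w) (\<lambda>n. y n w) xt yt"
proof -
  have "AE w in M. convergent (\<lambda>n. \<Sum>k=1..n. noise real_of_int k w / real k)"
    by (rule AE_noise_convergent) auto
  moreover have "AE w in M. convergent (\<lambda>n. \<Sum>k=1..n. noise (\<lambda>a. \<bar>real_of_int a\<bar>) k w / real k)"
    by (rule AE_noise_convergent) auto
  ultimately show ?thesis
  proof eventually_elim
    case (elim w)
    define N1 where "N1 n = (\<Sum>k=1..n. noise real_of_int k w / real k)" for n
    define N2 where "N2 n = (\<Sum>k=1..n. noise (\<lambda>a. \<bar>real_of_int a\<bar>) k w / real k)" for n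
    obtain L1 L2 where L: "N1 \<longlonglongrightarrow> L1" "N2 \<longlonglongrightarrow> L2"
      using elim unfolding convergent_def N1_def N2_def by blast
    \<comment> \<open>Adding the tail of the convergent noise series cancels the noise of each step,
      and the tail tends to 0.\<close>
    have "euler_scheme m (\<lambda>n. x n w) (\<lambda>n. y n w) (\<lambda>n. x n w + (L1 - N1 n)) (\<lambda>n. y n w + (L2 - N2 n))"
    proof
      show "(\<lambda>n. x n w + (L1 - N1 n) - x n w) \<longlonglongrightarrow> 0"
        using tendsto_diff[OF tendsto_const[of L1] L(1)] by simp
      show "(\<lambda>n. y n w + (L2 - N2 n) - y n w) \<longlonglongrightarrow> 0"
        using tendsto_diff[OF tendsto_const[of L2] L(2)] by simp
      fix n :: nat assume n: "2 \<le> n"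
      \<comment> \<open>The recursion of averages with \<open>r = n + 1\<close>: \<open>A\<close> is
        the old sum, \<open>a\<close> the new term and \<open>b\<close> its conditional
        mean.\<close>
      have gen: "(A + a) / r + (L - (N + (a - b) / r)) = A / (r - 1) + (L - N) + (b - A / (r - 1)) / r"
        if "r > 1" for A a b r L N :: real
      proof -
        define q where "q = A / (r - 1)"
        have A: "A = q * (r - 1)" using that by (simp add: q_def)
        show ?thesis unfolding q_def[symmetric] unfolding A using that by (simp add: field_simps)
      qed
      have 1: "real_of_int (X (Suc n) w) - mean_next real_of_int n w = real_of_int (X (Suc n) w) - m * x n w * (2 - y n w)"
        unfolding up_minus_down[symmetric] by (simp add: mean_next_def)
      have 2: "mean_next (\<lambda>a. \<bar>real_of_int a\<bar>) n w = 2 * y n w - 3/2 * (y n w)^2 + m^2 * (x n w)^2 / 2"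
        unfolding up_plus_down[symmetric] by (simp add: mean_next_def)
      have N: "N1 (Suc n) = N1 n + (real_of_int (X (Suc n) w) - m * x n w * (2 - y n w)) / real (Suc n)"
        "N2 (Suc n) = N2 n + (\<bar>real_of_int (X (Suc n) w)\<bar> - (2 * y n w - 3/2 * (y n w)^2 + m^2 * (x n w)^2 / 2)) / real (Suc n)"
        using n 1 2 by (simp_all add: N1_def N2_def noise_def)
      have "x (Suc n) w + (L1 - N1 (Suc n)) = x n w + (L1 - N1 n) + (m * x n w * (2 - y n w) - x n w) / real (Suc n)"
        using gen[of "real (Suc n)" "S n w" "real_of_int (X (Suc n) w)" L1 "N1 n" "m * x n w * (2 - y n w)"] n
        unfolding N x_def S_Suc by simp
      then show "x (Suc n) w + (L1 - N1 (Suc n)) = x n w + (L1 - N1 n) + drift_x m (x n w) (y n w) / real (Suc n)"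
        by (simp add: drift_x_def algebra_simps)
      have "y (Suc n) w + (L2 - N2 (Suc n)) = y n w + (L2 - N2 n) + (2 * y n w - 3/2 * (y n w)^2 + m^2 * (x n w)^2 / 2 - y n w) / real (Suc n)"
        using gen[of "real (Suc n)" "Y n w" "\<bar>real_of_int (X (Suc n) w)\<bar>" L2 "N2 n" "2 * y n w - 3/2 * (y n w)^2 + m^2 * (x n w)^2 / 2"] n
        unfolding N y_def Y_Suc by simp
      then show "y (Suc n) w + (L2 - N2 (Suc n)) = y n w + (L2 - N2 n) + drift_y m (x n w) (y n w) / real (Suc n)"
        by (simp add: drift_y_def)
    qed (use m in \<open>auto intro: xy y_le\<close>)
    then show ?case by blast
  qed
qed

section \<open>The proportion of nonzero steps does not vanish\<close>

text \<open>For small \<open>y\<close> a step is nonzero with probability about \<open>2 y\<close>,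
  so \<open>1 / y\<close> drifts downwards: its mean increment is at most
  \<open>(1 - (1 / y) / 3) / n\<close>. The value 3 is the fixed point of this recursion, and it is
  not overshot because \<open>n \<ge> 1\<close>.\<close>

lemma expectation_inverse_y_le: "n \<ge> 2 \<Longrightarrow> expectation (\<lambda>w. real n / Y n w) \<le> 3"
proof (induction n rule: dec_induct)
  case base
  have "expectation (\<lambda>w. real 2 / Y 2 w) \<le> expectation (\<lambda>w. 1)"
  proof (rule integral_mono)
    show "integrable M (\<lambda>w. real 2 / Y 2 w)"
      using adapted_SY[of 2 "\<lambda>_ b. real 2 / b"] by (rule adapted_integrable)
    show "real 2 / Y 2 w \<le> 1" for w
      using Y_ge_2[of 2 w] by (simp add: pos_divide_le_eq)
  qed simp
  then show ?case by (simp add: prob_space)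
next
  case (step n)
  define f where "f w a = real (Suc n) / (Y n w + \<bar>real_of_int a\<bar>)" for w a
  have f: "adapted n f"
    unfolding f_def by (intro adaptedI ext) (metis adaptedD adapted_Y)
  have int: "integrable M (\<lambda>w. real n / Y n w)"
    using adapted_SY[of n "\<lambda>_ b. real n / b"] by (rule adapted_integrable)
  have "expectation (\<lambda>w. real (Suc n) / Y (Suc n) w) = expectation (\<lambda>w. f w (X (Suc n) w))"
    by (simp add: f_def Y_Suc)
  also have "\<dots> = expectation (\<lambda>w. up n w * f w 1 + down n w * f w (-1) + (1 - up n w - down n w) * f w 0)"
    by (rule expectation_next(2)[OF step(1) f])
  also have "\<dots> \<le> expectation (\<lambda>w. real n / Y n w + (1 - (real n / Y n w) / 3) / real n)"
  proof (rule integral_mono)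
    show "integrable M (\<lambda>w. up n w * f w 1 + down n w * f w (-1) + (1 - up n w - down n w) * f w 0)"
      unfolding f_def up_def down_def x_def y_def using adapted_SY[of n "\<lambda>a b. prob_up m (a / real n) (b / real n) * (real (Suc n) / (b + \<bar>real_of_int 1\<bar>))
        + prob_up m (- (a / real n)) (b / real n) * (real (Suc n) / (b + \<bar>real_of_int (- 1)\<bar>))
        + (1 - prob_up m (a / real n) (b / real n) - prob_up m (- (a / real n)) (b / real n)) * (real (Suc n) / (b + \<bar>real_of_int 0\<bar>))"]
      by (rule adapted_integrable)
    show "integrable M (\<lambda>w. real n / Y n w + (1 - (real n / Y n w) / 3) / real n)"
      using adapted_SY[of n "\<lambda>_ b. real n / b + (1 - (real n / b) / 3) / real n"] by (rule adapted_integrable)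
    fix w
    define v where "v = Y n w"
    define q where "q = up n w + down n w"
    have v: "2 \<le> v" "v \<le> real n" using Y_ge_2[OF step(1)] Y_le by (auto simp: v_def)
    have n: "0 < real n" using step(1) by simp
    have yv: "y n w = v / real n" by (simp add: y_def v_def)
    have "2 * (v / real n) - 3/2 * (v / real n)^2 \<le> q" unfolding q_def up_plus_down yv by simp
    then have q: "v / real n * (2 - 3/2 * (v / real n)) \<le> q" by (simp add: power2_eq_square algebra_simps)
    have "up n w * f w 1 + down n w * f w (-1) + (1 - up n w - down n w) * f w 0
       = (real n + 1) * (q / (v + 1) + (1 - q) / v)"
    proof -
      have "a * (A / b) + d * (A / b) + (1 - a - d) * (A / e) = A * ((a + d) / b + (1 - (a + d)) / e)"
        for a d A b e :: real
        by (simp add: divide_inverse algebra_simps)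
      from this[of "up n w" "real n + 1" "v + 1" "down n w" v] show ?thesis
        by (simp add: f_def q_def v_def add.commute)
    qed
    also have "q / (v + 1) + (1 - q) / v = 1 / v - q / (v * (v + 1))"
    proof -
      have "1 / (v + 1) = 1 / v - 1 / (v * (v + 1))" using v by (simp add: divide_simps)
      moreover have "q * (a - b) + (1 - q) * a = a - q * b" for a b by (simp add: algebra_simps)
      ultimately have "q * (1 / (v + 1)) + (1 - q) * (1 / v) = 1 / v - q * (1 / (v * (v + 1)))"
        by presburger
      then show ?thesis by simp
    qed
    also have "(real n + 1) * (1 / v - q / (v * (v + 1))) \<le> real n / v + 1 / v - real n * (q / (v * (v + 1)))"
    proof -
      have "0 \<le> q / (v * (v + 1))" using v up_down_nonneg[of n w] by (simp add: q_def)
      moreover have "(N + 1) * (a - b) \<le> N * a + a - N * b" if "0 \<le> b" for N a b :: real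
        using that by (simp add: algebra_simps)
      ultimately show ?thesis by (metis times_divide_eq_right mult.right_neutral)
    qed
    finally have A: "up n w * f w 1 + down n w * f w (-1) + (1 - up n w - down n w) * f w 0
      \<le> real n / v + 1 / v - real n * (q / (v * (v + 1)))" .
    have B: "4/3 * (1 / v) - 1 / real n \<le> real n * (q / (v * (v + 1)))"
    proof -
      \<comment> \<open>This is \<open>v \<ge> 2\<close>, guaranteed by the two nonzero first
        steps.\<close>
      have "1 / (v + 1) \<ge> 2 / (3 * v)" using v by (simp add: field_simps)
      moreover have "2 - 3/2 * (v / real n) \<ge> 0" using v n by (simp add: field_simps)
      ultimately have "(2 - 3/2 * (v / real n)) * (2 / (3 * v)) \<le> (2 - 3/2 * (v / real n)) * (1 / (v + 1))"
        by (intro mult_left_mono) auto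
      also have "\<dots> = real n * ((v / real n * (2 - 3/2 * (v / real n))) / (v * (v + 1)))"
        using v n by simp
      also have "\<dots> \<le> real n * (q / (v * (v + 1)))"
        using q v n by (intro mult_left_mono divide_right_mono) auto
      also have "(2 - 3/2 * (v / real n)) * (2 / (3 * v)) = 4/3 * (1 / v) - 1 / real n"
        using v n by (simp add: field_simps)
      finally show ?thesis .
    qed
    from A B have "up n w * f w 1 + down n w * f w (-1) + (1 - up n w - down n w) * f w 0
       \<le> real n / v + 1 / v - (4/3 * (1 / v) - 1 / real n)" by simp
    also have "\<dots> = real n / v + (1 - (real n / v) / 3) / real n"
      using v n by (simp add: field_simps)
    finally show "up n w * f w 1 + down n w * f w (-1) + (1 - up n w - down n w) * f w 0
       \<le> real n / Y n w + (1 - (real n / Y n w) / 3) / real n" by (simp add: v_def)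
  qed
  also have "\<dots> = expectation (\<lambda>w. real n / Y n w) + (1 - expectation (\<lambda>w. real n / Y n w) / 3) / real n"
  proof -
    define g where "g w = real n / Y n w" for w
    have "integrable M g" using int by (simp add: g_def[abs_def])
    then have "expectation (\<lambda>w. g w + (1 - g w / 3) / real n) = expectation g + (1 - expectation g / 3) / real n"
      by (simp add: prob_space)
    then show ?thesis unfolding g_def .
  qed
  also have "\<dots> \<le> 3"
  proof -
    define a where "a = expectation (\<lambda>w. real n / Y n w)"
    have "a \<le> 3" using step.IH by (simp add: a_def)
    moreover have "1 \<le> real n" using step(1) by simp
    then have "(1 - a / 3) / real n \<le> (1 - a / 3) / 1" using \<open>a \<le> 3\<close> by (intro divide_left_mono) auto
    ultimately have "a + (1 - a / 3) / real n \<le> 3" by argo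
    then show ?thesis unfolding a_def .
  qed
  finally show ?case .
qed

text \<open>By Fatou, the lower limit of \<open>n / Y n\<close> has expectation at most 3 and is
  finite almost surely, while \<open>y\<close> tending to 0 would make it infinite.\<close>

lemma AE_y_not_tendsto_zero: "AE w in M. \<not> (\<lambda>n. y n w) \<longlonglongrightarrow> 0"
proof -
  let ?f = "\<lambda>n w. ennreal (real n / Y n w)"
  have "(\<integral>\<^sup>+ w. liminf (\<lambda>n. ?f n w) \<partial>M) \<le> liminf (\<lambda>n. \<integral>\<^sup>+ w. ?f n w \<partial>M)"
    by (rule nn_integral_liminf) simp
  also have "\<dots> \<le> liminf (\<lambda>n. ennreal 3)"
  proof (rule Liminf_mono)
    show "\<forall>\<^sub>F n in sequentially. (\<integral>\<^sup>+ w. ?f n w \<partial>M) \<le> ennreal 3"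
      using eventually_ge_at_top[of 2]
    proof eventually_elim
      case (elim n)
      have "(\<integral>\<^sup>+ w. ?f n w \<partial>M) = ennreal (expectation (\<lambda>w. real n / Y n w))"
        using adapted_integrable[OF adapted_SY[of n "\<lambda>_ b. real n / b"]] Y_nonneg
        by (intro nn_integral_eq_integral) auto
      then show ?case using expectation_inverse_y_le[OF elim] by (simp add: ennreal_leI del: ennreal_numeral)
    qed
  qed
  also have "\<dots> < \<infinity>" by (simp add: Liminf_const)
  finally have "AE w in M. liminf (\<lambda>n. ?f n w) \<noteq> \<infinity>"
    by (intro nn_integral_PInf_AE) auto
  then show ?thesis
  proof eventually_elim
    case (elim w)
    show ?case
    proof
      assume "(\<lambda>n. y n w) \<longlonglongrightarrow> 0"
      moreover have "\<forall>\<^sub>F n in sequentially. 0 < y n w"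
      proof (rule eventually_mono[OF eventually_ge_at_top[of 2]])
        fix n :: nat assume "2 \<le> n"
        then show "0 < y n w" using Y_ge_2[of n w] by (simp add: y_def)
      qed
      ultimately have "filterlim (\<lambda>n. y n w) (at_right 0) sequentially"
        by (auto simp: filterlim_at elim: eventually_mono)
      then have "filterlim (\<lambda>n. inverse (y n w)) at_top sequentially"
        by (rule filterlim_compose[OF filterlim_inverse_at_top_right])
      then have "((\<lambda>n. ennreal (inverse (y n w))) \<longlongrightarrow> \<infinity>) sequentially"
        unfolding infinity_ennreal_def by (subst ennreal_tendsto_top_eq_at_top)
      then have "((\<lambda>n. ?f n w) \<longlongrightarrow> \<infinity>) sequentially"
        by (simp add: y_def)
      then show False using elim by (simp add: lim_imp_Liminf)
    qed
  qed
qed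

subsection \<open>Escape from the symmetric equilibrium\<close>

lemma adapted_pred_sets:
  assumes "adapted n P"
  shows "{w \<in> space M. P w} \<in> sets M"
proof -
  obtain F where F: "\<And>w. P w = F (H n w)" using adapted_repr[OF assms] by blast
  have "{w \<in> space M. P w} = H n -` {h. F h} \<inter> space M" by (auto simp: F)
  also have "\<dots> \<in> sets M" by (rule measurable_sets[OF H_meas]) simp
  finally show ?thesis .
qed

lemma expectation_of_bool:
  assumes "adapted n P"
  shows "expectation (\<lambda>w. of_bool (P w)) = \<P>(w in M. P w)"
proof -
  have "expectation (\<lambda>w. of_bool (P w)) = expectation (\<lambda>w. indicator {w \<in> space M. P w} w)"
    by (intro Bochner_Integration.integral_cong) (auto simp: indicator_def)
  also have "\<dots> = \<P>(w in M. P w)"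
    using adapted_pred_sets[OF assms] by (simp add: Int_absorb2 sets.sets_into_space)
  finally show ?thesis .
qed

lemma adapted_mult_S:
  assumes "adapted n P"
  shows "adapted n (\<lambda>w. of_bool (P w) * (g (S n w) :: real))"
proof (rule adaptedI)
  fix w w' assume eq: "H n w = H n w'"
  show "of_bool (P w) * g (S n w) = of_bool (P w') * g (S n w')"
    using adaptedD[OF assms eq] adaptedD[OF adapted_S eq] by simp
qed

lemma integrable_mult_S:
  assumes "adapted n P"
  shows "integrable M (\<lambda>w. of_bool (P w) * (g (S n w) :: real))"
  by (rule adapted_integrable[OF adapted_mult_S[OF assms]])

text \<open>A supermartingale step for a potential that changes with time (\<open>g0\<close> now,
  \<open>g\<close> next), localised to an event \<open>P\<close> of the past; applied along
  decreasing events it does the work of a stopping time.\<close>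

lemma expectation_S_step:
  fixes g g0 :: "real \<Rightarrow> real"
  assumes n: "n \<ge> 2" and P: "adapted n P"
    and le: "\<And>w. P w \<Longrightarrow> up n w * g (S n w + 1) + down n w * g (S n w - 1) + (1 - up n w - down n w) * g (S n w)
      \<le> c * g0 (S n w)"
  shows "expectation (\<lambda>w. of_bool (P w) * g (S (Suc n) w)) \<le> c * expectation (\<lambda>w. of_bool (P w) * g0 (S n w))"
proof -
  define f where "f w a = of_bool (P w) * g (S n w + real_of_int a)" for w a
  have f: "adapted n f"
  proof (rule adaptedI)
    fix w w' assume eq: "H n w = H n w'"
    show "f w = f w'"
      using adaptedD[OF P eq] adaptedD[OF adapted_S eq] by (intro ext) (simp add: f_def)
  qed
  define F where "F w = up n w * f w 1 + down n w * f w (-1) + (1 - up n w - down n w) * f w 0" for w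
  have F: "adapted n F"
  proof (rule adaptedI)
    fix w w' assume eq: "H n w = H n w'"
    show "F w = F w'"
      using adaptedD[OF adapted_up(1) eq] adaptedD[OF adapted_up(2) eq] adaptedD[OF f eq] by (simp add: F_def)
  qed
  have "expectation (\<lambda>w. of_bool (P w) * g (S (Suc n) w)) = expectation (\<lambda>w. f w (X (Suc n) w))"
    by (simp add: f_def S_Suc)
  also have "\<dots> = expectation F"
    unfolding F_def by (rule expectation_next(2)[OF n f])
  also have "\<dots> \<le> expectation (\<lambda>w. c * (of_bool (P w) * g0 (S n w)))"
  proof (rule integral_mono)
    show "integrable M F" by (rule adapted_integrable[OF F])
    show "integrable M (\<lambda>w. c * (of_bool (P w) * g0 (S n w)))"
      by (rule integrable_mult_right[OF integrable_mult_S[OF P]])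
    show "F w \<le> c * (of_bool (P w) * g0 (S n w))" for w
      using le[of w] by (cases "P w") (simp_all add: F_def f_def)
  qed
  finally show ?thesis by simp
qed

text \<open>The lower bound makes the next step nonzero with probability at least 1/2, so the noise
  cannot degenerate; the upper bound \<open>b\<close> will keep the growth exponent
  \<open>m (2 - y)\<close> of \<open>S\<close> above 1.\<close>

definition good :: "real \<Rightarrow> nat \<Rightarrow> 'a \<Rightarrow> bool" where
  "good b n w \<longleftrightarrow> 1/2 \<le> y n w \<and> y n w \<le> b"

lemma adapted_good: "adapted n (good b n)"
  unfolding good_def y_def by (rule adapted_SY)

lemma good_nonzero_prob: "good b n w \<Longrightarrow> 1/2 \<le> up n w + down n w"
proof -
  assume "good b n w"
  then have "0 \<le> (y n w - 1/2) * (1 - y n w)" using y_le[of n w] by (simp add: good_def)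
  moreover have "(y n w - 1/2) * (1 - y n w) = 3/2 * y n w - (y n w)^2 - 1/2"
    by (simp add: power2_eq_square algebra_simps)
  moreover have "0 \<le> m^2 * (x n w)^2" by simp
  moreover have "(y n w)^2 \<le> y n w" using y_le[of n w] y_nonneg[of n w] by (simp add: power2_eq_square mult_left_le)
  ultimately show ?thesis unfolding up_plus_down by argo
qed

end

section \<open>One-step drift of the two escape potentials\<close>

lemma inverse_quadratic_bound:
  fixes t :: real
  assumes "- 1/2 \<le> t"
  shows "1 / (1 + t) \<le> 1 - t + 2 * t^2"
proof -
  have "1 \<le> (1 - t + 2 * t^2) * (1 + t)"
  proof -
    have "0 \<le> t^2 * (1 + 2 * t)" using assms by simp
    then show ?thesis by (simp add: power2_eq_square algebra_simps)
  qed
  then show ?thesis using assms by (simp add: pos_divide_le_eq)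
qed

lemma inverse_square_bound:
  fixes t :: real
  assumes "- 1/2 \<le> t" "t \<le> 1/2"
  shows "1 / (1 + t)^2 \<le> 1 - 2 * t + 8 * t^2"
proof -
  have "0 \<le> t^2 * ((1 + 2 * t) * (5 + 4 * t))" using assms by simp
  then have "1 \<le> (1 - 2 * t + 8 * t^2) * (1 + t)^2"
    by (simp add: power2_eq_square algebra_simps)
  moreover have "0 < (1 + t)^2" using assms by (simp add: zero_less_power2)
  ultimately show ?thesis by (simp add: pos_divide_le_eq)
qed

text \<open>The constant 32 absorbs the second-order terms.\<close>

lemma inverse_quadratic_drift:
  fixes S u d \<kappa> n :: real
  assumes n: "2000 \<le> n" and ud: "0 \<le> u" "0 \<le> d" "1/2 \<le> u + d" "u + d \<le> 1"
    and mean: "u - d = \<kappa> * (S / n)" and \<kappa>: "1 \<le> \<kappa>"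
  shows "u * ((n + 1) / ((S + 1)^2 + 32 * (n + 1))) + d * ((n + 1) / ((S - 1)^2 + 32 * (n + 1)))
      + (1 - u - d) * ((n + 1) / (S^2 + 32 * (n + 1)))
    \<le> (1 - (1/100) / n) * (n / (S^2 + 32 * n))"
proof -
  define Q where "Q = S^2 + 32 * n"
  \<comment> \<open>Bounds \<open>(2 |S| + 33)^2\<close>, hence the squared increment
    \<open>\<Delta>\<close> of \<open>Q\<close>; 2178 is \<open>2 * 33^2\<close>.\<close>
  define D where "D = 8 * S^2 + 2178"
  have Q: "64000 \<le> Q" "0 < Q" using n zero_le_power2[of S] unfolding Q_def by linarith+
  have S_le: "2 * \<bar>S\<bar> \<le> Q / 2"
    using zero_le_power2[of "\<bar>S\<bar> - 2"] n by (simp add: Q_def power2_eq_square algebra_simps)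
  have one: "1 / (Q + \<Delta>) \<le> (1 - \<Delta> / Q + 2 * D / Q^2) / Q"
    if "\<Delta> = 2 * a * S + a^2 + 32" "\<bar>a\<bar> \<le> 1" for a \<Delta>
  proof -
    have aS: "\<bar>a * S\<bar> \<le> 1 * \<bar>S\<bar>" unfolding abs_mult using that by (intro mult_right_mono) auto
    have a2: "0 \<le> a^2" "a^2 \<le> 1" using that by (auto intro: square_le_one)
    have "- (Q / 2) \<le> \<Delta>" unfolding that(1) mult.assoc using aS a2 S_le by linarith
    then have t: "- 1/2 \<le> \<Delta> / Q" using Q by (simp add: field_simps)
    have "\<bar>\<Delta>\<bar> \<le> 2 * \<bar>S\<bar> + 33" unfolding that(1) mult.assoc using aS a2 by linarith
    then have "\<Delta>^2 \<le> (2 * \<bar>S\<bar> + 33)^2" by (rule abs_le_square)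
    also have "\<dots> \<le> D"
      using zero_le_power2[of "2 * \<bar>S\<bar> - 33"] by (simp add: D_def power2_eq_square algebra_simps)
    finally have D: "\<Delta>^2 \<le> D" .
    have "Q + \<Delta> = (1 + \<Delta> / Q) * Q" using Q by (simp add: field_simps)
    then have "1 / (Q + \<Delta>) = (1 / (1 + \<Delta> / Q)) / Q" by simp
    also have "\<dots> \<le> (1 - \<Delta> / Q + 2 * (\<Delta> / Q)^2) / Q"
      using inverse_quadratic_bound[OF t] Q by (intro divide_right_mono) auto
    also have "\<dots> \<le> (1 - \<Delta> / Q + 2 * D / Q^2) / Q"
      using D Q by (intro divide_right_mono add_left_mono) (auto simp: power_divide divide_right_mono)
    finally show ?thesis .
  qed
  define D1 where "D1 = 2 * 1 * S + 1^2 + 32"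
  define D2 where "D2 = 2 * (-1) * S + (-1)^2 + 32"
  define D0 where "D0 = 2 * 0 * S + 0^2 + (32::real)"
  have b: "1 / (Q + D1) \<le> (1 - D1 / Q + 2 * D / Q^2) / Q" "1 / (Q + D2) \<le> (1 - D2 / Q + 2 * D / Q^2) / Q"
    "1 / (Q + D0) \<le> (1 - D0 / Q + 2 * D / Q^2) / Q"
    by (rule one[OF D1_def] one[OF D2_def] one[OF D0_def]; simp)+
  have e: "(S + 1)^2 + 32 * (n + 1) = Q + D1" "(S - 1)^2 + 32 * (n + 1) = Q + D2" "S^2 + 32 * (n + 1) = Q + D0"
    by (simp_all add: Q_def D1_def D2_def D0_def power2_eq_square algebra_simps)
  \<comment> \<open>In the diffusive scale \<open>Q\<close> is \<open>n (w + 32)\<close>, and its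
    mean increment \<open>ED\<close> is at least \<open>2 w + 65/2\<close>: 32 from the shift,
    \<open>2 w\<close> from the drift and 1/2 from the variance.\<close>
  define w where "w = S^2 / n"
  define ED where "ED = u * D1 + d * D2 + (1 - u - d) * D0"
  have Qw: "Q = n * (w + 32)" using n by (simp add: Q_def w_def field_simps)
  have w0: "0 \<le> w" using n by (simp add: w_def)
  have "ED = 2 * S * (u - d) + (u + d) + 32"
    by (simp add: ED_def D1_def D2_def D0_def algebra_simps)
  moreover have "2 * S * (u - d) = 2 * (\<kappa> * w)" unfolding mean by (simp add: w_def power2_eq_square)
  moreover have "1 * w \<le> \<kappa> * w" using \<kappa> w0 by (intro mult_right_mono) auto
  ultimately have ED: "2 * w + 65/2 \<le> ED" using ud(3) by argo
  have "2 * D / Q = (16 * (n * w) + 4356) / Q" using n by (simp add: D_def w_def)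
  also have "\<dots> = 16 * (n * w) / Q + 4356 / Q" by (rule add_divide_distrib)
  also have "16 * (n * w) / Q \<le> w / 2"
  proof -
    have "16 * (n * w) / Q = n * (16 * w) / (n * (w + 32))" unfolding Qw by (simp add: mult.left_commute)
    also have "\<dots> = w * (16 / (w + 32))" using n by simp
    also have "\<dots> \<le> w * (1/2)" using w0 by (intro mult_left_mono) (auto simp: field_simps)
    finally show ?thesis by linarith
  qed
  also have "4356 / Q \<le> 1/10" using Q by (simp add: pos_divide_le_eq)
  finally have err: "2 * D / Q \<le> w / 2 + 1/10" by simp
  \<comment> \<open>The variance provides the margin: \<open>3/2 w + 32.4\<close> dominates
    \<open>1.01 (w + 32)\<close>. Of the resulting rate \<open>(101/100) / n\<close>, the growth of
    the numerator from \<open>n\<close> to \<open>n + 1\<close> consumes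
    \<open>1 / n\<close>.\<close>
  have "(101/100) * (w + 32) \<le> ED - 2 * D / Q" using ED err w0 by argo
  then have "(101/100) * (w + 32) / Q \<le> (ED - 2 * D / Q) / Q" using Q by (intro divide_right_mono) auto
  moreover have "(101/100) * (w + 32) / Q = (101/100) / n"
  proof -
    have gen: "c * z / (n * z) = c / n" if "z \<noteq> 0" for c z :: real using that by simp
    show ?thesis unfolding Qw by (rule gen) (use w0 in auto)
  qed
  moreover have "(ED - 2 * D / Q) / Q = ED / Q - 2 * D / Q^2"
    by (simp add: diff_divide_distrib power2_eq_square)
  ultimately have key: "1 - ED / Q + 2 * D / Q^2 \<le> 1 - (101/100) / n" by linarith
  have "u * (1 / (Q + D1)) + d * (1 / (Q + D2)) + (1 - u - d) * (1 / (Q + D0))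
    \<le> u * ((1 - D1 / Q + 2 * D / Q^2) / Q) + d * ((1 - D2 / Q + 2 * D / Q^2) / Q) + (1 - u - d) * ((1 - D0 / Q + 2 * D / Q^2) / Q)"
    using b ud by (intro add_mono mult_left_mono) auto
  also have "\<dots> = (1 - ED / Q + 2 * D / Q^2) / Q"
    by (simp add: ED_def divide_inverse algebra_simps)
  also have "\<dots> \<le> (1 - (101/100) / n) / Q" using key Q by (intro divide_right_mono) auto
  finally have "(n + 1) * (u * (1 / (Q + D1)) + d * (1 / (Q + D2)) + (1 - u - d) * (1 / (Q + D0)))
    \<le> (n + 1) * ((1 - (101/100) / n) / Q)" using n by (intro mult_left_mono) auto
  also have "\<dots> \<le> (1 - (1/100) / n) * (n / Q)"
  proof -
    have "(n + 1) * (1 - (101/100) / n) \<le> (1 - (1/100) / n) * n"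
      using n by (simp add: field_simps)
    then have "((n + 1) * (1 - (101/100) / n)) / Q \<le> ((1 - (1/100) / n) * n) / Q"
      using Q by (intro divide_right_mono) auto
    then show ?thesis by simp
  qed
  finally show ?thesis unfolding e Q_def[symmetric] by (simp add: algebra_simps)
qed

text \<open>In relative terms the drift contributes \<open>- 2 \<kappa> / n\<close>, the numerator
  \<open>2 / n\<close>, and the second-order term \<open>8 / S^2 \<le> l / n\<close> by the choice
  of \<open>K\<close>; with \<open>\<kappa> \<ge> 1 + l\<close> a rate \<open>l / n\<close> remains.
  The bound \<open>4 \<le> K\<close> keeps \<open>S\<close> at distance at least 2 from the
  pole.\<close>

lemma inverse_square_drift:
  fixes S u d \<kappa> l K n :: real
  assumes n: "1 \<le> n" and ud: "0 \<le> u" "0 \<le> d" "u + d \<le> 1"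
    and mean: "u - d = \<kappa> * (S / n)" and \<kappa>: "1 + l \<le> \<kappa>" and l: "0 < l" and K: "4 \<le> K" "8 \<le> l * K" and S: "K * n \<le> S^2"
  shows "u * ((n + 1)^2 / (S + 1)^2) + d * ((n + 1)^2 / (S - 1)^2) + (1 - u - d) * ((n + 1)^2 / S^2)
    \<le> (1 - l / n) * (n^2 / S^2)"
proof -
  have "4 * 1 \<le> K * n" using K n by (intro mult_mono) auto
  then have S4: "2^2 \<le> \<bar>S\<bar>^2" using S by simp
  then have S2: "2 \<le> \<bar>S\<bar>" by (rule power2_le_imp_le) simp
  then have S0: "S \<noteq> 0" by auto
  have one: "1 / (S + a)^2 \<le> (1 - 2 * (a / S) + 8 / S^2) / S^2" if a: "\<bar>a\<bar> \<le> 1" for a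
  proof -
    have "\<bar>a / S\<bar> \<le> 1 / 2" unfolding abs_divide using a S2 by (intro frac_le) auto
    then have t: "- 1/2 \<le> a / S" "a / S \<le> 1/2" by linarith+
    have "(S + a)^2 = S^2 * (1 + a / S)^2" using S0 by (simp add: field_simps power2_eq_square)
    then have "1 / (S + a)^2 = (1 / (1 + a / S)^2) / S^2" by (simp add: field_simps)
    also have "\<dots> \<le> (1 - 2 * (a / S) + 8 * (a / S)^2) / S^2"
      using inverse_square_bound[OF t] by (intro divide_right_mono) auto
    also have "\<dots> \<le> (1 - 2 * (a / S) + 8 / S^2) / S^2"
      using square_le_one[OF a] by (intro divide_right_mono add_left_mono) (auto simp: power_divide divide_right_mono)
    finally show ?thesis .
  qed
  have b: "1 / (S + 1)^2 \<le> (1 - 2 * (1 / S) + 8 / S^2) / S^2" "1 / (S - 1)^2 \<le> (1 - 2 * (- 1 / S) + 8 / S^2) / S^2"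
    "1 / S^2 \<le> (1 - 2 * (0 / S) + 8 / S^2) / S^2"
    using one[of 1] one[of "-1"] one[of 0] by auto
  have "u * (1 / (S + 1)^2) + d * (1 / (S - 1)^2) + (1 - u - d) * (1 / S^2)
    \<le> u * ((1 - 2 * (1 / S) + 8 / S^2) / S^2) + d * ((1 - 2 * (- 1 / S) + 8 / S^2) / S^2)
      + (1 - u - d) * ((1 - 2 * (0 / S) + 8 / S^2) / S^2)"
    using b ud by (intro add_mono mult_left_mono) auto
  also have "\<dots> = (1 - 2 * ((u - d) / S) + 8 / S^2) / S^2"
    by (simp add: divide_inverse algebra_simps)
  also have "(u - d) / S = \<kappa> / n" unfolding mean using S0 by simp
  also have "(1 - 2 * (\<kappa> / n) + 8 / S^2) / S^2 \<le> (1 - (2 + l) / n) / S^2"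
  proof (rule divide_right_mono)
    have "(1 + l) / n \<le> \<kappa> / n" using \<kappa> n by (intro divide_right_mono) auto
    moreover have "8 / S^2 \<le> l / n"
    proof -
      have "0 < K * n" using K n by simp
      then have "8 / S^2 \<le> 8 / (K * n)" using S S0 by (intro divide_left_mono mult_pos_pos) (use K n in auto)
      also have "\<dots> \<le> l / n" using K n by (simp add: field_simps)
      finally show ?thesis .
    qed
    moreover have "(2 + l) / n = 2 * ((1 + l) / n) - l / n" by (simp add: add_divide_distrib)
    ultimately show "1 - 2 * (\<kappa> / n) + 8 / S^2 \<le> 1 - (2 + l) / n" by linarith
  qed simp
  finally have "(n + 1)^2 * (u * (1 / (S + 1)^2) + d * (1 / (S - 1)^2) + (1 - u - d) * (1 / S^2))
    \<le> (n + 1)^2 * ((1 - (2 + l) / n) / S^2)" by (intro mult_left_mono) auto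
  also have "\<dots> \<le> (1 - l / n) * (n^2 / S^2)"
  proof -
    define r where "r = 1 / n"
    have r: "0 < r" "n * r = 1" using n by (auto simp: r_def)
    have "(n + 1)^2 * (1 - (2 + l) / n) = n^2 * ((1 + r)^2 * (1 - (2 + l) * r))"
    proof -
      have "n + 1 = n * (1 + r)" using r by (simp add: algebra_simps)
      then show ?thesis by (simp add: r_def power_mult_distrib)
    qed
    also have "(1 + r)^2 * (1 - (2 + l) * r) = (1 - l * r) - (3 + 2 * l) * r^2 - (2 + l) * (r * r^2)"
      by (simp add: power2_eq_square algebra_simps)
    also have "\<dots> \<le> 1 - l * r"
    proof -
      have "0 \<le> (3 + 2 * l) * r^2" "0 \<le> (2 + l) * (r * r^2)" using l r by auto
      then show ?thesis by linarith
    qed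
    finally have "(n + 1)^2 * (1 - (2 + l) / n) \<le> n^2 * (1 - l * r)" by (simp add: mult_left_mono)
    then have "((n + 1)^2 * (1 - (2 + l) / n)) / S^2 \<le> (n^2 * (1 - l * r)) / S^2"
      by (intro divide_right_mono) auto
    then show ?thesis by (simp add: r_def mult.commute)
  qed
  finally show ?thesis by (simp add: algebra_simps)
qed

context two_channel_process
begin

lemma adapted_conj: "adapted n P \<Longrightarrow> adapted n Q \<Longrightarrow> adapted n (\<lambda>w. P w \<and> Q w)"
  by (rule adapted_comp2)

lemma adapted_Ball_interval:
  assumes "\<And>k. k \<le> n \<Longrightarrow> adapted k (P k)"
  shows "adapted n (\<lambda>w. \<forall>k\<in>{N..n}. P k w)"
proof (rule adaptedI)
  fix w w' assume eq: "H n w = H n w'"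
  have "P k w = P k w'" if "k \<le> n" for k
    using adaptedD[OF adapted_mono[OF that assms[OF that]] eq] .
  then show "(\<forall>k\<in>{N..n}. P k w) = (\<forall>k\<in>{N..n}. P k w')" by auto
qed

lemma adapted_comp: "adapted n f \<Longrightarrow> adapted n (\<lambda>w. c (f w))"
  unfolding adapted_def by metis

lemma adapted_S_pred: "adapted n (\<lambda>w. c (S n w))"
  by (rule adapted_comp[OF adapted_S])

lemma adapted_of_bool: "adapted n P \<Longrightarrow> adapted n (\<lambda>w. of_bool (P w) :: real)"
  by (rule adapted_comp)

lemma prob_le_expectation_S:
  fixes g :: "real \<Rightarrow> real"
  assumes Q: "adapted n Q" and P: "adapted n P"
    and le: "\<And>w. Q w \<Longrightarrow> P w \<and> 1 \<le> c * g (S n w)" and nonneg: "\<And>w. P w \<Longrightarrow> 0 \<le> c * g (S n w)"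
  shows "\<P>(w in M. Q w) \<le> c * expectation (\<lambda>w. of_bool (P w) * g (S n w))"
proof -
  have "\<P>(w in M. Q w) = expectation (\<lambda>w. of_bool (Q w))"
    by (rule expectation_of_bool[OF Q, symmetric])
  also have "\<dots> \<le> expectation (\<lambda>w. c * (of_bool (P w) * g (S n w)))"
  proof (rule integral_mono)
    have "adapted n (\<lambda>w. of_bool (Q w) :: real)" by (rule adapted_of_bool[OF Q])
    then show "integrable M (\<lambda>w. of_bool (Q w) :: real)" by (rule adapted_integrable)
    show "integrable M (\<lambda>w. c * (of_bool (P w) * g (S n w)))"
      by (rule integrable_mult_right[OF integrable_mult_S[OF P]])
    show "of_bool (Q w) \<le> c * (of_bool (P w) * g (S n w))" for w
      using le[of w] nonneg[of w] by (cases "Q w"; cases "P w") auto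
  qed
  finally show ?thesis by simp
qed

text \<open>While \<open>good\<close> holds, \<open>n / (S\<^sup>2 + 32 n)\<close> decays in expectation, so \<open>S\<^sup>2 \<ge> 2 K n\<close> becomes likely; from there
  \<open>n\<^sup>2 / S\<^sup>2\<close> is a supermartingale until \<open>S\<^sup>2 < K n\<close>, so that this return has probability at most 1/2. As
  \<open>n\<^sup>2 / S\<^sup>2 \<ge> 1\<close> must not tend to 0, the event \<open>E\<close> that \<open>good\<close> persists satisfies \<open>prob E \<le> prob E / 2\<close>.\<close>

lemma prob_always_good:
  assumes m0: "0 \<le> m" and l: "0 < l" and b: "1 + l \<le> m * (2 - b)" and N: "2000 \<le> N"
  shows "\<P>(w in M. \<forall>k\<ge>N. good b k w) = 0"
proof -
  define K where "K = max 4 (8 / l)"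
  have "l * (8 / l) \<le> l * K" using l by (intro mult_left_mono) (auto simp: K_def)
  then have K: "4 \<le> K" "8 \<le> l * K" using l by (auto simp: K_def)
  define G where "G n w \<longleftrightarrow> (\<forall>k\<in>{N..n}. good b k w)" for n w
  have aG: "adapted n (G n)" for n
    unfolding G_def by (rule adapted_Ball_interval[OF adapted_good])
  have drift: "up n w - down n w = m * (2 - y n w) * (S n w / real n)" for n w
    unfolding up_minus_down x_def by simp
  have \<kappa>: "1 + l \<le> m * (2 - y n w)" if "good b n w" for n w
  proof -
    have "m * (2 - b) \<le> m * (2 - y n w)" using that m0 by (intro mult_left_mono) (auto simp: good_def)
    then show ?thesis using b by linarith
  qed
  define a where "a n = expectation (\<lambda>w. of_bool (G n w) * (real n / ((S n w)^2 + 32 * real n)))" for n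
  have a_lim: "a \<longlonglongrightarrow> 0"
  proof (rule contraction_tendsto_zero[where c = "1/100" and N = N])
    show "0 \<le> a n" for n unfolding a_def by (intro Bochner_Integration.integral_nonneg) auto
    fix n assume n: "N \<le> n"
    have "a (Suc n) \<le> expectation (\<lambda>w. of_bool (G n w) * ((real n + 1) / ((S (Suc n) w)^2 + 32 * (real n + 1))))"
      unfolding a_def
    proof (rule integral_mono)
      show "integrable M (\<lambda>w. of_bool (G (Suc n) w) * (real (Suc n) / ((S (Suc n) w)^2 + 32 * real (Suc n))))"
        by (rule integrable_mult_S[OF aG])
      show "integrable M (\<lambda>w. of_bool (G n w) * ((real n + 1) / ((S (Suc n) w)^2 + 32 * (real n + 1))))"
        by (rule integrable_mult_S[OF adapted_Suc[OF aG]])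
      have "G n w" if "G (Suc n) w" for w using that by (auto simp: G_def)
      then show "of_bool (G (Suc n) w) * (real (Suc n) / ((S (Suc n) w)^2 + 32 * real (Suc n)))
        \<le> of_bool (G n w) * ((real n + 1) / ((S (Suc n) w)^2 + 32 * (real n + 1)))" for w
        by (cases "G (Suc n) w") (auto simp: add.commute)
    qed
    also have "\<dots> \<le> (1 - (1/100) / real n) * a n"
      unfolding a_def
    proof (rule expectation_S_step[OF _ aG])
      fix w assume "G n w"
      then have g: "good b n w" using n by (auto simp: G_def)
      show "up n w * ((real n + 1) / ((S n w + 1)^2 + 32 * (real n + 1)))
        + down n w * ((real n + 1) / ((S n w - 1)^2 + 32 * (real n + 1)))
        + (1 - up n w - down n w) * ((real n + 1) / ((S n w)^2 + 32 * (real n + 1)))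
        \<le> (1 - (1/100) / real n) * (real n / ((S n w)^2 + 32 * real n))"
        using n N l \<kappa>[OF g] good_nonzero_prob[OF g] up_down_nonneg up_down_le_1 drift[of n w]
        by (intro inverse_quadratic_drift[where \<kappa> = "m * (2 - y n w)"]) auto
    qed (use n N in auto)
    also have "\<dots> \<le> a n * (1 - (1/100) / real (Suc n))"
    proof -
      have "1 - (1/100) / real n \<le> 1 - (1/100) / real (Suc n)"
        using n N by (intro diff_left_mono divide_left_mono) auto
      moreover have "0 \<le> a n" unfolding a_def by (intro Bochner_Integration.integral_nonneg) auto
      ultimately show ?thesis by (metis mult.commute mult_left_mono)
    qed
    finally show "a (Suc n) \<le> a n * (1 - (1/100) / real (Suc n))" .
  qed simp
  \<comment> \<open>Markov's inequality: below the level \<open>2 K n\<close> the potential is at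
    least \<open>1 / (2 K + 32)\<close>.\<close>
  have near: "\<P>(w in M. G n w \<and> (S n w)^2 < 2 * K * real n) \<le> (2 * K + 32) * a n" if "n \<ge> N" for n
    unfolding a_def
  proof (rule prob_le_expectation_S)
    show "adapted n (\<lambda>w. G n w \<and> (S n w)^2 < 2 * K * real n)"
      by (intro adapted_conj aG adapted_S_pred)
    show "G n w \<and> 1 \<le> (2 * K + 32) * (real n / ((S n w)^2 + 32 * real n))"
      if "G n w \<and> (S n w)^2 < 2 * K * real n" for w
    proof -
      have "0 < real n" using \<open>n \<ge> N\<close> N by simp
      then have "0 < (S n w)^2 + 32 * real n" by (simp add: add_nonneg_pos)
      then show ?thesis using that by (simp add: pos_le_divide_eq algebra_simps)
    qed
    show "0 \<le> (2 * K + 32) * (real n / ((S n w)^2 + 32 * real n))" for w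
      using K by simp
  qed (rule aG)
  have far: "\<exists>e. e \<longlonglongrightarrow> 0 \<and> (\<forall>T\<ge>n. \<P>(w in M. G T w \<and> 2 * K * real n \<le> (S n w)^2)
      \<le> \<P>(w in M. G n w) / 2 + e T)" if n: "n \<ge> N" for n
  proof -
    have n0: "0 < real n" "2 \<le> n" using n N by auto
    \<comment> \<open>The walk was high at time \<open>n\<close> and has kept \<open>S^2\<close>
      above \<open>K j\<close> since; \<open>ret k\<close> is the probability that it first falls
      below at time \<open>k + 1\<close>. The factor 2 between the two levels is what makes the
      return probability at most 1/2.\<close>
    define C where "C k w \<longleftrightarrow> (G n w \<and> 2 * K * real n \<le> (S n w)^2) \<and> (\<forall>j\<in>{n..k}. good b j w \<and> K * real j \<le> (S j w)^2)" for k w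
    have aC: "adapted k (C k)" if "n \<le> k" for k
    proof -
      have "adapted k (\<lambda>w. G n w \<and> 2 * K * real n \<le> (S n w)^2)"
        by (rule adapted_mono[OF that]) (intro adapted_conj aG adapted_S_pred)
      moreover have "adapted k (\<lambda>w. \<forall>j\<in>{n..k}. good b j w \<and> K * real j \<le> (S j w)^2)"
        by (rule adapted_Ball_interval) (intro adapted_conj adapted_good adapted_S_pred)
      ultimately show ?thesis unfolding C_def by (rule adapted_conj)
    qed
    define e where "e k = expectation (\<lambda>w. of_bool (C k w) * ((real k)^2 / (S k w)^2))" for k
    define ret where "ret k = \<P>(w in M. C k w \<and> (S (Suc k) w)^2 < K * real (Suc k))" for k
    have e0: "0 \<le> e k" for k unfolding e_def by (intro Bochner_Integration.integral_nonneg) auto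
    \<comment> \<open>At a return at time \<open>k + 1\<close> the potential is at least
      \<open>(k + 1) / K \<ge> n / K\<close>, so the returning paths take away at least
      \<open>n / K\<close> per unit of probability.\<close>
    have step: "e (Suc k) + real n / K * ret k \<le> (1 - l / real k) * e k" if k: "n \<le> k" for k
    proof -
      have aR: "adapted (Suc k) (\<lambda>w. C k w \<and> (S (Suc k) w)^2 < K * real (Suc k))"
        by (intro adapted_conj adapted_Suc[OF aC[OF k]] adapted_S_pred)
      have aR': "adapted (Suc k) (\<lambda>w. of_bool (C k w \<and> (S (Suc k) w)^2 < K * real (Suc k)) :: real)"
        by (rule adapted_of_bool[OF aR])
      have "e (Suc k) + real n / K * ret k
        = expectation (\<lambda>w. of_bool (C (Suc k) w) * ((real (Suc k))^2 / (S (Suc k) w)^2)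
            + real n / K * of_bool (C k w \<and> (S (Suc k) w)^2 < K * real (Suc k)))"
        unfolding e_def ret_def expectation_of_bool[OF aR, symmetric]
        using integrable_mult_S[OF aC[of "Suc k"], of "\<lambda>s. (real (Suc k))^2 / s^2"] adapted_integrable[OF aR'] k
        by simp
      also have "\<dots> \<le> expectation (\<lambda>w. of_bool (C k w) * ((real k + 1)^2 / (S (Suc k) w)^2))"
      proof (rule integral_mono)
        show "integrable M (\<lambda>w. of_bool (C (Suc k) w) * ((real (Suc k))^2 / (S (Suc k) w)^2)
            + real n / K * of_bool (C k w \<and> (S (Suc k) w)^2 < K * real (Suc k)))"
          using integrable_mult_S[OF aC[of "Suc k"], of "\<lambda>s. (real (Suc k))^2 / s^2"] adapted_integrable[OF aR'] k
          by simp
        show "integrable M (\<lambda>w. of_bool (C k w) * ((real k + 1)^2 / (S (Suc k) w)^2))"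
          by (rule integrable_mult_S[OF adapted_Suc[OF aC[OF k]]])
        fix w
        have CS: "C k w" "\<not> (S (Suc k) w)^2 < K * real (Suc k)" if "C (Suc k) w"
        proof -
          have "K * real (Suc k) \<le> (S (Suc k) w)^2"
            using that k unfolding C_def by (meson atLeastAtMost_iff le_Suc_eq order_refl)
          then show "\<not> (S (Suc k) w)^2 < K * real (Suc k)" by simp
          show "C k w" using that unfolding C_def by (meson atLeastAtMost_iff le_SucI)
        qed
        show "of_bool (C (Suc k) w) * ((real (Suc k))^2 / (S (Suc k) w)^2)
            + real n / K * of_bool (C k w \<and> (S (Suc k) w)^2 < K * real (Suc k))
          \<le> of_bool (C k w) * ((real k + 1)^2 / (S (Suc k) w)^2)"
        proof (cases "C k w \<and> (S (Suc k) w)^2 < K * real (Suc k)")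
          case True
          then have "K * real k \<le> (S k w)^2" using k by (auto simp: C_def)
          moreover have "4 * 1 \<le> K * real k" using K n0 k by (intro mult_mono) auto
          ultimately have "2^2 \<le> \<bar>S k w\<bar>^2" by simp
          then have "2 \<le> \<bar>S k w\<bar>" by (rule power2_le_imp_le) simp
          \<comment> \<open>Since \<open>S k\<close> is at least 2 in modulus and a step at most 1,
            the quotient below is not the default value of a division by 0.\<close>
          then have "S (Suc k) w \<noteq> 0" using X_cases[of "Suc k" w] unfolding S_Suc by auto
          then have pos: "0 < (S (Suc k) w)^2" by simp
          have "real n / K * (S (Suc k) w)^2 \<le> real n / K * (K * real (Suc k))"
            using True K n0 by (intro mult_left_mono) auto
          also have "\<dots> = real n * real (Suc k)" using K by simp
          also have "\<dots> \<le> real (Suc k) * real (Suc k)" using k by (intro mult_right_mono) auto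
          also have "\<dots> = (real k + 1)^2" by (simp add: power2_eq_square add.commute)
          finally have "real n / K \<le> (real k + 1)^2 / (S (Suc k) w)^2"
            using pos by (simp add: pos_le_divide_eq)
          moreover have "\<not> C (Suc k) w" using True CS by blast
          ultimately show ?thesis using True by simp
        next
          case False
          then show ?thesis using CS by (cases "C (Suc k) w") (auto simp: add.commute)
        qed
      qed
      also have "\<dots> \<le> (1 - l / real k) * e k"
        unfolding e_def
      proof (rule expectation_S_step[OF _ aC[OF k]])
        fix w assume "C k w"
        then have g: "good b k w" "K * real k \<le> (S k w)^2" using k by (auto simp: C_def)
        show "up k w * ((real k + 1)^2 / (S k w + 1)^2) + down k w * ((real k + 1)^2 / (S k w - 1)^2)
          + (1 - up k w - down k w) * ((real k + 1)^2 / (S k w)^2) \<le> (1 - l / real k) * ((real k)^2 / (S k w)^2)"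
          using k n0 l K \<kappa>[OF g(1)] up_down_nonneg up_down_le_1 drift[of k w] g(2)
          by (intro inverse_square_drift[where \<kappa> = "m * (2 - y k w)" and K = K]) auto
      qed (use k n0 in auto)
      finally show ?thesis .
    qed
    have ret0: "0 \<le> ret k" for k by (simp add: ret_def)
    have e_step: "e (Suc k) \<le> (1 - l / real k) * e k" if "n \<le> k" for k
    proof -
      have "0 \<le> real n / K * ret k" using ret0 K by simp
      then show ?thesis using step[OF that] by linarith
    qed
    have e_lim: "e \<longlonglongrightarrow> 0"
    proof (rule contraction_tendsto_zero[OF l, where N = n])
      fix k assume k: "n \<le> k"
      have "1 - l / real k \<le> 1 - l / real (Suc k)"
        using n0 k l by (intro diff_left_mono divide_left_mono) auto
      then have "(1 - l / real k) * e k \<le> (1 - l / real (Suc k)) * e k" using e0 by (rule mult_right_mono)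
      then show "e (Suc k) \<le> e k * (1 - l / real (Suc k))"
        using e_step[OF k] by (simp add: mult.commute)
    qed (rule e0)
    have total: "e T + real n / K * (\<Sum>k\<in>{n..<T}. ret k) \<le> e n" if "n \<le> T" for T
      using that
    proof (induction T rule: dec_induct)
      case (step T)
      have "(1 - l / real T) * e T \<le> 1 * e T" using l e0 by (intro mult_right_mono) auto
      then show ?case using step.IH \<open>\<And>k. n \<le> k \<Longrightarrow> e (Suc k) + real n / K * ret k \<le> (1 - l / real k) * e k\<close>[OF step.hyps(1)] step.hyps(1)
        by (simp add: distrib_left)
    qed simp
    have en: "e n \<le> real n / (2 * K) * \<P>(w in M. G n w)"
    proof -
      have aG': "adapted n (\<lambda>w. of_bool (G n w) :: real)"
        by (rule adapted_of_bool[OF aG])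
      have "e n \<le> expectation (\<lambda>w. real n / (2 * K) * of_bool (G n w))"
        unfolding e_def
      proof (rule integral_mono)
        show "integrable M (\<lambda>w. of_bool (C n w) * ((real n)^2 / (S n w)^2))"
          by (rule integrable_mult_S[OF aC]) simp
        show "integrable M (\<lambda>w. real n / (2 * K) * of_bool (G n w))"
          by (rule integrable_mult_right[OF adapted_integrable[OF aG']])
        show "of_bool (C n w) * ((real n)^2 / (S n w)^2) \<le> real n / (2 * K) * of_bool (G n w)" for w
        proof (cases "C n w")
          case True
          then have c: "G n w" "2 * K * real n \<le> (S n w)^2" by (auto simp: C_def)
          have p: "0 < 2 * K * real n" using K n0 by simp
          have "(real n)^2 / (S n w)^2 \<le> (real n)^2 / (2 * K * real n)"
          proof (rule divide_left_mono[OF c(2)])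
            have "0 < (S n w)^2" using p c(2) by linarith
            then show "0 < (S n w)^2 * (2 * K * real n)" using p by (rule mult_pos_pos)
          qed simp
          also have "\<dots> = real n / (2 * K)" using n0 by (simp add: power2_eq_square)
          finally show ?thesis using True c by simp
        next
          case False
          then show ?thesis using K by simp
        qed
      qed
      also have "\<dots> = real n / (2 * K) * \<P>(w in M. G n w)"
        unfolding expectation_of_bool[OF aG, symmetric] by simp
      finally show ?thesis .
    qed
    \<comment> \<open>The potential is at most \<open>n / (2 K)\<close> at the start and at least
      \<open>n / K\<close> at a return, whence the ratio 1/2.\<close>
    have ret_sum: "(\<Sum>k\<in>{n..<T}. ret k) \<le> \<P>(w in M. G n w) / 2" if "n \<le> T" for T
    proof -
      have "real n / K * (\<Sum>k\<in>{n..<T}. ret k) \<le> real n / K * (\<P>(w in M. G n w) / 2)"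
        using total[OF that] en e0[of T] by simp
      moreover have "0 < real n / K" using n0 K by simp
      ultimately show ?thesis by (rule mult_left_le_imp_le)
    qed
    have bound: "\<P>(w in M. G T w \<and> 2 * K * real n \<le> (S n w)^2)
      \<le> \<P>(w in M. G n w) / 2 + e T" if T: "n \<le> T" for T
    proof -
      define R where "R k = {w \<in> space M. C k w \<and> (S (Suc k) w)^2 < K * real (Suc k)}" for k
      have Rs: "R k \<in> sets M" if "n \<le> k" for k
        unfolding R_def by (rule adapted_pred_sets[of "Suc k"]) (intro adapted_conj adapted_Suc[OF aC[OF that]] adapted_S_pred)
      have Cs: "{w \<in> space M. C T w} \<in> sets M" by (rule adapted_pred_sets[OF aC[OF T]])
      have Us: "(\<Union>k\<in>{n..<T}. R k) \<in> sets M" using Rs by (intro sets.finite_UN) auto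
      have path: "C T' w \<or> (\<exists>k\<in>{n..<T'}. C k w \<and> (S (Suc k) w)^2 < K * real (Suc k))"
        if "n \<le> T'" "G T' w" "2 * K * real n \<le> (S n w)^2" for T' w
        using that
      proof (induction T' rule: dec_induct)
        case base
        have "K * real n \<le> 2 * K * real n" using K by simp
        then show ?case using base n by (auto simp: C_def G_def)
      next
        case (step T')
        have GT: "G T' w" "good b (Suc T') w" using step.prems step.hyps n by (auto simp: G_def)
        have "C T' w \<Longrightarrow> \<not> (S (Suc T') w)^2 < K * real (Suc T') \<Longrightarrow> C (Suc T') w"
          using GT step.hyps unfolding C_def by (auto simp: le_Suc_eq)
        then show ?case using step.IH[OF GT(1) step.prems(2)] step.hyps by force
      qed
      have "{w \<in> space M. G T w \<and> 2 * K * real n \<le> (S n w)^2} \<subseteq> {w \<in> space M. C T w} \<union> (\<Union>k\<in>{n..<T}. R k)"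
        using path[OF T] unfolding R_def by blast
      then have "\<P>(w in M. G T w \<and> 2 * K * real n \<le> (S n w)^2) \<le> prob ({w \<in> space M. C T w} \<union> (\<Union>k\<in>{n..<T}. R k))"
        using Cs Us by (intro finite_measure_mono) auto
      also have "\<dots> \<le> \<P>(w in M. C T w) + prob (\<Union>k\<in>{n..<T}. R k)"
        using Cs Us by (intro measure_Un_le) auto
      also have "prob (\<Union>k\<in>{n..<T}. R k) \<le> (\<Sum>k\<in>{n..<T}. prob (R k))"
        using Rs by (intro measure_UNION_le) auto
      also have "(\<Sum>k\<in>{n..<T}. prob (R k)) \<le> \<P>(w in M. G n w) / 2"
        using ret_sum[OF T] by (simp add: ret_def R_def)
      \<comment> \<open>Without a return up to time \<open>T\<close> the potential
        \<open>T^2 / S^2\<close> is at least 1, as \<open>S T\<close> is at most \<open>T\<close> in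
        modulus, while its expectation tends to 0.\<close>
      also have "\<P>(w in M. C T w) \<le> 1 * e T"
        unfolding e_def
      proof (rule prob_le_expectation_S[OF aC[OF T] aC[OF T]])
        fix w assume c: "C T w"
        have "K * real T \<le> (S T w)^2" using c T by (auto simp: C_def)
        moreover have "0 < K * real T" using K n0 T by simp
        ultimately have "0 < (S T w)^2" by linarith
        moreover have "\<bar>S T w\<bar> \<le> real T" using abs_S_le[of T w] Y_le[of T w] by linarith
        then have "(S T w)^2 \<le> (real T)^2" by (rule abs_le_square)
        ultimately show "C T w \<and> 1 \<le> 1 * ((real T)^2 / (S T w)^2)" using c by (simp add: pos_le_divide_eq)
      qed simp
      finally show ?thesis by simp
    qed
    then show ?thesis using e_lim by blast
  qed
  define E where "E = {w \<in> space M. \<forall>k\<ge>N. good b k w}"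
  define pG where "pG n = \<P>(w in M. G n w)" for n
  have Gs: "{w \<in> space M. G n w} \<in> sets M" for n by (rule adapted_pred_sets[OF aG])
  have EG: "E \<subseteq> {w \<in> space M. G n w}" for n by (auto simp: E_def G_def)
  \<comment> \<open>Here \<open>T\<close> tends to infinity for fixed \<open>n\<close>; afterwards
    \<open>n\<close> does, so that \<open>a n\<close> vanishes and \<open>pG n\<close> tends to
    \<open>prob E\<close>.\<close>
  have pE: "prob E \<le> (2 * K + 32) * a n + pG n / 2" if n: "n \<ge> N" for n
  proof -
    obtain e where e: "e \<longlonglongrightarrow> 0" "\<And>T. n \<le> T \<Longrightarrow> \<P>(w in M. G T w \<and> 2 * K * real n \<le> (S n w)^2)
      \<le> pG n / 2 + e T" using far[OF n] unfolding pG_def by blast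
    have "prob E \<le> (2 * K + 32) * a n + (pG n / 2 + e T)" if T: "T \<ge> n" for T
    proof -
      let ?A = "{w \<in> space M. G n w \<and> (S n w)^2 < 2 * K * real n}"
      let ?B = "{w \<in> space M. G T w \<and> 2 * K * real n \<le> (S n w)^2}"
      have A: "?A \<in> sets M" by (rule adapted_pred_sets[of n]) (intro adapted_conj aG adapted_S_pred)
      have "adapted T (\<lambda>w. 2 * K * real n \<le> (S n w)^2)" by (rule adapted_mono[OF T adapted_S_pred])
      then have B: "?B \<in> sets M" by (intro adapted_pred_sets[of T] adapted_conj aG)
      have "prob E \<le> prob (?A \<union> ?B)"
        using A B EG[of n] EG[of T] by (intro finite_measure_mono) auto
      also have "\<dots> \<le> prob ?A + prob ?B" using A B by (intro measure_Un_le) auto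
      finally show ?thesis using near[OF n] e(2)[OF T] by linarith
    qed
    moreover have "(\<lambda>T. (2 * K + 32) * a n + (pG n / 2 + e T)) \<longlonglongrightarrow> (2 * K + 32) * a n + (pG n / 2 + 0)"
      by (intro tendsto_intros e)
    ultimately show ?thesis using LIMSEQ_le_const[of _ _ "prob E"] by fastforce
  qed
  have "pG \<longlonglongrightarrow> prob (\<Inter>n. {w \<in> space M. G n w})"
    unfolding pG_def using Gs by (intro finite_Lim_measure_decseq) (auto simp: decseq_def G_def)
  also have "(\<Inter>n. {w \<in> space M. G n w}) = E"
  proof -
    have "(\<forall>n. G n w) \<longleftrightarrow> (\<forall>k\<ge>N. good b k w)" for w
      unfolding G_def by (meson atLeastAtMost_iff order_refl)
    then show ?thesis by (auto simp: E_def)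
  qed
  finally have "(\<lambda>n. (2 * K + 32) * a n + pG n / 2) \<longlonglongrightarrow> (2 * K + 32) * 0 + prob E / 2"
    by (intro tendsto_intros a_lim) auto
  then have "prob E \<le> (2 * K + 32) * 0 + prob E / 2"
    using pE by (intro LIMSEQ_le_const) auto
  then have "prob E \<le> 0" by simp
  then show ?thesis using measure_nonneg[of M E] unfolding E_def by linarith
qed

end

section \<open>The limit and its sign\<close>

lemma pmf_rad:
  assumes "0 \<le> q" "q \<le> 1"
  shows "pmf (rad_pmf q) a = (if a = 1 then q else if a = -1 then 1 - q else 0)"
proof -
  let ?f = "\<lambda>b. if b then 1 else (-1::int)"
  have "?f -` {a} = (if a = 1 then {True} else if a = -1 then {False} else {})"
    by (auto split: if_splits)
  then show ?thesis
    using assms by (simp add: rad_pmf_def pmf_map measure_pmf_single)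
qed

lemma (in prob_space) distr_eq_rad_half:
  fixes R :: "'a \<Rightarrow> int"
  assumes R[measurable]: "R \<in> measurable M (count_space UNIV)" and range: "\<And>w. R w \<in> {-1, 1}"
    and eq: "\<P>(w in M. R w = 1) = \<P>(w in M. R w = -1)"
  shows "distr M (count_space UNIV) R = measure_pmf (rad_pmf (1/2))"
proof -
  have "\<P>(w in M. R w = 1) + \<P>(w in M. R w = -1)
      = prob ({w \<in> space M. R w = 1} \<union> {w \<in> space M. R w = -1})"
    by (subst finite_measure_Union) auto
  also have "{w \<in> space M. R w = 1} \<union> {w \<in> space M. R w = -1} = space M" using range by auto
  finally have half: "\<P>(w in M. R w = 1) = 1/2" "\<P>(w in M. R w = -1) = 1/2"
    using eq by (auto simp: prob_space)
  show ?thesis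
  proof (rule measure_eqI_countable[where A = UNIV])
    fix a :: int
    have "emeasure (distr M (count_space UNIV) R) {a} = ennreal (\<P>(w in M. R w = a))"
      by (subst emeasure_distr) (auto simp: emeasure_eq_measure vimage_def Int_def conj_commute)
    also have "\<P>(w in M. R w = a) = pmf (rad_pmf (1/2)) a"
    proof -
      consider "a = 1" | "a = -1" | "a \<noteq> 1" "a \<noteq> -1" by blast
      then show ?thesis
      proof cases
        case 3
        then have empty: "{w \<in> space M. R w = a} = {}" using range by force
        show ?thesis unfolding empty using 3 by (simp add: pmf_rad)
      qed (use half in \<open>auto simp: pmf_rad\<close>)
    qed
    finally show "emeasure (distr M (count_space UNIV) R) {a} = emeasure (measure_pmf (rad_pmf (1/2))) {a}"
      by (simp add: emeasure_pmf_single)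
  qed auto
qed

context two_channel_process
begin

section \<open>Invariance of the law under a change of sign\<close>

text \<open>For a nonzero step the kernel only sees the product of step and sum, which negation
  preserves. A zero step is not covered by \<open>kernel\<close>; its probability is what remains of
  that of the shorter history, where the induction hypothesis applies.\<close>

lemma prob_history_symmetric:
  "n \<ge> 2 \<Longrightarrow> \<P>(w in M. H n w = h) = \<P>(w in M. H n w = map uminus h)"
proof (induction n arbitrary: h rule: dec_induct)
  case base
  show ?case by (rule init_symmetric)
next
  case (step n)
  have zero: "\<P>(w in M. H k w = h) = 0" if "h \<notin> histories k" for k h
  proof -
    have empty: "{w \<in> space M. H k w = h} = {}" using that H_in by auto
    show ?thesis unfolding empty by simp
  qed
  have neg: "map uminus h \<in> histories k \<longleftrightarrow> h \<in> histories k" for k and h :: "int list"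
    by (force simp: histories_def)
  show ?case
  proof (cases "h \<in> histories (Suc n)")
    case False
    moreover from this have "map uminus h \<notin> histories (Suc n)" using neg by blast
    ultimately show ?thesis using zero[of h "Suc n"] zero[of "map uminus h" "Suc n"] by simp
  next
    case True
    then obtain g a where h: "h = g @ [a]" by (cases h rule: rev_cases) (auto simp: histories_def)
    have g: "length g = n" "set g \<subseteq> {-1, 0, 1}" and a: "a \<in> {-1, 0, 1}"
      using True by (auto simp: histories_def h)
    define J where "J g a = \<P>(w in M. H n w = g \<and> X (Suc n) w = a)" for g a
    have J: "\<P>(w in M. H (Suc n) w = g @ [a]) = J g a" for g a
      by (simp add: history_Suc J_def)
    have nonzero: "J g a = J (map uminus g) (- a)" if a: "a \<in> {-1, 1}" for a
    proof -
      have "sum_list (map uminus g) = - sum_list g" by (induction g) auto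
      moreover have "map abs (map uminus g) = map abs g" by simp
      moreover have "set (map uminus g) \<subseteq> {-1, 0, 1}" using g by auto
      ultimately show ?thesis
        using kernel[of n g a] kernel[of n "map uminus g" "- a"] step.IH[of g] g a step.hyps
        unfolding J_def by (auto simp del: map_map)
    qed
    have split: "\<P>(w in M. H n w = g) = J g 0 + J g 1 + J g (-1)" for g
    proof -
      have 1: "{w \<in> space M. H n w = g} = ({w \<in> space M. H n w = g \<and> X (Suc n) w = 0}
         \<union> {w \<in> space M. H n w = g \<and> X (Suc n) w = 1}) \<union> {w \<in> space M. H n w = g \<and> X (Suc n) w = -1}"
        using X_cases by auto
      have [measurable]: "{w \<in> space M. H n w = g \<and> X (Suc n) w = c} \<in> sets M" for c by measurable
      show ?thesis unfolding J_def
        by (subst 1, subst finite_measure_Union, simp, simp, force, subst finite_measure_Union) auto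
    qed
    have "J g a = J (map uminus g) (- a)"
    proof (cases "a = 0")
      case True
      then show ?thesis
        using split[of g] split[of "map uminus g"] step.IH[of g] nonzero[of 1] nonzero[of "-1"] by simp
    qed (use nonzero a in auto)
    then show ?thesis using J[of g a] J[of "map uminus g" "- a"] by (simp add: h)
  qed
qed

lemma prob_symmetric:
  assumes n: "n \<ge> 2"
  shows "\<P>(w in M. Q (H n w)) = \<P>(w in M. Q (map uminus (H n w)))"
proof -
  have expand: "\<P>(w in M. Q (H n w)) = (\<Sum>h\<in>{h \<in> histories n. Q h}. \<P>(w in M. H n w = h))" for Q
  proof -
    have "{w \<in> space M. Q (H n w)} = (\<Union>h\<in>{h \<in> histories n. Q h}. {w \<in> space M. H n w = h})"
      using H_in by auto
    then show ?thesis
      using finite_histories by (simp, intro finite_measure_finite_Union) (auto simp: disjoint_family_on_def)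
  qed
  have neg: "map uminus h \<in> histories n" if "h \<in> histories n" for h
    using that by (force simp: histories_def)
  show ?thesis unfolding expand expand[of "\<lambda>h. Q (map uminus h)"]
    by (rule sum.reindex_bij_witness[where i = "map uminus" and j = "map uminus"])
      (auto simp: neg prob_history_symmetric[OF n, symmetric] o_def)
qed

section \<open>Almost sure limits in the two regimes\<close>

lemma AE_tendsto_zero:
  assumes "p < 7/8"
  shows "AE w in M. (\<lambda>n. x n w) \<longlonglongrightarrow> 0"
  using AE_euler_scheme AE_y_not_tendsto_zero
proof eventually_elim
  case (elim w)
  then obtain xt yt where "euler_scheme m (\<lambda>n. x n w) (\<lambda>n. y n w) xt yt" by blast
  then show ?case using elim(2) assms by (intro euler_scheme.x_tendsto_zero) (auto simp: m_def)
qed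

lemma AE_tendsto_r:
  assumes p78: "7/8 < p"
  shows "AE w in M. (\<lambda>n. x n w) \<longlonglongrightarrow> lyapunov.r m \<or> (\<lambda>n. x n w) \<longlonglongrightarrow> - lyapunov.r m"
proof -
  interpret lyapunov m using p78 p by unfold_locales (auto simp: m_def)
  \<comment> \<open>As \<open>m (2 - s) = 1\<close>, any \<open>b < s\<close> gives a growth
    exponent above 1, with excess \<open>l = m (s - b)\<close>; and \<open>b > 2/3\<close> lets
    \<open>y\<close> settle into the window when \<open>x\<close> tends to 0.\<close>
  define b where "b = (2/3 + s) / 2"
  define l where "l = m * (s - b)"
  have b: "2/3 < b" "b < s" using s_bounds by (auto simp: b_def)
  have l: "0 < l" using b m_gt by (simp add: l_def)
  have "m * (2 - s) = 1" using m_gt by (simp add: s_def field_simps)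
  then have "1 + l \<le> m * (2 - b)" by (simp add: l_def algebra_simps)
  have [measurable]: "{w \<in> space M. good b k w} \<in> sets M" for k
    by (rule adapted_pred_sets[OF adapted_good])
  have "AE w in M. \<not> (\<forall>k\<ge>N. good b k w)" if N: "2000 \<le> N" for N
  proof -
    have A: "{w \<in> space M. \<forall>k\<ge>N. good b k w} \<in> sets M" by measurable
    have "\<P>(w in M. \<forall>k\<ge>N. good b k w) = 0"
      using m_gt l \<open>1 + l \<le> m * (2 - b)\<close> N by (intro prob_always_good) auto
    then have "AE w in M. w \<notin> {w \<in> space M. \<forall>k\<ge>N. good b k w}" using prob_eq_0[OF A] by simp
    then show ?thesis using AE_space by eventually_elim auto
  qed
  then have "AE w in M. \<forall>N. 2000 \<le> N \<longrightarrow> \<not> (\<forall>k\<ge>N. good b k w)"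
    by (subst AE_all_countable) auto
  with AE_euler_scheme AE_y_not_tendsto_zero show ?thesis
  proof eventually_elim
    case (elim w)
    then obtain xt yt where es: "euler_scheme m (\<lambda>n. x n w) (\<lambda>n. y n w) xt yt" by blast
    interpret supercritical_scheme m "\<lambda>n. x n w" "\<lambda>n. y n w" xt yt
      by (intro supercritical_scheme.intro es lyapunov_axioms)
    have "\<not> (\<lambda>n. x n w) \<longlonglongrightarrow> 0"
    proof
      assume x0: "(\<lambda>n. x n w) \<longlonglongrightarrow> 0"
      have "\<forall>\<^sub>F n in sequentially. y n w \<le> 2/3 + (b - 2/3)"
        using b s_bounds by (intro eventually_y_le[OF x0]) auto
      moreover have "\<forall>\<^sub>F n in sequentially. 2/3 - 1/6 \<le> y n w"
        by (rule eventually_y_ge[OF elim(2)]) simp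
      ultimately have "\<forall>\<^sub>F n in sequentially. good b n w"
        by eventually_elim (simp add: good_def)
      then obtain N where "\<forall>k\<ge>N. good b k w" by (auto simp: eventually_sequentially)
      then have "\<forall>k\<ge>max N 2000. good b k w" by simp
      then show False using elim(3) by (metis max.cobounded2)
    qed
    then show ?case by (rule tendsto_r_or_minus_r)
  qed
qed

lemma c_p_eq: "7/8 < p \<Longrightarrow> c_p p = lyapunov.r m"
proof -
  assume p78: "7/8 < p"
  interpret lyapunov m using p78 p by unfold_locales (auto simp: m_def)
  have "(2 * m - 1) * (4 * m - 3) = 32 * p^2 - 52 * p + 21"
    by (simp add: m_def power2_eq_square algebra_simps)
  then show ?thesis using p78 by (simp add: c_p_def r_def flip: m_def)
qed

lemma tendsto_prob_eventually:
  assumes Q: "\<And>n. {w \<in> space M. Q n w} \<in> sets M" and B: "{w \<in> space M. B w} \<in> sets M"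
    and ev: "AE w in M. \<forall>\<^sub>F n in sequentially. Q n w = B w"
  shows "(\<lambda>n. \<P>(w in M. Q n w)) \<longlonglongrightarrow> \<P>(w in M. B w)"
proof -
  have int: "\<P>(w in M. P w) = expectation (\<lambda>w. indicator {w \<in> space M. P w} w)"
    if "{w \<in> space M. P w} \<in> sets M" for P
    using that by (simp add: Int_absorb2 sets.sets_into_space)
  have "(\<lambda>n. expectation (\<lambda>w. indicator {w \<in> space M. Q n w} w)) \<longlonglongrightarrow> expectation (\<lambda>w. indicator {w \<in> space M. B w} w :: real)"
  proof (rule integral_dominated_convergence[where w = "\<lambda>_. 1"])
    show "AE w in M. (\<lambda>n. indicator {w \<in> space M. Q n w} w :: real) \<longlonglongrightarrow> indicator {w \<in> space M. B w} w"
      using ev AE_space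
    proof eventually_elim
      case (elim w)
      have "\<forall>\<^sub>F n in sequentially. (indicator {w \<in> space M. Q n w} w :: real) = indicator {w \<in> space M. B w} w"
        using elim(1) by eventually_elim (auto simp: indicator_def)
      then show ?case by (rule tendsto_eventually)
    qed
  qed (use Q B in \<open>auto simp: indicator_def\<close>)
  then show ?thesis using int[OF Q] int[OF B] by simp
qed

text \<open>For \<open>p < 7/8\<close> the factor \<open>c_p\<close> is 0 and any fair sign serves,
  such as \<open>X 1\<close>. Otherwise the sign is read off the walk, and its fairness is the limit
  of the symmetry at finite times.\<close>

lemma limit_law:
  assumes "p \<noteq> 7/8"
  shows "\<exists>R :: 'a \<Rightarrow> int. R \<in> measurable M (count_space UNIV)
    \<and> distr M (count_space UNIV) R = measure_pmf (rad_pmf (1/2))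
    \<and> (AE w in M. (\<lambda>n. real_of_int (walk_S X n w) / real n) \<longlonglongrightarrow> c_p p * real_of_int (R w))"
proof (cases "p < 7/8")
  case True
  have "\<P>(w in M. X 1 w = 1) = \<P>(w in M. X 1 w = -1)"
  proof -
    have H2: "H 2 w = [X 1 w, X 2 w]" for w by (simp add: history_def numeral_2_eq_2)
    have neg: "- a = 1 \<longleftrightarrow> a = -1" for a :: int by auto
    show ?thesis using prob_symmetric[of 2 "\<lambda>h. hd h = 1"] by (simp add: H2 neg)
  qed
  then have "distr M (count_space UNIV) (X 1) = measure_pmf (rad_pmf (1/2))"
    using X_cases X_init by (intro distr_eq_rad_half) auto
  moreover have "AE w in M. (\<lambda>n. real_of_int (walk_S X n w) / real n) \<longlonglongrightarrow> c_p p * real_of_int (X 1 w)"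
    using AE_tendsto_zero[OF True] True by (simp add: x_def S_def c_p_def)
  ultimately show ?thesis using X_meas by blast
next
  case False
  then have p78: "7/8 < p" using assms by simp
  interpret lyapunov m using p78 p by unfold_locales (auto simp: m_def)
  \<comment> \<open>Eventual positivity is measurable and makes sense at every point, so
    \<open>R\<close> is a sign even on the null set where the limit fails.\<close>
  define A where "A w \<longleftrightarrow> (\<exists>N. \<forall>n\<ge>N. S n w > 0)" for w
  define R where "R w = (if A w then 1 else (-1::int))" for w
  have As: "{w \<in> space M. A w} \<in> sets M" "{w \<in> space M. \<not> A w} \<in> sets M"
    unfolding A_def by measurable
  have Ss: "{w \<in> space M. S n w > 0} \<in> sets M" "{w \<in> space M. S n w < 0} \<in> sets M" for n
    by measurable
  have lim: "AE w in M. ((\<forall>\<^sub>F n in sequentially. (S n w > 0) = A w) \<and> (\<forall>\<^sub>F n in sequentially. (S n w < 0) = (\<not> A w)))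
      \<and> (\<lambda>n. x n w) \<longlonglongrightarrow> r * real_of_int (R w)"
    using AE_tendsto_r[OF p78]
  proof eventually_elim
    case (elim w)
    have x_S: "S n w > 0" if "x n w > 0" for n using that by (auto simp: x_def zero_less_divide_iff)
    have x_S': "S n w < 0" if "x n w < 0" for n using that by (auto simp: x_def divide_less_0_iff)
    from elim show ?case
    proof
      assume x: "(\<lambda>n. x n w) \<longlonglongrightarrow> r"
      then have "\<forall>\<^sub>F n in sequentially. x n w > 0" using r_pos by (rule order_tendstoD)
      then have ev: "\<forall>\<^sub>F n in sequentially. S n w > 0" by eventually_elim (rule x_S)
      then have "A w" by (simp add: A_def eventually_sequentially)
      then show ?thesis using ev x by (auto simp: R_def elim: eventually_mono)
    next
      assume x: "(\<lambda>n. x n w) \<longlonglongrightarrow> - r"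
      then have "\<forall>\<^sub>F n in sequentially. x n w < 0" using r_pos by (intro order_tendstoD) auto
      then have ev: "\<forall>\<^sub>F n in sequentially. S n w < 0" by eventually_elim (rule x_S')
      have "\<not> A w"
      proof
        assume "A w"
        then have "\<forall>\<^sub>F n in sequentially. S n w > 0" by (simp add: A_def eventually_sequentially)
        with ev have "\<forall>\<^sub>F n in sequentially. False" by eventually_elim simp
        then show False by simp
      qed
      then show ?thesis using ev x by (auto simp: R_def elim: eventually_mono)
    qed
  qed
  have lp: "(\<lambda>n. \<P>(w in M. S n w > 0)) \<longlonglongrightarrow> \<P>(w in M. A w)"
    using lim by (intro tendsto_prob_eventually Ss As) (auto elim: eventually_mono)
  have lm: "(\<lambda>n. \<P>(w in M. S n w < 0)) \<longlonglongrightarrow> \<P>(w in M. \<not> A w)"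
    using lim by (intro tendsto_prob_eventually Ss As) (auto elim: eventually_mono)
  have sym: "\<P>(w in M. S n w > 0) = \<P>(w in M. S n w < 0)" if "n \<ge> 2" for n
  proof -
    have "sum_list (map uminus h) = - sum_list h" for h :: "int list" by (induction h) auto
    then show ?thesis
      using prob_symmetric[OF that, of "\<lambda>h. sum_list h > 0"] by (simp add: S_def sum_list_history)
  qed
  have "(\<lambda>n. \<P>(w in M. S n w > 0)) \<longlonglongrightarrow> \<P>(w in M. \<not> A w)"
    using lm by (rule Lim_transform_eventually) (use sym in \<open>auto simp: eventually_sequentially intro!: exI[of _ 2]\<close>)
  then have "\<P>(w in M. A w) = \<P>(w in M. \<not> A w)"
    using lp by (rule LIMSEQ_unique[rotated])
  moreover have "{w \<in> space M. R w = 1} = {w \<in> space M. A w}" "{w \<in> space M. R w = -1} = {w \<in> space M. \<not> A w}"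
    by (auto simp: R_def)
  ultimately have eq: "\<P>(w in M. R w = 1) = \<P>(w in M. R w = -1)" by simp
  have R: "R \<in> measurable M (count_space UNIV)"
    unfolding R_def using As by measurable
  have "distr M (count_space UNIV) R = measure_pmf (rad_pmf (1/2))"
    using R eq by (intro distr_eq_rad_half) (auto simp: R_def)
  moreover have "AE w in M. (\<lambda>n. real_of_int (walk_S X n w) / real n) \<longlonglongrightarrow> c_p p * real_of_int (R w)"
    using lim unfolding c_p_eq[OF p78] by (auto simp: x_def S_def elim: eventually_mono)
  ultimately show ?thesis using R by blast
qed

end

section \<open>Realisation from independent draws\<close>

text \<open>Out-of-range indices, which have probability zero, contribute 0: the original walk need not be
  measurable there.\<close>

function walk_of :: "(draw_idx \<Rightarrow> int) \<Rightarrow> nat \<Rightarrow> int" where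
  "walk_of \<omega> n = (if n = 0 then 0 else if n \<le> 2 then (if \<omega> (IX n) = 1 then 1 else -1) else
    clamp1 (\<omega> (IA1 n) * (if 1 \<le> \<omega> (IU1 n) \<and> \<omega> (IU1 n) < int n then walk_of \<omega> (nat (\<omega> (IU1 n))) else 0)
      + \<omega> (IA2 n) * (if 1 \<le> \<omega> (IU2 n) \<and> \<omega> (IU2 n) < int n then walk_of \<omega> (nat (\<omega> (IU2 n))) else 0)))"
  by auto
termination by (relation "Wellfounded.measure snd") auto

declare walk_of.simps [simp del]

lemma clamp1_range: "clamp1 t \<in> {-1, 0, 1}"
  by (auto simp: clamp1_def max_def min_def)

lemma walk_of_range: "walk_of \<omega> n \<in> {-1, 0, 1}"
  by (subst walk_of.simps) (use clamp1_range in auto)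

text \<open>The draws that determine the walk up to time \<open>n\<close>; finiteness makes the
  product space of such a block discrete.\<close>

definition draws_upto :: "nat \<Rightarrow> draw_idx set" where
  "draws_upto n = {IX 1, IX 2} \<union> IU1 ` {3..n} \<union> IU2 ` {3..n} \<union> IA1 ` {3..n} \<union> IA2 ` {3..n}"

lemma finite_draws_upto: "finite (draws_upto n)"
  by (simp add: draws_upto_def)

lemma draws_upto_subset: "draws_upto n \<subseteq> draw_set"
  by (auto simp: draws_upto_def draw_set_def)

lemma walk_of_cong:
  "(\<And>d. d \<in> draws_upto n \<Longrightarrow> \<omega> d = \<omega>' d) \<Longrightarrow> k \<le> n \<Longrightarrow> walk_of \<omega> k = walk_of \<omega>' k"
proof (induction k rule: less_induct)
  case (less k)
  show ?case
  proof (cases "k \<le> 2")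
    case True
    then consider "k = 0" | "k = 1" | "k = 2" by linarith
    then show ?thesis
      using less.prems(1)[of "IX 1"] less.prems(1)[of "IX 2"]
      by cases (auto simp: walk_of.simps[of _ 0] walk_of.simps[of _ "Suc 0"] walk_of.simps[of _ 2] draws_upto_def)
  next
    case False
    then have k: "IU1 k \<in> draws_upto n" "IU2 k \<in> draws_upto n" "IA1 k \<in> draws_upto n" "IA2 k \<in> draws_upto n"
      using less.prems(2) by (auto simp: draws_upto_def)
    have IH: "walk_of \<omega> (nat u) = walk_of \<omega>' (nat u)" if "1 \<le> u" "u < int k" for u
      using that less.prems by (intro less.IH) auto
    show ?thesis
      using False k[THEN less.prems(1)] IH by (simp add: walk_of.simps[of _ k] cong: if_cong)
  qed
qed

text \<open>The recalled step, with positions counted from 1 and, outside the history, the default 0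
  of \<open>walk_of\<close>.\<close>

definition select :: "int list \<Rightarrow> int \<Rightarrow> int" where
  "select h u = (if 1 \<le> u \<and> u \<le> int (length h) then h ! (nat u - 1) else 0)"

text \<open>On the event that the past equals \<open>h\<close>, the next step is a function of four
  fresh draws alone, with \<open>h\<close> a constant; this is the form to which independence
  applies.\<close>

lemma walk_of_Suc:
  assumes n: "n \<ge> 2" and h: "map (walk_of \<omega>) [1..<Suc n] = h"
  shows "walk_of \<omega> (Suc n) = clamp1 (\<omega> (IA1 (Suc n)) * select h (\<omega> (IU1 (Suc n))) + \<omega> (IA2 (Suc n)) * select h (\<omega> (IU2 (Suc n))))"
proof -
  have "(if 1 \<le> u \<and> u < int (Suc n) then walk_of \<omega> (nat u) else 0) = select h u" for u
  proof (cases "1 \<le> u \<and> u < int (Suc n)")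
    case True
    then have "[1..<Suc n] ! (nat u - 1) = nat u" by (subst nth_upt) auto
    then have "h ! (nat u - 1) = walk_of \<omega> (nat u)" using True unfolding h[symmetric] by (subst nth_map) auto
    moreover have "length h = n" unfolding h[symmetric] by simp
    ultimately show ?thesis using True by (auto simp: select_def)
  next
    case False
    moreover have "length h = n" unfolding h[symmetric] by simp
    ultimately show ?thesis by (auto simp: select_def)
  qed
  then show ?thesis using n by (simp add: walk_of.simps[of _ "Suc n"])
qed

section \<open>Transition probabilities from independent draws\<close>

locale independent_draws = prob_space M for M :: "'a measure" +
  fixes D :: "draw_idx \<Rightarrow> 'a \<Rightarrow> int" and p :: real
  assumes p: "0 < p" "p < 1"
    and indep: "indep_vars (\<lambda>_. count_space UNIV) D draw_set"
    and init_law: "\<And>i. i \<in> {1, 2} \<Longrightarrow> \<P>(w in M. D (IX i) w = 1) = 1/2"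
    and index_law: "\<And>n u i. n \<ge> 2 \<Longrightarrow> u \<in> {1..n} \<Longrightarrow> i \<in> {IU1 (Suc n), IU2 (Suc n)} \<Longrightarrow>
      \<P>(w in M. D i w = int u) = 1 / real n"
    and sign_law: "\<And>n i. n \<ge> 2 \<Longrightarrow> i \<in> {IA1 (Suc n), IA2 (Suc n)} \<Longrightarrow>
      \<P>(w in M. D i w = 1) = p \<and> \<P>(w in M. D i w = -1) = 1 - p"
begin

lemma D_meas: "d \<in> draw_set \<Longrightarrow> D d \<in> measurable M (count_space UNIV)"
  using indep by (simp add: indep_vars_def)

abbreviation draw :: "'a \<Rightarrow> draw_idx \<Rightarrow> int" where "draw w \<equiv> \<lambda>d. D d w"

lemma PiM_draws:
  assumes "finite A"
  shows "PiM A (\<lambda>_. count_space UNIV) = count_space (PiE A (\<lambda>_. UNIV :: int set))"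
  using assms by (intro count_space_PiM_finite) auto

lemma restrict_meas:
  assumes "finite A" "A \<subseteq> draw_set"
  shows "(\<lambda>w. restrict (draw w) A) \<in> measurable M (count_space (PiE A (\<lambda>_. UNIV)))"
  unfolding PiM_draws[OF assms(1), symmetric] using assms(2) D_meas by (intro measurable_restrict) auto

lemma local_meas:
  assumes "finite A" "A \<subseteq> draw_set" and f: "\<And>\<omega>. f \<omega> = f (restrict \<omega> A)"
  shows "(\<lambda>w. f (draw w)) \<in> measurable M (count_space UNIV)"
proof -
  have "(\<lambda>w. f (restrict (draw w) A)) \<in> measurable M (count_space UNIV)"
    by (rule measurable_compose[OF restrict_meas[OF assms(1,2)]]) simp
  then show ?thesis by (simp add: f[symmetric])
qed

text \<open>A finite product of copies of the countable discrete space \<open>int\<close> is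
  discrete, so every predicate of a finite block of draws is an event, and disjoint blocks are
  independent.\<close>

lemma block_independence:
  assumes A: "finite A" "A \<subseteq> draw_set" and B: "finite B" "B \<subseteq> draw_set" and AB: "A \<inter> B = {}"
    and P: "\<And>\<omega>. P \<omega> = P (restrict \<omega> A)" and Q: "\<And>\<omega>. Q \<omega> = Q (restrict \<omega> B)"
  shows "\<P>(w in M. P (draw w) \<and> Q (draw w)) = \<P>(w in M. P (draw w)) * \<P>(w in M. Q (draw w))"
proof -
  have ind: "indep_var (PiM A (\<lambda>_. count_space UNIV)) (\<lambda>w. restrict (draw w) A)
      (PiM B (\<lambda>_. count_space UNIV)) (\<lambda>w. restrict (draw w) B)"
    by (rule indep_var_restrict[OF indep AB A(2) B(2)])
  define SA where "SA = {\<omega> \<in> PiE A (\<lambda>_. UNIV). P \<omega>}"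
  define SB where "SB = {\<omega> \<in> PiE B (\<lambda>_. UNIV). Q \<omega>}"
  have "SA \<in> sets (PiM A (\<lambda>_. count_space UNIV))" "SB \<in> sets (PiM B (\<lambda>_. count_space UNIV))"
    unfolding PiM_draws[OF A(1)] PiM_draws[OF B(1)] by (auto simp: SA_def SB_def)
  from indep_varD[OF ind this]
  have "prob ((\<lambda>w. (restrict (draw w) A, restrict (draw w) B)) -` (SA \<times> SB) \<inter> space M)
    = prob ((\<lambda>w. restrict (draw w) A) -` SA \<inter> space M) * prob ((\<lambda>w. restrict (draw w) B) -` SB \<inter> space M)" .
  moreover have "(\<lambda>w. (restrict (draw w) A, restrict (draw w) B)) -` (SA \<times> SB) \<inter> space M
      = {w \<in> space M. P (draw w) \<and> Q (draw w)}"
    using P[symmetric] Q[symmetric] by (auto simp: SA_def SB_def)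
  moreover have "(\<lambda>w. restrict (draw w) A) -` SA \<inter> space M = {w \<in> space M. P (draw w)}"
    using P[symmetric] by (auto simp: SA_def)
  moreover have "(\<lambda>w. restrict (draw w) B) -` SB \<inter> space M = {w \<in> space M. Q (draw w)}"
    using Q[symmetric] by (auto simp: SB_def)
  ultimately show ?thesis by simp
qed

lemma D_set [measurable]: "d \<in> draw_set \<Longrightarrow> {w \<in> space M. P (D d w)} \<in> sets M"
  using measurable_sets[OF D_meas, of d "{a. P a}"] by (simp add: vimage_def Int_def conj_commute)

lemma sign_zero:
  assumes n: "n \<ge> 2" and i: "i \<in> {IA1 (Suc n), IA2 (Suc n)}" and a: "a \<noteq> 1" "a \<noteq> -1"
  shows "\<P>(w in M. D i w = a) = 0"
proof -
  have id: "i \<in> draw_set" using n i by (auto simp: draw_set_def)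
  have "prob ({w \<in> space M. D i w = 1} \<union> {w \<in> space M. D i w = -1}) = \<P>(w in M. D i w = 1) + \<P>(w in M. D i w = -1)"
    using id by (intro finite_measure_Union) auto
  then have 1: "prob ({w \<in> space M. D i w = 1} \<union> {w \<in> space M. D i w = -1}) = 1"
    using sign_law[OF n i] by simp
  have "prob (({w \<in> space M. D i w = 1} \<union> {w \<in> space M. D i w = -1}) \<union> {w \<in> space M. D i w = a})
    = prob ({w \<in> space M. D i w = 1} \<union> {w \<in> space M. D i w = -1}) + \<P>(w in M. D i w = a)"
    using id a by (intro finite_measure_Union) auto
  then show ?thesis
    using 1 measure_nonneg[of M "{w \<in> space M. D i w = a}"]
      prob_le_1[of "({w \<in> space M. D i w = 1} \<union> {w \<in> space M. D i w = -1}) \<union> {w \<in> space M. D i w = a}"]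
    by linarith
qed

lemma index_range:
  assumes n: "n \<ge> 2" and i: "i \<in> {IU1 (Suc n), IU2 (Suc n)}"
  shows "AE w in M. D i w \<in> int ` {1..n}"
proof -
  have id: "i \<in> draw_set" using n i by (auto simp: draw_set_def)
  have "{w \<in> space M. D i w \<in> int ` {1..n}} = (\<Union>u\<in>{1..n}. {w \<in> space M. D i w = int u})" by auto
  then have "\<P>(w in M. D i w \<in> int ` {1..n}) = (\<Sum>u\<in>{1..n}. \<P>(w in M. D i w = int u))"
    using id by (simp, intro finite_measure_finite_Union) (auto simp: disjoint_family_on_def)
  also have "\<dots> = (\<Sum>u\<in>{1..n}. 1 / real n)" using index_law[OF n _ i] by (intro sum.cong) auto
  also have "\<dots> = 1" using n by simp
  finally show ?thesis using id by (subst (asm) prob_Collect_eq_1) auto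
qed

text \<open>One formula for the three values of \<open>c\<close>, linear in \<open>c\<close> and its
  modulus, so that averaging over a uniformly chosen past step produces exactly the mean and the
  proportion of nonzero steps.\<close>

lemma sign_product_law:
  assumes n: "n \<ge> 2" and i: "i \<in> {IA1 (Suc n), IA2 (Suc n)}" and c: "c \<in> {-1, 0, 1}" and a: "a \<in> {-1, 1}"
  shows "\<P>(w in M. D i w * c = a) = (\<bar>real_of_int c\<bar> + (2 * p - 1) * (real_of_int a * real_of_int c)) / 2"
    and "\<P>(w in M. D i w * c = 0) = 1 - \<bar>real_of_int c\<bar>"
proof -
  have neg: "- z = 1 \<longleftrightarrow> z = -1" "- z = -1 \<longleftrightarrow> z = 1" for z :: int by auto
  show "\<P>(w in M. D i w * c = a) = (\<bar>real_of_int c\<bar> + (2 * p - 1) * (real_of_int a * real_of_int c)) / 2"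
    using c a sign_law[OF n i] by (auto simp: neg field_simps)
  show "\<P>(w in M. D i w * c = 0) = 1 - \<bar>real_of_int c\<bar>"
    using c sign_zero[OF n i, of 0] by (auto simp: prob_space)
qed

lemma channel_law:
  assumes n: "n \<ge> 2" and h: "length h = n" "set h \<subseteq> {-1, 0, 1}"
    and i: "(i, j) \<in> {(IU1 (Suc n), IA1 (Suc n)), (IU2 (Suc n), IA2 (Suc n))}" and a: "a \<in> {-1, 1}"
  defines "s \<equiv> real_of_int (sum_list h) / real n" and "t \<equiv> real_of_int (sum_list (map abs h)) / real n"
  shows "\<P>(w in M. D j w * select h (D i w) = a) = (t + (2 * p - 1) * (real_of_int a * s)) / 2"
    and "\<P>(w in M. D j w * select h (D i w) = 0) = 1 - t"
proof -
  have ij: "i \<in> {IU1 (Suc n), IU2 (Suc n)}" "j \<in> {IA1 (Suc n), IA2 (Suc n)}" "i \<noteq> j" using i by auto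
  have id: "i \<in> draw_set" "j \<in> draw_set" using n ij by (auto simp: draw_set_def)
  have sum_h: "(\<Sum>u\<in>{1..n}. f (h ! (u - 1))) = sum_list (map f h)" for f :: "int \<Rightarrow> real"
  proof -
    have "(\<Sum>u\<in>{1..n}. f (h ! (u - 1))) = (\<Sum>u\<in>{0..<n}. f (h ! u))"
      by (rule sum.reindex_bij_witness[where i = Suc and j = "\<lambda>u. u - 1"]) auto
    then show ?thesis using h by (simp add: sum_list_sum_nth)
  qed
  have sums: "sum_list (map (\<lambda>c. real_of_int c) h) = real n * s" "sum_list (map (\<lambda>c. \<bar>real_of_int c\<bar>) h) = real n * t"
  proof -
    have "sum_list (map (\<lambda>c. real_of_int c) g) = real_of_int (sum_list g)" for g by (induction g) auto
    moreover have "sum_list (map (\<lambda>c. \<bar>real_of_int c\<bar>) g) = real_of_int (sum_list (map abs g))" for g by (induction g) auto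
    ultimately show "sum_list (map (\<lambda>c. real_of_int c) h) = real n * s" "sum_list (map (\<lambda>c. \<bar>real_of_int c\<bar>) h) = real n * t"
      using n by (simp_all add: s_def t_def)
  qed
  \<comment> \<open>Decomposition over the chosen index, which lies in its range only almost surely;
    the sign is independent of it.\<close>
  have total: "\<P>(w in M. D j w * select h (D i w) = v)
    = (\<Sum>u\<in>{1..n}. 1 / real n * \<P>(w in M. D j w * (h ! (u - 1)) = v))" for v
  proof -
    have ev: "{w \<in> space M. D i w = int u \<and> D j w * (h ! (u - 1)) = v} \<in> sets M" for u
    proof -
      have "{w \<in> space M. D i w = int u \<and> D j w * (h ! (u - 1)) = v}
         = {w \<in> space M. D i w = int u} \<inter> {w \<in> space M. D j w * (h ! (u - 1)) = v}" by auto
      then show ?thesis using D_set[OF id(1), of "\<lambda>a. a = int u"] D_set[OF id(2), of "\<lambda>a. a * (h ! (u - 1)) = v"] by auto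
    qed
    have "(\<lambda>w. D j w * select h (D i w) = v) \<in> measurable M (count_space UNIV)"
      using local_meas[of "{i, j}" "\<lambda>\<omega>. \<omega> j * select h (\<omega> i) = v"] id by auto
    then have me: "{w \<in> space M. D j w * select h (D i w) = v} \<in> sets M" by (simp add: pred_def[symmetric])
    have "\<P>(w in M. D j w * select h (D i w) = v)
      = prob (\<Union>u\<in>{1..n}. {w \<in> space M. D i w = int u \<and> D j w * (h ! (u - 1)) = v})"
    proof (rule finite_measure_eq_AE)
      show "AE w in M. (w \<in> {w \<in> space M. D j w * select h (D i w) = v})
        = (w \<in> (\<Union>u\<in>{1..n}. {w \<in> space M. D i w = int u \<and> D j w * (h ! (u - 1)) = v}))"
        using index_range[OF n ij(1)]
      proof eventually_elim
        case (elim w)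
        then show ?case using h by (auto simp: select_def)
      qed
    qed (use me ev in auto)
    also have "\<dots> = (\<Sum>u\<in>{1..n}. \<P>(w in M. D i w = int u \<and> D j w * (h ! (u - 1)) = v))"
      using ev by (intro finite_measure_finite_Union) (auto simp: disjoint_family_on_def)
    also have "\<dots> = (\<Sum>u\<in>{1..n}. 1 / real n * \<P>(w in M. D j w * (h ! (u - 1)) = v))"
    proof (rule sum.cong[OF refl])
      fix u assume u: "u \<in> {1..n}"
      have "\<P>(w in M. D i w = int u \<and> D j w * (h ! (u - 1)) = v)
        = \<P>(w in M. D i w = int u) * \<P>(w in M. D j w * (h ! (u - 1)) = v)"
        using id ij(3) block_independence[of "{i}" "{j}" "\<lambda>\<omega>. \<omega> i = int u" "\<lambda>\<omega>. \<omega> j * (h ! (u - 1)) = v"] by auto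
      then show "\<P>(w in M. D i w = int u \<and> D j w * (h ! (u - 1)) = v)
        = 1 / real n * \<P>(w in M. D j w * (h ! (u - 1)) = v)"
        using index_law[OF n u ij(1)] by simp
    qed
    finally show ?thesis .
  qed
  have hu: "h ! (u - 1) \<in> {-1, 0, 1}" if "u \<in> {1..n}" for u
  proof -
    have "u - 1 < length h" using that h by auto
    then show ?thesis using h(2) nth_mem by blast
  qed
  have "\<P>(w in M. D j w * select h (D i w) = a)
    = (\<Sum>u\<in>{1..n}. 1 / real n * ((\<bar>real_of_int (h ! (u - 1))\<bar> + (2 * p - 1) * (real_of_int a * real_of_int (h ! (u - 1)))) / 2))"
    unfolding total by (intro sum.cong refl) (simp only: sign_product_law(1)[OF n ij(2) hu a])
  also have "\<dots> = 1 / real n * (((\<Sum>u\<in>{1..n}. \<bar>real_of_int (h ! (u - 1))\<bar>)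
      + (2 * p - 1) * (real_of_int a * (\<Sum>u\<in>{1..n}. real_of_int (h ! (u - 1))))) / 2)"
    by (simp only: sum_distrib_left[symmetric] sum_divide_distrib[symmetric] sum.distrib)
  also have "\<dots> = (t + (2 * p - 1) * (real_of_int a * s)) / 2"
  proof -
    have gen: "1 / N * ((N * t + q * (b * (N * s))) / 2) = (t + q * (b * s)) / 2" if "N \<noteq> 0" for N q b :: real
      using that by (simp add: field_simps)
    show ?thesis
      unfolding sum_h[of "\<lambda>c. real_of_int c"] sum_h[of "\<lambda>c. \<bar>real_of_int c\<bar>"] sums
      by (rule gen) (use n in simp)
  qed
  finally show "\<P>(w in M. D j w * select h (D i w) = a) = (t + (2 * p - 1) * (real_of_int a * s)) / 2" .
  have "\<P>(w in M. D j w * select h (D i w) = 0) = (\<Sum>u\<in>{1..n}. 1 / real n * (1 - \<bar>real_of_int (h ! (u - 1))\<bar>))"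
    unfolding total by (intro sum.cong refl) (simp only: sign_product_law(2)[OF n ij(2) hu a])
  also have "\<dots> = 1 / real n * (real n - (\<Sum>u\<in>{1..n}. \<bar>real_of_int (h ! (u - 1))\<bar>))"
    by (simp only: sum_distrib_left[symmetric] sum_subtractf) simp
  also have "\<dots> = 1 - t"
  proof -
    have gen: "1 / N * (N - N * t) = 1 - t" if "N \<noteq> 0" for N :: real
      using that by (simp add: field_simps)
    show ?thesis unfolding sum_h[of "\<lambda>c. \<bar>real_of_int c\<bar>"] sums by (rule gen) (use n in simp)
  qed
  finally show "\<P>(w in M. D j w * select h (D i w) = 0) = 1 - t" .
qed

definition Xd :: "nat \<Rightarrow> 'a \<Rightarrow> int" where
  "Xd n w = walk_of (draw w) n"

lemma history_Xd: "history Xd n w = map (walk_of (draw w)) [1..<Suc n]"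
  by (simp add: history_def Xd_def)

lemma Xd_meas: "Xd n \<in> measurable M (count_space UNIV)"
proof -
  have "walk_of \<omega> n = walk_of (restrict \<omega> (draws_upto n)) n" for \<omega>
    by (rule walk_of_cong[where n = n]) auto
  then show ?thesis
    unfolding Xd_def[abs_def] by (rule local_meas[OF finite_draws_upto draws_upto_subset])
qed

lemma kernel_Xd:
  assumes n: "n \<ge> 2" and h: "length h = n" "set h \<subseteq> {-1, 0, 1}" and a: "a \<in> {-1, 1}"
  shows "\<P>(w in M. history Xd n w = h \<and> Xd (Suc n) w = a)
      = \<P>(w in M. history Xd n w = h) *
        prob_up (2 * p - 1) (real_of_int a * real_of_int (sum_list h) / real n)
          (real_of_int (sum_list (map abs h)) / real n)"
proof -
  define B1 where "B1 = {IU1 (Suc n), IA1 (Suc n)}"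
  define B2 where "B2 = {IU2 (Suc n), IA2 (Suc n)}"
  define c1 where "c1 \<omega> = \<omega> (IA1 (Suc n)) * select h (\<omega> (IU1 (Suc n)))" for \<omega>
  define c2 where "c2 \<omega> = \<omega> (IA2 (Suc n)) * select h (\<omega> (IU2 (Suc n)))" for \<omega>
  have B: "finite B1" "finite B2" "B1 \<subseteq> draw_set" "B2 \<subseteq> draw_set" "B1 \<inter> B2 = {}"
    "draws_upto n \<inter> (B1 \<union> B2) = {}"
    using n by (auto simp: B1_def B2_def draw_set_def draws_upto_def)
  have c1: "c1 \<omega> = c1 (restrict \<omega> B1)" and c2: "c2 \<omega> = c2 (restrict \<omega> B2)" for \<omega>
    by (simp_all add: c1_def c2_def B1_def B2_def)
  have c12: "c1 \<omega> = c1 (restrict \<omega> (B1 \<union> B2))" "c2 \<omega> = c2 (restrict \<omega> (B1 \<union> B2))" for \<omega>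
    by (simp_all add: c1_def c2_def B1_def B2_def)
  have hist: "(map (walk_of \<omega>) [1..<Suc n] = h) = (map (walk_of (restrict \<omega> (draws_upto n))) [1..<Suc n] = h)" for \<omega>
  proof -
    have "map (walk_of \<omega>) [1..<Suc n] = map (walk_of (restrict \<omega> (draws_upto n))) [1..<Suc n]"
      by (intro map_cong refl walk_of_cong[where n = n]) auto
    then show ?thesis by (simp only:)
  qed
  have "{w \<in> space M. history Xd n w = h \<and> Xd (Suc n) w = a}
    = {w \<in> space M. map (walk_of (draw w)) [1..<Suc n] = h \<and> clamp1 (c1 (draw w) + c2 (draw w)) = a}"
    unfolding history_Xd using walk_of_Suc[OF n] by (auto simp: Xd_def c1_def c2_def simp del: upt_Suc)
  \<comment> \<open>With \<open>h\<close> frozen in the second event, past and next step use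
    disjoint blocks of draws.\<close>
  also have "prob \<dots> = \<P>(w in M. map (walk_of (draw w)) [1..<Suc n] = h)
      * \<P>(w in M. clamp1 (c1 (draw w) + c2 (draw w)) = a)"
  proof (rule block_independence[of "draws_upto n" "B1 \<union> B2"])
    show "(clamp1 (c1 \<omega> + c2 \<omega>) = a) = (clamp1 (c1 (restrict \<omega> (B1 \<union> B2)) + c2 (restrict \<omega> (B1 \<union> B2))) = a)" for \<omega>
      by (simp only: c12[symmetric])
    show "(map (walk_of \<omega>) [1..<Suc n] = h) = (map (walk_of (restrict \<omega> (draws_upto n))) [1..<Suc n] = h)" for \<omega>
      by (rule hist)
  qed (use B draws_upto_subset finite_draws_upto in auto)
  also have "\<P>(w in M. clamp1 (c1 (draw w) + c2 (draw w)) = a)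
     = prob_up (2 * p - 1) (real_of_int a * real_of_int (sum_list h) / real n) (real_of_int (sum_list (map abs h)) / real n)"
  proof -
    define s where "s = real_of_int (sum_list h) / real n"
    define t where "t = real_of_int (sum_list (map abs h)) / real n"
    define q where "q b = (t + (2 * p - 1) * (real_of_int b * s)) / 2" for b
    have law1: "\<P>(w in M. c1 (draw w) = b) = q b" if "b \<in> {-1, 1}" for b
      using channel_law(1)[OF n h _ that, of "IU1 (Suc n)" "IA1 (Suc n)"] by (simp add: c1_def q_def s_def t_def)
    have law2: "\<P>(w in M. c2 (draw w) = b) = q b" if "b \<in> {-1, 1}" for b
      using channel_law(1)[OF n h _ that, of "IU2 (Suc n)" "IA2 (Suc n)"] by (simp add: c2_def q_def s_def t_def)
    have law0: "\<P>(w in M. c1 (draw w) = 0) = 1 - t" "\<P>(w in M. c2 (draw w) = 0) = 1 - t"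
      using channel_law(2)[OF n h _ a, of "IU1 (Suc n)" "IA1 (Suc n)"] channel_law(2)[OF n h _ a, of "IU2 (Suc n)" "IA2 (Suc n)"]
      by (simp_all add: c1_def c2_def t_def)
    have m1: "(\<lambda>w. c1 (draw w)) \<in> measurable M (count_space UNIV)" using B c1 by (intro local_meas[of B1])
    have m2: "(\<lambda>w. c2 (draw w)) \<in> measurable M (count_space UNIV)" using B c2 by (intro local_meas[of B2])
    have sets: "{w \<in> space M. P (c1 (draw w)) (c2 (draw w))} \<in> sets M" for P
    proof -
      have "(\<lambda>w. (c1 (draw w), c2 (draw w))) \<in> measurable M (count_space UNIV)"
        using B c12 by (intro local_meas[of "B1 \<union> B2" "\<lambda>\<omega>. (c1 \<omega>, c2 \<omega>)"]) auto
      from measurable_sets[OF this, of "{(a, b). P a b}"] show ?thesis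
        by (simp add: vimage_def Int_def conj_commute)
    qed
    have pair: "\<P>(w in M. c1 (draw w) = b \<and> c2 (draw w) = b') = \<P>(w in M. c1 (draw w) = b) * \<P>(w in M. c2 (draw w) = b')" for b b'
    proof (rule block_independence[of B1 B2])
      show "(c1 \<omega> = b) = (c1 (restrict \<omega> B1) = b)" "(c2 \<omega> = b') = (c2 (restrict \<omega> B2) = b')" for \<omega>
        by (simp_all only: c1[symmetric] c2[symmetric])
    qed (use B in auto)
    \<comment> \<open>The laws give the masses at -1, 0 and 1; these add up to 1, so a channel takes
      other values with probability 0.\<close>
    have range: "AE w in M. c (draw w) \<in> {-1, 0, 1}"
      if m: "(\<lambda>w. c (draw w)) \<in> measurable M (count_space UNIV)"
        and l: "\<And>b. b \<in> {-1, 1} \<Longrightarrow> \<P>(w in M. c (draw w) = b) = q b" "\<P>(w in M. c (draw w) = 0) = 1 - t"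
      for c :: "(draw_idx \<Rightarrow> int) \<Rightarrow> int"
    proof -
      have se: "{w \<in> space M. c (draw w) = b} \<in> sets M" for b
        using measurable_sets[OF m, of "{b}"] by (simp add: vimage_def Int_def conj_commute)
      have "{w \<in> space M. c (draw w) \<in> {-1, 0, 1}} = (\<Union>b\<in>{-1, 0, 1}. {w \<in> space M. c (draw w) = b})" by auto
      then have "\<P>(w in M. c (draw w) \<in> {-1, 0, 1}) = (\<Sum>b\<in>{-1, 0, 1}. \<P>(w in M. c (draw w) = b))"
        using se by (simp only:, intro finite_measure_finite_Union) (auto simp: disjoint_family_on_def)
      also have "\<dots> = q (-1) + (1 - t) + q 1" using l(1)[of 1] l(1)[of "-1"] l(2) by simp
      also have "\<dots> = 1"
      proof -
        define z where "z = (2 * p - 1) * s"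
        have "q (-1) = (t - z) / 2" "q 1 = (t + z) / 2" by (simp_all add: q_def z_def)
        then show ?thesis by argo
      qed
      finally have 1: "\<P>(w in M. c (draw w) \<in> {-1, 0, 1}) = 1" .
      have "{w \<in> space M. c (draw w) \<in> {-1, 0, 1}} \<in> sets M"
        using measurable_sets[OF m, of "{-1, 0, 1}"] by (simp add: vimage_def Int_def conj_commute)
      from prob_Collect_eq_1[OF this] 1 show ?thesis by simp
    qed
    have r1: "AE w in M. c1 (draw w) \<in> {-1, 0, 1}" by (rule range[OF m1 law1 law0(1)])
    have r2: "AE w in M. c2 (draw w) \<in> {-1, 0, 1}" by (rule range[OF m2 law2 law0(2)])
    define E where "E b b' = {w \<in> space M. c1 (draw w) = b \<and> c2 (draw w) = b'}" for b b'
    \<comment> \<open>After clamping, \<open>a\<close> arises exactly from the channel pairs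
      \<open>(a, a)\<close>, \<open>(a, 0)\<close> and \<open>(0, a)\<close>.\<close>
    have "\<P>(w in M. clamp1 (c1 (draw w) + c2 (draw w)) = a) = prob (E a a \<union> E a 0 \<union> E 0 a)"
    proof (rule finite_measure_eq_AE)
      show "AE w in M. (w \<in> {w \<in> space M. clamp1 (c1 (draw w) + c2 (draw w)) = a}) = (w \<in> E a a \<union> E a 0 \<union> E 0 a)"
        using r1 r2
      proof eventually_elim
        case (elim w)
        then show ?case using a by (auto simp: E_def clamp1_def)
      qed
      show "{w \<in> space M. clamp1 (c1 (draw w) + c2 (draw w)) = a} \<in> sets M" by (rule sets)
      show "E a a \<union> E a 0 \<union> E 0 a \<in> sets M" unfolding E_def by (intro sets.Un sets)
    qed
    also have "\<dots> = prob (E a a) + prob (E a 0) + prob (E 0 a)"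
    proof -
      have "E b b' \<in> sets M" for b b' unfolding E_def by (rule sets)
      then show ?thesis
        using a by (subst finite_measure_Union; (subst finite_measure_Union)?) (auto simp: E_def)
    qed
    also have "\<dots> = q a * q a + q a * (1 - t) + (1 - t) * q a"
      unfolding E_def pair law0 using law1[OF a] law2[OF a] by simp
    also have "\<dots> = prob_up (2 * p - 1) (real_of_int a * s) t"
    proof -
      have "u * u + u * (1 - t) + (1 - t) * u = u^2 + 2 * u * (1 - t)" for u
        by (simp add: power2_eq_square algebra_simps)
      then show ?thesis by (simp only: prob_up_def q_def)
    qed
    finally show ?thesis by (simp add: s_def t_def)
  qed
  finally show ?thesis unfolding history_Xd .
qed

text \<open>All four pairs of signs have probability 1/4 and all other lists probability 0.\<close>

lemma init_symmetric_Xd: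
  "\<P>(w in M. history Xd 2 w = h) = \<P>(w in M. history Xd 2 w = map uminus h)"
proof -
  have W: "walk_of \<omega> i = (if \<omega> (IX i) = 1 then 1 else -1)" if "i \<in> {1, 2}" for \<omega> i
    using that by (auto simp: walk_of.simps[of _ i])
  have hist: "history Xd 2 w = [walk_of (draw w) 1, walk_of (draw w) 2]" for w
    by (simp add: history_Xd numeral_2_eq_2)
  have one: "\<P>(w in M. walk_of (draw w) i = b) = 1/2" if i: "i \<in> {1, 2}" and b: "b \<in> {-1, 1}" for i b
  proof (cases "b = 1")
    case True
    have eq: "{w \<in> space M. walk_of (draw w) i = b} = {w \<in> space M. D (IX i) w = 1}"
      using True W[OF i] by auto
    show ?thesis unfolding eq by (rule init_law[OF i])
  next
    case False
    have id: "IX i \<in> draw_set" using i by (auto simp: draw_set_def)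
    have "{w \<in> space M. walk_of (draw w) i = b} = space M - {w \<in> space M. D (IX i) w = 1}"
      using False b W[OF i] by auto
    then show ?thesis using prob_compl[OF D_set[OF id, of "\<lambda>a. a = 1"]] init_law[OF i] by simp
  qed
  have two: "\<P>(w in M. history Xd 2 w = [b, c]) = 1/4" if "b \<in> {-1, 1}" "c \<in> {-1, 1}" for b c
  proof -
    have "{w \<in> space M. history Xd 2 w = [b, c]} = {w \<in> space M. walk_of (draw w) 1 = b \<and> walk_of (draw w) 2 = c}"
      by (simp add: hist)
    also have "prob \<dots> = \<P>(w in M. walk_of (draw w) 1 = b) * \<P>(w in M. walk_of (draw w) 2 = c)"
      by (intro block_independence[of "{IX 1}" "{IX 2}"]) (auto simp: W draw_set_def)
    finally have eq: "\<P>(w in M. history Xd 2 w = [b, c])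
      = \<P>(w in M. walk_of (draw w) 1 = b) * \<P>(w in M. walk_of (draw w) 2 = c)" .
    have half: "\<P>(w in M. walk_of (draw w) 1 = b) = 1/2" "\<P>(w in M. walk_of (draw w) 2 = c) = 1/2"
      by (rule one; use that in simp)+
    show ?thesis unfolding eq half by simp
  qed
  have zero: "\<P>(w in M. history Xd 2 w = g) = 0" if "\<not> (\<exists>b\<in>{-1, 1}. \<exists>c\<in>{-1, 1}. g = [b, c])" for g
  proof -
    have empty: "{w \<in> space M. history Xd 2 w = g} = {}"
      using that by (auto simp: hist W)
    show ?thesis unfolding empty by simp
  qed
  show ?thesis
  proof (cases "\<exists>b\<in>{-1, 1}. \<exists>c\<in>{-1, 1}. h = [b, c]")
    case True
    then obtain b where b: "b \<in> {-1, 1}" "\<exists>c\<in>{-1, 1}. h = [b, c]" by (rule bexE)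
    from b(2) obtain c where c: "c \<in> {-1, 1}" "h = [b, c]" by (rule bexE)
    have "- b \<in> {-1, 1}" "- c \<in> {-1, 1}" using b(1) c(1) by auto
    then show ?thesis using two[OF b(1) c(1)] two[of "- b" "- c"] c(2) by simp
  next
    case False
    have "\<not> (\<exists>b\<in>{-1, 1}. \<exists>c\<in>{-1, 1}. map uminus h = [b, c])"
    proof
      assume "\<exists>b\<in>{-1, 1}. \<exists>c\<in>{-1, 1}. map uminus h = [b, c]"
      then obtain b where b: "b \<in> {-1, 1}" "\<exists>c\<in>{-1, 1}. map uminus h = [b, c]" by (rule bexE)
      from b(2) obtain c where c: "c \<in> {-1, 1}" "map uminus h = [b, c]" by (rule bexE)
      note bc = b(1) c
      have "h = [- b, - c]" using c(2) by (auto simp: map_eq_Cons_conv)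
      then show False using False bc by auto
    qed
    then have "\<P>(w in M. history Xd 2 w = map uminus h) = 0" by (rule zero)
    moreover have "\<P>(w in M. history Xd 2 w = h) = 0" using False by (rule zero)
    ultimately show ?thesis by (simp only:)
  qed
qed

text \<open>The conditions required at every point hold because \<open>walk_of\<close> turns any
  draws into an admissible walk: its first two values are signs whatever the draws, and later ones
  are clamped.\<close>

sublocale Xd: two_channel_process M Xd p
proof
  show "Xd n \<in> measurable M (count_space UNIV)" for n by (rule Xd_meas)
  show "Xd n w \<in> {-1, 0, 1}" for n w unfolding Xd_def by (rule walk_of_range)
  show "Xd 1 w \<noteq> 0" "Xd 2 w \<noteq> 0" for w by (auto simp: Xd_def walk_of.simps)
qed (use p kernel_Xd init_symmetric_Xd in auto)

end

section \<open>Transfer to the given walk\<close>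

lemma (in prob_space) prob_eq_pmf:
  assumes R: "R \<in> measurable M (count_space UNIV)" and d: "distr M (count_space UNIV) R = measure_pmf P"
  shows "\<P>(w in M. R w = a) = pmf P a"
proof -
  have "measure (distr M (count_space UNIV) R) {a} = prob (R -` {a} \<inter> space M)"
    by (rule measure_distr[OF R]) simp
  moreover have "R -` {a} \<inter> space M = {w \<in> space M. R w = a}" by auto
  ultimately show ?thesis by (simp add: d measure_pmf_single)
qed

lemma (in prob_space) AE_in_set_pmf:
  assumes R: "R \<in> measurable M (count_space UNIV)" and d: "distr M (count_space UNIV) R = measure_pmf P"
  shows "AE w in M. R w \<in> set_pmf P"
proof (rule AE_distrD[OF R])
  show "AE a in distr M (count_space UNIV) R. a \<in> set_pmf P"
    unfolding d by (rule AE_measure_pmf)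
qed

theorem theorem2p1:
  fixes M :: "'a measure"
    and X :: "nat \<Rightarrow> 'a \<Rightarrow> int"
    and U1 U2 :: "nat \<Rightarrow> 'a \<Rightarrow> nat"
    and A1 A2 :: "nat \<Rightarrow> 'a \<Rightarrow> int"
    and p :: real
  assumes "prob_space M"
    and "0 < p" and "p < 1" and "p \<noteq> 7/8"
    and indep: "prob_space.indep_vars M (\<lambda>_. count_space UNIV) (draws X U1 U2 A1 A2) draw_set"
    and X1: "distr M (count_space UNIV) (X 1) = measure_pmf (rad_pmf (1/2))"
    and X2: "distr M (count_space UNIV) (X 2) = measure_pmf (rad_pmf (1/2))"
    and U1: "\<And>n. n \<ge> 2 \<Longrightarrow> distr M (count_space UNIV) (U1 (n+1)) = measure_pmf (pmf_of_set {1..n})"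
    and U2: "\<And>n. n \<ge> 2 \<Longrightarrow> distr M (count_space UNIV) (U2 (n+1)) = measure_pmf (pmf_of_set {1..n})"
    and A1: "\<And>n. n \<ge> 2 \<Longrightarrow> distr M (count_space UNIV) (A1 (n+1)) = measure_pmf (rad_pmf p)"
    and A2: "\<And>n. n \<ge> 2 \<Longrightarrow> distr M (count_space UNIV) (A2 (n+1)) = measure_pmf (rad_pmf p)"
    and rec: "\<And>n w. n \<ge> 2 \<Longrightarrow> w \<in> space M \<Longrightarrow>
       X (n+1) w = clamp1 (A1 (n+1) w * X (U1 (n+1) w) w + A2 (n+1) w * X (U2 (n+1) w) w)"
  shows "\<exists>R :: 'a \<Rightarrow> int. R \<in> measurable M (count_space UNIV)
            \<and> distr M (count_space UNIV) R = measure_pmf (rad_pmf (1/2))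
            \<and> (AE w in M. (\<lambda>n. real_of_int (walk_S X n w) / real n)
                             \<longlonglongrightarrow> c_p p * real_of_int (R w))"
proof -
  interpret prob_space M by fact
  let ?D = "draws X U1 U2 A1 A2"
  have D: "?D d \<in> measurable M (count_space UNIV)" if "d \<in> draw_set" for d
    using indep that by (simp add: indep_vars_def)
  have X_meas: "X i \<in> measurable M (count_space UNIV)" if "i \<in> {1, 2}" for i
    using D[of "IX i"] that by (auto simp: draw_set_def)
  have X_law: "distr M (count_space UNIV) (X i) = measure_pmf (rad_pmf (1/2))" if "i \<in> {1, 2}" for i
    using that X1 X2 by auto
  have nat_meas: "V \<in> measurable M (count_space UNIV)"
    if "(\<lambda>w. int (V w)) \<in> measurable M (count_space UNIV)" for V :: "'a \<Rightarrow> nat"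
    using measurable_compose[OF that, of nat "count_space UNIV"] by simp
  have U_meas: "U1 (Suc n) \<in> measurable M (count_space UNIV)" "U2 (Suc n) \<in> measurable M (count_space UNIV)"
    if "n \<ge> 2" for n
    using D[of "IU1 (Suc n)"] D[of "IU2 (Suc n)"] that by (auto simp: draw_set_def intro: nat_meas)
  have A_meas: "A1 (Suc n) \<in> measurable M (count_space UNIV)" "A2 (Suc n) \<in> measurable M (count_space UNIV)"
    if "n \<ge> 2" for n
    using D[of "IA1 (Suc n)"] D[of "IA2 (Suc n)"] that by (auto simp: draw_set_def)
  interpret independent_draws M ?D p
  proof
    show "\<P>(w in M. ?D (IX i) w = 1) = 1/2" if "i \<in> {1, 2}" for i
      using prob_eq_pmf[OF X_meas X_law, OF that that, of 1] by (simp add: pmf_rad)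
    show "\<P>(w in M. ?D i w = int u) = 1 / real n"
      if n: "2 \<le> n" and u: "u \<in> {1..n}" and i: "i \<in> {IU1 (Suc n), IU2 (Suc n)}" for n u i
    proof -
      have "pmf (pmf_of_set {1..n}) u = 1 / real n" using u by (subst pmf_of_set) auto
      then show ?thesis
        using i prob_eq_pmf[OF U_meas(1)[OF n], of "pmf_of_set {1..n}" u] prob_eq_pmf[OF U_meas(2)[OF n], of "pmf_of_set {1..n}" u]
          U1[OF n] U2[OF n] by auto
    qed
    show "\<P>(w in M. ?D i w = 1) = p \<and> \<P>(w in M. ?D i w = -1) = 1 - p"
      if n: "2 \<le> n" and i: "i \<in> {IA1 (Suc n), IA2 (Suc n)}" for n i
      using i prob_eq_pmf[OF A_meas(1)[OF n], of "rad_pmf p"] prob_eq_pmf[OF A_meas(2)[OF n], of "rad_pmf p"]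
        A1[OF n] A2[OF n] assms(2,3) by (auto simp: pmf_rad)
  qed (use assms indep in auto)
  \<comment> \<open>The limit is obtained for the modified walk \<open>Xd\<close> driven by the same
    draws.\<close>
  obtain R :: "'a \<Rightarrow> int" where R: "R \<in> measurable M (count_space UNIV)"
    "distr M (count_space UNIV) R = measure_pmf (rad_pmf (1/2))"
    "AE w in M. (\<lambda>n. real_of_int (walk_S Xd n w) / real n) \<longlonglongrightarrow> c_p p * real_of_int (R w)"
    using Xd.limit_law[OF assms(4)] by blast
  have "AE w in M. \<forall>i\<in>{1, 2}. X i w \<in> {-1, 1}"
  proof -
    have "set_pmf (rad_pmf (1/2)) \<subseteq> {-1, 1}" by (auto simp: rad_pmf_def)
    then have "AE w in M. X i w \<in> {-1, 1}" if "i \<in> {1, 2}" for i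
      using AE_in_set_pmf[OF X_meas X_law, OF that that] by (auto elim: eventually_mono)
    then show ?thesis by auto
  qed
  moreover have "AE w in M. \<forall>n. 2 \<le> n \<longrightarrow> U1 (Suc n) w \<in> {1..n} \<and> U2 (Suc n) w \<in> {1..n}"
  proof (subst AE_all_countable, intro allI)
    fix n :: nat
    show "AE w in M. 2 \<le> n \<longrightarrow> U1 (Suc n) w \<in> {1..n} \<and> U2 (Suc n) w \<in> {1..n}"
    proof (cases "2 \<le> n")
      case True
      have "AE w in M. U1 (Suc n) w \<in> set_pmf (pmf_of_set {1..n})"
        by (rule AE_in_set_pmf[OF U_meas(1)[OF True]]) (use U1[OF True] in simp)
      moreover have "AE w in M. U2 (Suc n) w \<in> set_pmf (pmf_of_set {1..n})"
        by (rule AE_in_set_pmf[OF U_meas(2)[OF True]]) (use U2[OF True] in simp)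
      moreover have "set_pmf (pmf_of_set {1..n}) = {1..n}" using True by (intro set_pmf_of_set) auto
      ultimately show ?thesis by auto
    qed simp
  qed
  \<comment> \<open>Outside countably many null events all indices are in range and the first two
    steps are signs; there both walks satisfy the same recursion.\<close>
  ultimately have "AE w in M. \<forall>n\<ge>1. X n w = Xd n w"
    using AE_space
  proof eventually_elim
    case (elim w)
    have "X n w = Xd n w" if "n \<ge> 1" for n
      using that
    proof (induction n rule: less_induct)
      case (less n)
      show ?case
      proof (cases "n \<le> 2")
        case True
        then have "n \<in> {1, 2}" using less.prems by auto
        then show ?thesis using elim(1) by (auto simp: Xd_def walk_of.simps[of _ "Suc 0"] walk_of.simps[of _ 2])
      next
        case False
        then obtain k where k: "n = Suc k" "2 \<le> k" by (cases n) auto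
        have U: "U1 n w \<in> {1..k}" "U2 n w \<in> {1..k}" using elim(2) k by auto
        have IH: "X (U1 n w) w = Xd (U1 n w) w" "X (U2 n w) w = Xd (U2 n w) w"
          using U k by (auto intro!: less.IH)
        have "Xd n w = clamp1 (A1 n w * Xd (U1 n w) w + A2 n w * Xd (U2 n w) w)"
          using U k unfolding Xd_def by (subst walk_of.simps) auto
        then show ?thesis using rec[OF k(2) elim(3)] IH k by simp
      qed
    qed
    then show ?case by blast
  qed
  then have "AE w in M. (\<lambda>n. real_of_int (walk_S X n w) / real n) \<longlonglongrightarrow> c_p p * real_of_int (R w)"
    using R(3)
  proof eventually_elim
    case (elim w)
    have "walk_S X n w = walk_S Xd n w" for n
      unfolding walk_S_def using elim(1) by (intro sum.cong) auto
    then show ?case using elim(2) by simp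
  qed
  then show ?thesis using R(1,2) by blast
qed

end
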